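(* Let $\theta$ be an inner function and let $1 \le p < \infty$. Take a function $g \in \bar\theta H^p$ and denote by $p_g$ its best $H^p$-approximation. The function $g - p_g$ can be uniquely represented in the form $$g - p_g = c \cdot \bar\theta\, I F^{2/p},$$ where $c = \operatorname{dist}_{L^p}(g, H^p)$, $F$ is an outer function in $K^2_\theta$ of unit norm, $F(0) > 0$, and $I$ is an inner function such that $IF \in K^2_\theta$.
   Context: $\mathbb{T}$ is the unit circle with normalized Lebesgue measure $m$, $L^p = L^p(\mathbb{T}, m)$, and $H^p$ is the Hardy space in the open unit disk, identified with a closed subspace of $L^p$ via angular boundary values. A bounded analytic function $\theta$ in the open unit disk is inner if $|\theta| = 1$ a.e. on $\mathbb{T}$ in the sense of angular boundary values. $\bar\theta H^p = \{\bar\theta h : h \in H^p\} \subset L^p$. The coinvariant subspace is $K^2_\theta = H^2 \cap \bar z \theta\, \overline{H^2}$ (as functions on $\mathbb{T}$), where $\overline{H^2} = \{\bar f : f \in H^2\}$; "unit norm" refers to the $L^2$ norm. The best $H^p$-approximation of $g$ is the function $p_g \in H^p$ with $\|g - p_g\|_{L^p} = \operatorname{dist}_{L^p}(g, H^p) = \inf_{h \in H^p}\|g-h\|_{L^p}$; for $1 \le p < \infty$ it exists and is unique. Since an outer function $F$ has no zeros in the disk and $F(0)>0$, $F^{2/p}$ denotes the analytic branch in the disk that is positive at $0$ (and its boundary values on $\mathbb{T}$). Uniqueness of the representation means that the functions $I$, $F$ with the listed properties are determined uniquely.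
   Formalization: The inner function θ is assumed nonconstant (otherwise K²_θ = {0} has no unit vector), and uniqueness of I and F is asserted only for g not in H^p (otherwise c = 0 and I may be replaced by −I); existence is still proved for g in H^p. *)

theory Defs
  imports "HOL-Complex_Analysis.Complex_Analysis"
begin

definition circle_measure :: "complex measure" where
  "circle_measure =
     distr (uniform_measure lborel {0..2 * pi}) (restrict_space borel (sphere 0 1)) cis"

text \<open>Elements of \<open>L\<^sup>p\<close> are represented by Borel functions, not by classes modulo null sets;
  equality in \<open>L\<^sup>p\<close> is therefore written out as almost everywhere equality.\<close>

definition Lp :: "real \<Rightarrow> (complex \<Rightarrow> complex) set" where
  "Lp p = {f \<in> borel_measurable circle_measure.
             integrable circle_measure (\<lambda>\<zeta>. norm (f \<zeta>) powr p)}"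

definition Lp_norm :: "real \<Rightarrow> (complex \<Rightarrow> complex) \<Rightarrow> real" where
  "Lp_norm p f = (\<integral>\<zeta>. norm (f \<zeta>) powr p \<partial>circle_measure) powr (1 / p)"

definition stolz_region :: "real \<Rightarrow> complex \<Rightarrow> complex set" where
  "stolz_region \<alpha> \<zeta> = {z \<in> ball 0 1. norm (z - \<zeta>) < \<alpha> * (1 - norm z)}"

definition has_angular_limit :: "(complex \<Rightarrow> complex) \<Rightarrow> complex \<Rightarrow> complex \<Rightarrow> bool" where
  "has_angular_limit f \<zeta> w \<longleftrightarrow>
     (\<forall>\<alpha>>1. (f \<longlongrightarrow> w) (at \<zeta> within stolz_region \<alpha> \<zeta>))"

text \<open>The value 0 where no angular limit exists is a dummy; for the functions considered below
  this concerns only a null set of points.\<close>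

definition bdry :: "(complex \<Rightarrow> complex) \<Rightarrow> complex \<Rightarrow> complex" where
  "bdry f \<zeta> =
     (if \<exists>w. has_angular_limit f \<zeta> w then THE w. has_angular_limit f \<zeta> w else 0)"

text \<open>\<open>hardy p\<close> consists of functions on the disk (their values outside the disk are irrelevant),
  \<open>hardy_circle p\<close> is its copy inside \<open>L\<^sup>p\<close>.\<close>

definition hardy :: "real \<Rightarrow> (complex \<Rightarrow> complex) set" where
  "hardy p = {f. f holomorphic_on ball 0 1 \<and>
                 (\<exists>B. \<forall>r\<in>{0..<1}.
                    (\<integral>\<zeta>. norm (f (of_real r * \<zeta>)) powr p \<partial>circle_measure) \<le> B)}"

definition hardy_circle :: "real \<Rightarrow> (complex \<Rightarrow> complex) set" where
  "hardy_circle p = {\<phi> \<in> Lp p. \<exists>f\<in>hardy p. AE \<zeta> in circle_measure. \<phi> \<zeta> = bdry f \<zeta>}"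

definition inner_function :: "(complex \<Rightarrow> complex) \<Rightarrow> bool" where
  "inner_function \<theta> \<longleftrightarrow>
     \<theta> holomorphic_on ball 0 1 \<and> bounded (\<theta> ` ball 0 1) \<and>
     (AE \<zeta> in circle_measure. norm (bdry \<theta> \<zeta>) = 1)"

text \<open>Here \<open>u\<close> is the logarithm of the boundary modulus of \<open>F\<close>.\<close>

definition outer_function :: "(complex \<Rightarrow> complex) \<Rightarrow> bool" where
  "outer_function F \<longleftrightarrow>
     (\<exists>(u :: complex \<Rightarrow> real) \<alpha>. integrable circle_measure u \<and> norm \<alpha> = 1 \<and>
        (\<forall>z\<in>ball 0 1. F z =
           \<alpha> * exp (\<integral>\<zeta>. (\<zeta> + z) / (\<zeta> - z) * of_real (u \<zeta>) \<partial>circle_measure)))"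

definition conj_mult_hardy :: "(complex \<Rightarrow> complex) \<Rightarrow> real \<Rightarrow> (complex \<Rightarrow> complex) set" where
  "conj_mult_hardy \<theta> p =
     {g \<in> Lp p. \<exists>h\<in>hardy p. AE \<zeta> in circle_measure. g \<zeta> = cnj (bdry \<theta> \<zeta>) * bdry h \<zeta>}"

definition model_space :: "(complex \<Rightarrow> complex) \<Rightarrow> (complex \<Rightarrow> complex) set" where
  "model_space \<theta> =
     {F \<in> hardy 2. \<exists>f\<in>hardy 2.
        AE \<zeta> in circle_measure. bdry F \<zeta> = cnj \<zeta> * bdry \<theta> \<zeta> * cnj (bdry f \<zeta>)}"

definition dist_hardy :: "real \<Rightarrow> (complex \<Rightarrow> complex) \<Rightarrow> real" where
  "dist_hardy p g = (INF h\<in>hardy p. Lp_norm p (\<lambda>\<zeta>. g \<zeta> - bdry h \<zeta>))"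

definition best_hardy_approx ::
  "real \<Rightarrow> (complex \<Rightarrow> complex) \<Rightarrow> (complex \<Rightarrow> complex) \<Rightarrow> bool" where
  "best_hardy_approx p g q \<longleftrightarrow>
     q \<in> hardy p \<and> Lp_norm p (\<lambda>\<zeta>. g \<zeta> - bdry q \<zeta>) = dist_hardy p g"

text \<open>For zero-free holomorphic \<open>F\<close> with \<open>F 0 > 0\<close> the chosen logarithm is unique on the disk,
  and \<open>disk_power F a\<close> is the branch of the power that is positive at \<open>0\<close>.\<close>

definition disk_log :: "(complex \<Rightarrow> complex) \<Rightarrow> complex \<Rightarrow> complex" where
  "disk_log F = (SOME L. L holomorphic_on ball 0 1 \<and>
                         (\<forall>z\<in>ball 0 1. exp (L z) = F z) \<and> Im (L 0) = 0)"

definition disk_power :: "(complex \<Rightarrow> complex) \<Rightarrow> real \<Rightarrow> complex \<Rightarrow> complex" where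
  "disk_power F a z = exp (of_real a * disk_log F z)"

definition is_representation ::
  "(complex \<Rightarrow> complex) \<Rightarrow> real \<Rightarrow> (complex \<Rightarrow> complex) \<Rightarrow> (complex \<Rightarrow> complex) \<Rightarrow>
   (complex \<Rightarrow> complex) \<Rightarrow> (complex \<Rightarrow> complex) \<Rightarrow> bool" where
  "is_representation \<theta> p g q I F \<longleftrightarrow>
     outer_function F \<and> F \<in> model_space \<theta> \<and> Lp_norm 2 (bdry F) = 1 \<and>
     Im (F 0) = 0 \<and> Re (F 0) > 0 \<and>
     inner_function I \<and> (\<lambda>z. I z * F z) \<in> model_space \<theta> \<and>
     (AE \<zeta> in circle_measure.
        g \<zeta> - bdry q \<zeta> =
          of_real (dist_hardy p g) * cnj (bdry \<theta> \<zeta>) * bdry I \<zeta> * bdry (disk_power F (2 / p)) \<zeta>)"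

end

theory Submission
  imports Defs
begin

text \<open>Let \<open>e\<close> be the error of best approximation and \<open>c = \<parallel>e\<parallel>\<^sub>p > 0\<close>. Since \<open>\<theta> g\<close> belongs to
  \<open>H\<^sup>p\<close>, \<open>\<theta> e\<close> is the boundary function of some \<open>G \<in> H\<^sup>p\<close>; in particular \<open>e \<noteq> 0\<close> almost
  everywhere, so \<open>t \<mapsto> \<parallel>e - t k\<parallel>\<^sub>p\<close> can be differentiated under the integral for every \<open>p \<ge> 1\<close>.
  Minimality says that \<open>\<phi> = \<bar>e\<bar>\<^sup>p / e\<close> has vanishing moments \<open>\<integral> \<zeta>\<^sup>n \<phi>\<close> for \<open>n \<ge> 0\<close>, that is, \<open>\<phi>\<close> is the boundary
  function of an analytic \<open>\<Phi>\<close> with \<open>\<Phi> 0 = 0\<close>. Then \<open>\<bar>e\<bar>\<^sup>p = conj \<theta> \<cdot> G \<Phi>\<close>, and the inner-outer factorizations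
  \<open>G = I \<cdot> O\<^sub>1\<close>, \<open>\<Phi> = z I\<^sub>2 \<cdot> O\<^sub>2\<close> have outer parts of modulus \<open>\<bar>e\<bar>\<close> and \<open>\<bar>e\<bar>\<^sup>p\<^sup>-\<^sup>1\<close>. With the outer function \<open>F\<close> of
  modulus \<open>(\<bar>e\<bar>/c)\<^sup>p\<^sup>/\<^sup>2\<close>, a unit vector of \<open>H\<^sup>2\<close>, this reads \<open>\<theta> \<bar>F\<bar>\<^sup>2 = \<zeta> I I\<^sub>2 F\<^sup>2\<close>, that is
  \<open>F = conj \<zeta> \<theta> conj (I I\<^sub>2 F)\<close> and \<open>I F = conj \<zeta> \<theta> conj (I\<^sub>2 F)\<close>, which are the two memberships in the
  model space, while \<open>G = I \<cdot> c F\<^sup>2\<^sup>/\<^sup>p\<close> is the representation. Uniqueness holds because the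
  representation determines \<open>\<bar>F\<bar>\<close> on the circle, hence the outer function \<open>F\<close>, and then \<open>I\<close>.
  If \<open>c = 0\<close>, the normalized reproducing kernel of the model space serves as \<open>F\<close>, with \<open>I = 1\<close>.

  The factorization rests on the inequality \<open>log \<bar>f\<bar> \<le> P[log \<bar>f\<^sup>*\<bar>]\<close> between an analytic function and the
  Poisson integral of its boundary values. For bounded \<open>f\<close> it follows from the Poisson representation
  (\<open>bounded_analytic_bdry\<close>) on dividing by an outer function (\<open>bounded_analytic_log_bdry\<close>). An \<open>H\<^sup>1\<close>
  function is a quotient of bounded functions whose denominator has positive real part, which carries
  angular limits and the inequality over to \<open>H\<^sup>1\<close> (\<open>hardy_1_bdry\<close>). Angular limits themselves come from
  Fatou's theorem for Poisson integrals (\<open>poisson_angular_limit\<close>), a consequence of a weak-type maximal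
  inequality.\<close>

section \<open>Integration over the circle\<close>

lemma space_circle_measure [simp]: "space circle_measure = sphere 0 1"
  by (simp add: circle_measure_def)

lemma sets_circle_measure [measurable_cong]:
  "sets circle_measure = sets (restrict_space borel (sphere 0 1))"
  by (simp add: circle_measure_def)

lemma cis_measurable_circle: "cis \<in> measurable lborel (restrict_space borel (sphere 0 1))"
proof (rule measurable_restrict_space2)
  show "cis \<in> borel_measurable lborel"
    by (simp add: borel_measurable_continuous_onI continuous_on_cis)
qed auto

lemma cis_measurable_uniform:
  "cis \<in> measurable (uniform_measure lborel {0..2 * pi}) (restrict_space borel (sphere 0 1))"
  using cis_measurable_circle by (simp cong: measurable_cong_sets)

lemma circle_measure_UNIV: "emeasure circle_measure (sphere 0 1) = 1"
proof -
  have "emeasure circle_measure (sphere 0 1)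
      = emeasure (uniform_measure lborel {0..2 * pi}) (cis -` sphere 0 1 \<inter> UNIV)"
    unfolding circle_measure_def
    by (subst emeasure_distr[OF cis_measurable_uniform]) (auto simp: sets_restrict_space)
  also have "cis -` sphere 0 1 \<inter> UNIV = UNIV"
    by auto
  also have "emeasure (uniform_measure lborel {0..2 * pi}) UNIV = 1"
    by (subst emeasure_uniform_measure) (auto simp: ennreal_divide_self)
  finally show ?thesis .
qed

interpretation circle: finite_measure circle_measure
  by standard (simp add: circle_measure_UNIV)

lemma measure_circle_space [simp]: "measure circle_measure (sphere 0 1) = 1"
  by (simp add: measure_def circle_measure_UNIV)

lemma measurable_circle_eq:
  "borel_measurable circle_measure = borel_measurable (restrict_space borel (sphere 0 1))"
  by (rule measurable_cong_sets[OF sets_circle_measure refl])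

lemma continuous_measurable_circle:
  "continuous_on (sphere 0 1) f \<Longrightarrow> f \<in> borel_measurable circle_measure"
  unfolding measurable_circle_eq by (rule borel_measurable_continuous_on_restrict)

lemma borel_measurable_circle:
  "f \<in> borel_measurable borel \<Longrightarrow> f \<in> borel_measurable circle_measure"
  unfolding measurable_circle_eq by (rule measurable_restrict_space1)

lemma ident_measurable_circle [measurable]: "(\<lambda>\<zeta>. \<zeta>) \<in> borel_measurable circle_measure"
  by (rule borel_measurable_circle) simp

lemma Int_sphere_in_sets_circle: "A \<in> sets borel \<Longrightarrow> sphere 0 1 \<inter> A \<in> sets circle_measure"
  by (auto simp: sets_circle_measure sets_restrict_space)

lemma integrable_circle_bounded:
  fixes f :: "complex \<Rightarrow> 'a::{banach, second_countable_topology}"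
  assumes "f \<in> borel_measurable circle_measure" "\<And>\<zeta>. norm \<zeta> = 1 \<Longrightarrow> norm (f \<zeta>) \<le> B"
  shows "integrable circle_measure f"
  using assms by (intro circle.integrable_const_bound[where B = B]) auto

lemma integrable_circle_continuous:
  fixes f :: "complex \<Rightarrow> 'a::{banach, second_countable_topology}"
  assumes "continuous_on (sphere 0 1) f"
  shows "integrable circle_measure f"
proof -
  have "compact (f ` sphere 0 1)"
    by (rule compact_continuous_image[OF assms]) auto
  then obtain B where "\<And>x. x \<in> f ` sphere 0 1 \<Longrightarrow> norm x \<le> B"
    using compact_imp_bounded bounded_iff by metis
  with assms show ?thesis
    by (intro integrable_circle_bounded[where B = B] continuous_measurable_circle) auto
qed

text \<open>The integral against normalized arc length is a parametrized interval integral; this is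
  the bridge to the contour integrals of the Cauchy theory.\<close>

lemma circle_integral_eq_interval:
  fixes f :: "complex \<Rightarrow> complex"
  assumes "continuous_on (sphere 0 1) f"
  shows "((\<lambda>t. f (cis t)) has_integral (2 * of_real pi * (\<integral>\<zeta>. f \<zeta> \<partial>circle_measure))) {0..2 * pi}"
proof -
  have m: "f \<in> borel_measurable (restrict_space borel (sphere 0 1))"
    by (rule borel_measurable_continuous_on_restrict[OF assms])
  have m': "(\<lambda>t. f (cis t)) \<in> borel_measurable lborel"
    using measurable_compose[OF cis_measurable_circle m] by simp
  have cont: "continuous_on {0..2 * pi} (\<lambda>t. f (cis t))"
    by (rule continuous_on_compose2[OF assms]) (auto intro: continuous_on_cis)
  have "(\<integral>\<zeta>. f \<zeta> \<partial>circle_measure) = (\<integral>t. f (cis t) \<partial>uniform_measure lborel {0..2 * pi})"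
    unfolding circle_measure_def by (rule integral_distr[OF cis_measurable_uniform m])
  also have "uniform_measure lborel {0..2 * pi}
      = density lborel (\<lambda>t. ennreal (indicator {0..2 * pi} t / (2 * pi)))"
    unfolding uniform_measure_def
    by (intro arg_cong2[where f = density] refl ext)
       (auto simp: indicator_def divide_ennreal[symmetric] ennreal_1[symmetric] simp del: ennreal_1)
  also have "(\<integral>t. f (cis t) \<partial>density lborel (\<lambda>t. ennreal (indicator {0..2 * pi} t / (2 * pi))))
      = (\<integral>t. (indicator {0..2 * pi} t / (2 * pi)) *\<^sub>R f (cis t) \<partial>lborel)"
    by (rule integral_density) (use m' in auto)
  also have "\<dots> = (1 / (2 * pi)) *\<^sub>R (LINT t : {0..2 * pi} | lborel. f (cis t))"
    unfolding set_lebesgue_integral_def integral_scaleR_right[symmetric]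
    by (intro Bochner_Integration.integral_cong) auto
  finally have 1: "(\<integral>\<zeta>. f \<zeta> \<partial>circle_measure)
      = (1 / (2 * pi)) *\<^sub>R (LINT t : {0..2 * pi} | lborel. f (cis t))" .
  have si: "set_integrable lborel {0..2 * pi} (\<lambda>t. f (cis t))"
    by (rule borel_integrable_atLeastAtMost'[OF cont])
  have "((\<lambda>t. f (cis t)) has_integral (LINT t : {0..2 * pi} | lborel. f (cis t))) {0..2 * pi}"
    using set_borel_integral_eq_integral[OF si] by (simp add: has_integral_integral)
  moreover have "(LINT t : {0..2 * pi} | lborel. f (cis t))
      = 2 * of_real pi * (\<integral>\<zeta>. f \<zeta> \<partial>circle_measure)"
    by (simp add: 1 scaleR_conv_of_real)
  ultimately show ?thesis
    by simp
qed

lemma circle_Cauchy_formula: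
  assumes "continuous_on (cball 0 1) f" "f holomorphic_on ball 0 1" "norm w < 1"
  shows "(\<integral>\<zeta>. \<zeta> / (\<zeta> - w) * f \<zeta> \<partial>circle_measure) = f w"
proof -
  have nz: "\<zeta> - w \<noteq> 0" if "norm \<zeta> = 1" for \<zeta>
    using that assms(3) by auto
  have cont: "continuous_on (sphere 0 1) (\<lambda>\<zeta>. \<zeta> / (\<zeta> - w) * f \<zeta>)"
    using nz by (intro continuous_intros continuous_on_subset[OF assms(1)]) auto
  have "((\<lambda>t. f (cis t) / (cis t - w) * (\<i> * cis t)) has_integral (2 * of_real pi * \<i> * f w)) {0..2 * pi}"
    using Cauchy_integral_circlepath[OF assms(1,2), of w] assms(3)
    by (simp add: circlepath_def has_contour_integral_part_circlepath_iff mult_ac)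
  from has_integral_mult_right[OF this, of "- \<i>"]
  have "((\<lambda>t. cis t / (cis t - w) * f (cis t)) has_integral (2 * of_real pi * f w)) {0..2 * pi}"
    by (simp add: mult_ac)
  with circle_integral_eq_interval[OF cont] have "2 * of_real pi * f w
      = 2 * of_real pi * (\<integral>\<zeta>. \<zeta> / (\<zeta> - w) * f \<zeta> \<partial>circle_measure)"
    by (rule has_integral_unique[symmetric])
  then show ?thesis
    by simp
qed

lemma circle_mean_value:
  assumes "continuous_on (cball 0 1) f" "f holomorphic_on ball 0 1"
  shows "(\<integral>\<zeta>. f \<zeta> \<partial>circle_measure) = f 0"
proof -
  have "(\<integral>\<zeta>. f \<zeta> \<partial>circle_measure) = (\<integral>\<zeta>. \<zeta> / (\<zeta> - 0) * f \<zeta> \<partial>circle_measure)"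
    by (rule Bochner_Integration.integral_cong) auto
  with circle_Cauchy_formula[OF assms, of 0] show ?thesis
    by simp
qed

section \<open>The Poisson kernel\<close>

definition poisson_kernel :: "complex \<Rightarrow> complex \<Rightarrow> real" where
  "poisson_kernel z \<zeta> = (1 - (norm z)\<^sup>2) / (norm (\<zeta> - z))\<^sup>2"

definition poisson :: "(complex \<Rightarrow> 'a::{banach, second_countable_topology}) \<Rightarrow> complex \<Rightarrow> 'a" where
  "poisson u z = (\<integral>\<zeta>. poisson_kernel z \<zeta> *\<^sub>R u \<zeta> \<partial>circle_measure)"

lemma norm_diff_ge: "norm \<zeta> = 1 \<Longrightarrow> 1 - norm z \<le> norm (\<zeta> - z)" for \<zeta> z :: complex
  using norm_triangle_ineq2[of \<zeta> z] by simp

lemma poisson_kernel_continuous: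
  assumes "norm z < 1"
  shows "continuous_on (sphere 0 1) (poisson_kernel z)"
  unfolding poisson_kernel_def using assms by (intro continuous_intros) auto

lemma poisson_kernel_measurable [measurable]: "poisson_kernel z \<in> borel_measurable circle_measure"
  unfolding poisson_kernel_def by measurable

lemma poisson_kernel_pos:
  assumes "norm z < 1" "norm \<zeta> = 1"
  shows "poisson_kernel z \<zeta> > 0"
proof -
  have "(norm z)\<^sup>2 < 1" using assms(1) by (simp add: abs_square_less_1)
  moreover have "\<zeta> \<noteq> z" using assms by auto
  ultimately show ?thesis by (simp add: poisson_kernel_def)
qed

lemma poisson_kernel_le:
  assumes "norm z < 1" "norm \<zeta> = 1"
  shows "poisson_kernel z \<zeta> \<le> 2 / (1 - norm z)"
proof -
  have "(1 - norm z)\<^sup>2 \<le> (norm (\<zeta> - z))\<^sup>2"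
    using norm_diff_ge[of \<zeta> z] assms by (intro power_mono) auto
  moreover have "1 - (norm z)\<^sup>2 \<le> 2 * (1 - norm z)" "0 \<le> 1 - (norm z)\<^sup>2"
    using assms zero_le_power2[of "1 - norm z"] abs_square_le_1[of "norm z"]
    by (auto simp: power2_diff)
  ultimately have "poisson_kernel z \<zeta> \<le> 2 * (1 - norm z) / (1 - norm z)\<^sup>2"
    unfolding poisson_kernel_def using assms by (intro frac_le) auto
  also have "\<dots> = 2 / (1 - norm z)"
    using assms by (simp add: power2_eq_square divide_simps)
  finally show ?thesis .
qed

lemma poisson_kernel_ge:
  assumes "norm z < 1" "norm \<zeta> = 1"
  shows "(1 - norm z) / 4 \<le> poisson_kernel z \<zeta>"
proof -
  have "norm (\<zeta> - z) \<le> 2"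
    using norm_triangle_ineq4[of \<zeta> z] assms by simp
  then have "(norm (\<zeta> - z))\<^sup>2 \<le> 2\<^sup>2"
    by (intro power_mono) auto
  moreover have "1 - norm z \<le> 1 - (norm z)\<^sup>2"
    using assms by (simp add: power2_eq_square mult_left_le_one_le)
  moreover have "\<zeta> \<noteq> z" using assms by auto
  ultimately show ?thesis
    unfolding poisson_kernel_def using assms by (intro frac_le) auto
qed

lemma poisson_kernel_integrable:
  fixes u :: "complex \<Rightarrow> 'a::{banach, second_countable_topology}"
  assumes "norm z < 1" "integrable circle_measure u"
  shows "integrable circle_measure (\<lambda>\<zeta>. poisson_kernel z \<zeta> *\<^sub>R u \<zeta>)"
proof (rule Bochner_Integration.integrable_bound)
  show "integrable circle_measure (\<lambda>\<zeta>. (2 / (1 - norm z)) *\<^sub>R u \<zeta>)"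
    using assms by auto
  show "(\<lambda>\<zeta>. poisson_kernel z \<zeta> *\<^sub>R u \<zeta>) \<in> borel_measurable circle_measure"
    using assms(2) by measurable
  show "AE \<zeta> in circle_measure.
      norm (poisson_kernel z \<zeta> *\<^sub>R u \<zeta>) \<le> norm ((2 / (1 - norm z)) *\<^sub>R u \<zeta>)"
  proof (rule AE_I2)
    fix \<zeta> assume "\<zeta> \<in> space circle_measure"
    then have n: "norm \<zeta> = 1" by simp
    have "\<bar>poisson_kernel z \<zeta>\<bar> \<le> \<bar>2 / (1 - norm z)\<bar>"
      using poisson_kernel_le[OF assms(1) n] poisson_kernel_pos[OF assms(1) n] by linarith
    then show "norm (poisson_kernel z \<zeta> *\<^sub>R u \<zeta>) \<le> norm ((2 / (1 - norm z)) *\<^sub>R u \<zeta>)"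
      unfolding norm_scaleR by (rule mult_right_mono) simp
  qed
qed

text \<open>On the circle the Poisson kernel is the Cauchy kernel plus a function that is analytic in
  \<open>\<zeta>\<close> and vanishes at 0, so it reproduces analytic functions.\<close>

lemma poisson_kernel_split:
  assumes "norm \<zeta> = 1" "norm z < 1"
  shows "complex_of_real (poisson_kernel z \<zeta>) = \<zeta> / (\<zeta> - z) + cnj z * \<zeta> / (1 - cnj z * \<zeta>)"
proof -
  have ne: "\<zeta> - z \<noteq> 0" using assms by auto
  have zz: "\<zeta> * cnj \<zeta> = 1"
    using assms complex_norm_square[of \<zeta>] by simp
  then have z0: "\<zeta> \<noteq> 0" by auto
  then have ci: "cnj \<zeta> = 1 / \<zeta>" using zz by (simp add: field_simps)
  have e: "1 - cnj z * \<zeta> = \<zeta> * cnj (\<zeta> - z)"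
    using zz by (simp add: algebra_simps)
  have ne2: "1 - cnj z * \<zeta> \<noteq> 0"
    unfolding e using z0 ne by (metis complex_cnj_zero_iff mult_eq_0_iff)
  have "complex_of_real (poisson_kernel z \<zeta>) = (1 - z * cnj z) / ((\<zeta> - z) * cnj (\<zeta> - z))"
    unfolding poisson_kernel_def of_real_divide of_real_diff complex_norm_square by simp
  also have "\<dots> = (1 - z * cnj z) * \<zeta> / ((\<zeta> - z) * (1 - cnj z * \<zeta>))"
    unfolding e using z0 by simp
  also have "\<dots> = \<zeta> / (\<zeta> - z) + cnj z * \<zeta> / (1 - cnj z * \<zeta>)"
    using ne ne2 by (simp add: divide_simps) (simp add: algebra_simps)
  finally show ?thesis .
qed

lemma poisson_formula:
  fixes f :: "complex \<Rightarrow> complex"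
  assumes "continuous_on (cball 0 1) f" "f holomorphic_on ball 0 1" "norm z < 1"
  shows "poisson f z = f z"
proof -
  have nz: "1 - cnj z * \<zeta> \<noteq> 0" if "norm \<zeta> \<le> 1" for \<zeta>
  proof
    assume "1 - cnj z * \<zeta> = 0"
    then have "norm (cnj z * \<zeta>) = 1" by simp
    moreover have "norm z * norm \<zeta> \<le> norm z * 1" using that by (intro mult_left_mono) auto
    ultimately show False using assms(3) by (simp add: norm_mult)
  qed
  have nz1: "\<zeta> - z \<noteq> 0" if "norm \<zeta> = 1" for \<zeta>
    using that assms(3) by auto
  let ?k = "\<lambda>\<zeta>. cnj z * \<zeta> / (1 - cnj z * \<zeta>) * f \<zeta>"
  have "poisson f z = (\<integral>\<zeta>. \<zeta> / (\<zeta> - z) * f \<zeta> + ?k \<zeta> \<partial>circle_measure)"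
    unfolding poisson_def
    by (intro Bochner_Integration.integral_cong)
       (auto simp: poisson_kernel_split assms scaleR_conv_of_real ring_distribs)
  also have "\<dots> = (\<integral>\<zeta>. \<zeta> / (\<zeta> - z) * f \<zeta> \<partial>circle_measure) + (\<integral>\<zeta>. ?k \<zeta> \<partial>circle_measure)"
    using nz nz1 by (intro Bochner_Integration.integral_add integrable_circle_continuous
        continuous_intros continuous_on_subset[OF assms(1)]) auto
  also have "(\<integral>\<zeta>. ?k \<zeta> \<partial>circle_measure) = ?k 0"
    using nz by (intro circle_mean_value continuous_intros holomorphic_intros assms) auto
  also have "(\<integral>\<zeta>. \<zeta> / (\<zeta> - z) * f \<zeta> \<partial>circle_measure) = f z"
    by (rule circle_Cauchy_formula[OF assms])
  finally show ?thesis by simp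
qed

lemma poisson_const:
  assumes "norm z < 1"
  shows "(\<integral>\<zeta>. poisson_kernel z \<zeta> \<partial>circle_measure) = 1"
proof -
  have "complex_of_real (\<integral>\<zeta>. poisson_kernel z \<zeta> \<partial>circle_measure) = poisson (\<lambda>_. 1 :: complex) z"
    unfolding poisson_def by (simp add: scaleR_conv_of_real)
  also have "\<dots> = 1"
    by (rule poisson_formula) (use assms in auto)
  finally show ?thesis
    by simp
qed

text \<open>The Poisson kernel of the point \<open>(1 - r) \<zeta>\<close> is at least \<open>1/(4r)\<close> on the arc and has total
  mass one.\<close>

lemma measure_arc_le:
  assumes "norm \<zeta> = 1" "r > 0"
  shows "measure circle_measure (sphere 0 1 \<inter> ball \<zeta> r) \<le> 4 * r"
proof (cases "r < 1")
  case False
  have "measure circle_measure (sphere 0 1 \<inter> ball \<zeta> r) \<le> measure circle_measure (space circle_measure)"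
    by (rule circle.bounded_measure)
  with False show ?thesis by simp
next
  case True
  define z where "z = of_real (1 - r) * \<zeta>"
  have nz: "norm z = 1 - r"
    using assms True by (simp add: z_def norm_mult del: of_real_diff)
  have nz1: "norm z < 1" using nz assms by simp
  let ?A = "sphere 0 1 \<inter> ball \<zeta> r"
  have A: "?A \<in> sets circle_measure" by (rule Int_sphere_in_sets_circle) auto
  have zz: "norm (\<zeta> - z) = r"
  proof -
    have "\<zeta> - z = of_real r * \<zeta>" by (simp add: z_def algebra_simps)
    then show ?thesis using assms by (simp add: norm_mult)
  qed
  have "measure circle_measure ?A * (1 / (4 * r)) = (\<integral>\<xi>. indicator ?A \<xi> * (1 / (4 * r)) \<partial>circle_measure)"
    using A circle.emeasure_finite[of ?A] by (simp add: less_top Int_absorb2 Int_absorb1)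
  also have "\<dots> \<le> (\<integral>\<xi>. poisson_kernel z \<xi> \<partial>circle_measure)"
  proof (rule integral_mono)
    show "integrable circle_measure (\<lambda>\<xi>. indicator ?A \<xi> * (1 / (4 * r)))"
      by (intro integrable_mult_left integrable_real_indicator A)
        (metis circle.emeasure_finite infinity_ennreal_def top.not_eq_extremum)
    show "integrable circle_measure (poisson_kernel z)"
      by (rule integrable_circle_continuous[OF poisson_kernel_continuous[OF nz1]])
    fix \<xi> assume "\<xi> \<in> space circle_measure"
    then have n: "norm \<xi> = 1" by simp
    show "indicator ?A \<xi> * (1 / (4 * r)) \<le> poisson_kernel z \<xi>"
    proof (cases "\<xi> \<in> ?A")
      case True
      then have "norm (\<xi> - z) \<le> 2 * r"
        using norm_triangle_ineq[of "\<xi> - \<zeta>" "\<zeta> - z"] zz by (auto simp: dist_norm norm_minus_commute)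
      then have "(norm (\<xi> - z))\<^sup>2 \<le> (2 * r)\<^sup>2" by (intro power_mono) auto
      moreover have "r \<le> 1 - (norm z)\<^sup>2"
        using \<open>r < 1\<close> assms(2) unfolding nz
        using mult_left_le[of r r] by (simp add: power2_diff) (simp add: power2_eq_square)
      moreover have "\<xi> \<noteq> z" using n nz1 by auto
      ultimately have "r / (2 * r)\<^sup>2 \<le> poisson_kernel z \<xi>"
        unfolding poisson_kernel_def using assms by (intro frac_le) auto
      then show ?thesis
        using True assms by (simp add: power2_eq_square divide_simps)
    qed (use poisson_kernel_pos[OF nz1 n] in auto)
  qed
  also have "\<dots> = 1" by (rule poisson_const[OF nz1])
  finally show ?thesis
    using assms by (simp add: field_simps)
qed

section \<open>A maximal inequality for arcs\<close>

text \<open>Every point where some arc average exceeds \<open>\<kappa>\<close> is the centre of such an arc. By the Vitali covering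
  lemma countably many disjoint ones among these arcs, enlarged five times, cover all such points; arcs
  of radius \<open>5r\<close> have measure at most \<open>20r\<close>. The set where \<open>u \<ge> \<kappa>\<close> is added to the exceptional set
  at the cost of Markov's inequality, whence 21.\<close>

lemma maximal_weak_type:
  fixes u :: "complex \<Rightarrow> real"
  assumes u: "integrable circle_measure u" "\<And>\<zeta>. u \<zeta> \<ge> 0" and "\<kappa> > 0"
  obtains N where "N \<in> sets circle_measure"
    "measure circle_measure N \<le> 21 / \<kappa> * (\<integral>\<zeta>. u \<zeta> \<partial>circle_measure)"
    "\<And>\<zeta> r. norm \<zeta> = 1 \<Longrightarrow> \<zeta> \<notin> N \<Longrightarrow> r > 0 \<Longrightarrow>
       (\<integral>\<xi>. indicator (sphere 0 1 \<inter> ball \<zeta> r) \<xi> * u \<xi> \<partial>circle_measure) \<le> \<kappa> * r"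
    "\<And>\<zeta>. norm \<zeta> = 1 \<Longrightarrow> \<zeta> \<notin> N \<Longrightarrow> u \<zeta> \<le> \<kappa>"
proof -
  let ?M = circle_measure
  define I where "I = (\<integral>\<zeta>. u \<zeta> \<partial>?M)"
  have I0: "I \<ge> 0" unfolding I_def by (rule integral_nonneg_AE) (use u in auto)
  define arc where "arc = (\<lambda>p :: complex \<times> real. sphere 0 1 \<inter> ball (fst p) (snd p))"
  have arcM: "arc p \<in> sets ?M" for p
    unfolding arc_def by (rule Int_sphere_in_sets_circle) auto
  define J where "J = (\<lambda>A. \<integral>\<xi>. indicator A \<xi> * u \<xi> \<partial>?M)"
  have Jint: "integrable ?M (\<lambda>\<xi>. indicator A \<xi> * u \<xi>)" if "A \<in> sets ?M" for A
    using integrable_mult_indicator[OF that u(1)] by simp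
  have JI: "J A \<le> I" if "A \<in> sets ?M" for A
    unfolding J_def I_def by (rule integral_mono[OF Jint[OF that] u(1)]) (auto simp: indicator_def u(2))
  \<comment> \<open>an arc is encoded as the pair of its centre and radius\<close>
  define K where "K = {p. norm (fst p) = 1 \<and> snd p > 0 \<and> J (arc p) > \<kappa> * snd p}"
  have KB: "0 < snd p \<and> snd p \<le> I / \<kappa>" if "p \<in> K" for p
  proof -
    from that have "snd p > 0" "\<kappa> * snd p < J (arc p)" by (auto simp: K_def)
    with JI[OF arcM[of p]] have "\<kappa> * snd p \<le> I" by simp
    with \<open>\<kappa> > 0\<close> \<open>snd p > 0\<close> show ?thesis by (simp add: field_simps)
  qed
  obtain C where C: "countable C" "C \<subseteq> K"
    "pairwise (\<lambda>i j. disjnt (cball (fst i) (snd i)) (cball (fst j) (snd j))) C"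
    "\<And>i. i \<in> K \<Longrightarrow> \<exists>j. j \<in> C \<and> \<not> disjnt (cball (fst i) (snd i)) (cball (fst j) (snd j)) \<and>
            cball (fst i) (snd i) \<subseteq> ball (fst j) (5 * snd j)"
    using Vitali_covering_lemma_cballs_balls[of K snd "I / \<kappa>" fst, OF KB] by blast
  \<comment> \<open>the countable family is indexed by natural numbers, with empty arcs as padding\<close>
  define e where "e = from_nat_into C"
  define S where "S = to_nat_on C ` C"
  have eC: "e n \<in> C" if "n \<in> S" for n
    using that C(1) by (auto simp: S_def e_def)
  have e_inj: "e m \<noteq> e n" if "m \<in> S" "n \<in> S" "m \<noteq> n" for m n
    using that C(1) by (auto simp: S_def e_def)
  define A where "A = (\<lambda>n. if n \<in> S then arc (fst (e n), 5 * snd (e n)) else {})"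
  define B where "B = (\<lambda>n. if n \<in> S then arc (e n) else {})"
  have AM: "A n \<in> sets ?M" and BM: "B n \<in> sets ?M" for n
    unfolding A_def B_def using arcM by auto
  have disj: "disjoint_family B"
    unfolding disjoint_family_on_def
  proof (intro ballI impI)
    fix m n :: nat assume "m \<noteq> n"
    show "B m \<inter> B n = {}"
    proof (cases "m \<in> S \<and> n \<in> S")
      case True
      then have "disjnt (cball (fst (e m)) (snd (e m))) (cball (fst (e n)) (snd (e n)))"
        using C(3) eC e_inj \<open>m \<noteq> n\<close> by (auto simp: pairwise_def)
      moreover have "B m \<subseteq> cball (fst (e m)) (snd (e m))" "B n \<subseteq> cball (fst (e n)) (snd (e n))"
        using True by (auto simp: B_def arc_def)
      ultimately show ?thesis
        unfolding disjnt_def by blast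
    qed (auto simp: B_def)
  qed
  have AB: "measure ?M (A n) \<le> 20 / \<kappa> * J (B n)" for n
  proof (cases "n \<in> S")
    case True
    then have "e n \<in> K" using eC C(2) by auto
    then have k: "norm (fst (e n)) = 1" "snd (e n) > 0" "J (arc (e n)) > \<kappa> * snd (e n)"
      by (auto simp: K_def)
    have "measure ?M (A n) \<le> 4 * (5 * snd (e n))"
      using measure_arc_le[OF k(1), of "5 * snd (e n)"] k(2) True by (simp add: A_def arc_def)
    also have "\<dots> = 20 / \<kappa> * (\<kappa> * snd (e n))" using \<open>\<kappa> > 0\<close> by simp
    also have "\<dots> \<le> 20 / \<kappa> * J (arc (e n))" using k(3) \<open>\<kappa> > 0\<close> by (intro mult_left_mono) auto
    finally show ?thesis using True by (simp add: B_def)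
  qed (auto simp: A_def B_def J_def)
  define N1 where "N1 = (\<Union>n. A n)"
  define N2 where "N2 = {\<zeta> \<in> space ?M. u \<zeta> \<ge> \<kappa>}"
  have um: "u \<in> borel_measurable ?M" using u(1) by auto
  have N1M: "N1 \<in> sets ?M" unfolding N1_def using AM by auto
  have N2M: "N2 \<in> sets ?M" unfolding N2_def using um by measurable
  have JBsum: "(\<Sum>n<k. J (B n)) \<le> I" for k
  proof -
    have "(\<Sum>n<k. J (B n)) = (\<integral>\<xi>. (\<Sum>n<k. indicator (B n) \<xi> * u \<xi>) \<partial>?M)"
      unfolding J_def by (rule Bochner_Integration.integral_sum[symmetric]) (rule Jint[OF BM])
    also have "\<dots> = J (\<Union>n<k. B n)"
      unfolding J_def sum_distrib_right[symmetric]
    proof (intro Bochner_Integration.integral_cong refl)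
      fix \<xi>
      have "disjoint_family_on B {..<k}"
        using disj by (auto simp: disjoint_family_on_def)
      then show "(\<Sum>n<k. indicator (B n) \<xi>) * u \<xi> = indicator (\<Union>n<k. B n) \<xi> * u \<xi>"
        by (simp add: indicator_UN_disjoint)
    qed
    also have "\<dots> \<le> I" by (rule JI) (use BM in auto)
    finally show ?thesis .
  qed
  have J0: "J (B n) \<ge> 0" for n
    unfolding J_def by (rule integral_nonneg_AE) (use u in auto)
  have sJ: "summable (\<lambda>n. J (B n))"
    using J0 JBsum by (intro summableI_nonneg_bounded) auto
  have sA: "summable (\<lambda>n. measure ?M (A n))"
    by (rule summable_comparison_test[OF _ summable_mult[OF sJ, of "20 / \<kappa>"]]) (use AB in auto)
  have "measure ?M N1 \<le> (\<Sum>n. measure ?M (A n))"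
    unfolding N1_def by (rule circle.finite_measure_subadditive_countably) (use AM sA in auto)
  also have "\<dots> \<le> (\<Sum>n. 20 / \<kappa> * J (B n))"
    by (rule suminf_le[OF AB sA summable_mult[OF sJ]])
  also have "\<dots> = 20 / \<kappa> * (\<Sum>n. J (B n))" by (rule suminf_mult[OF sJ])
  also have "\<dots> \<le> 20 / \<kappa> * I"
    using \<open>\<kappa> > 0\<close> by (intro mult_left_mono suminf_le_const sJ JBsum) auto
  finally have m1: "measure ?M N1 \<le> 20 / \<kappa> * I" .
  have m2: "measure ?M N2 \<le> I / \<kappa>"
    unfolding N2_def I_def
    using integral_Markov_inequality_measure[OF u(1), of "{}"] u(2) \<open>\<kappa> > 0\<close> by simp
  show thesis
  proof (rule that[of "N1 \<union> N2"])
    show "N1 \<union> N2 \<in> sets ?M" using N1M N2M by auto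
    have "measure ?M (N1 \<union> N2) \<le> measure ?M N1 + measure ?M N2"
      by (rule measure_Un_le[OF N1M N2M])
    with m1 m2 have "measure ?M (N1 \<union> N2) \<le> 20 / \<kappa> * I + I / \<kappa>" by linarith
    also have "\<dots> = 21 / \<kappa> * I" by (simp add: field_simps)
    finally show "measure ?M (N1 \<union> N2) \<le> 21 / \<kappa> * (\<integral>\<zeta>. u \<zeta> \<partial>?M)" by (simp add: I_def)
  next
    fix \<zeta> r assume z: "norm \<zeta> = 1" "\<zeta> \<notin> N1 \<union> N2" "(r::real) > 0"
    show "(\<integral>\<xi>. indicator (sphere 0 1 \<inter> ball \<zeta> r) \<xi> * u \<xi> \<partial>?M) \<le> \<kappa> * r"
    proof (rule ccontr)
      assume "\<not> ?thesis"
      then have "(\<zeta>, r) \<in> K" using z by (auto simp: K_def J_def arc_def)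
      from C(4)[OF this] obtain j where j: "j \<in> C" "cball \<zeta> r \<subseteq> ball (fst j) (5 * snd j)"
        by auto
      have "\<zeta> \<in> arc (fst j, 5 * snd j)"
        using subsetD[OF j(2), of \<zeta>] z by (simp add: arc_def)
      moreover have "A (to_nat_on C j) = arc (fst j, 5 * snd j)"
        using j(1) C(1) by (auto simp: A_def S_def e_def)
      ultimately have "\<zeta> \<in> N1" unfolding N1_def by blast
      with z show False by simp
    qed
  next
    fix \<zeta> assume "norm \<zeta> = 1" "\<zeta> \<notin> N1 \<union> N2"
    then show "u \<zeta> \<le> \<kappa>" by (auto simp: N2_def)
  qed
qed

text \<open>In a Stolz region \<open>\<xi>\<close> is, up to a constant, as far from \<open>z\<close> as from \<open>\<zeta>\<close>, so the kernel
  is dominated by averages over dyadic arcs around \<open>\<zeta>\<close> with geometrically decaying weights.\<close>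

lemma poisson_le_maximal:
  fixes u :: "complex \<Rightarrow> real"
  assumes u: "integrable circle_measure u" "\<And>\<zeta>. u \<zeta> \<ge> 0"
    and max: "\<And>r. r > 0 \<Longrightarrow>
       (\<integral>\<xi>. indicator (sphere 0 1 \<inter> ball \<zeta> r) \<xi> * u \<xi> \<partial>circle_measure) \<le> L * r"
    and "norm \<zeta> = 1" "\<alpha> > 1" and z: "z \<in> stolz_region \<alpha> \<zeta>"
  shows "poisson u z \<le> 16 * (1 + \<alpha>)\<^sup>2 * L"
proof -
  define d where "d = 1 - norm z"
  have z1: "norm z < 1" and zd: "norm (z - \<zeta>) < \<alpha> * d"
    using z by (auto simp: stolz_region_def d_def)
  have d0: "d > 0" using z1 by (simp add: d_def)
  have L0: "L \<ge> 0"
  proof -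
    have "0 \<le> (\<integral>\<xi>. indicator (sphere 0 1 \<inter> ball \<zeta> 1) \<xi> * u \<xi> \<partial>circle_measure)"
      by (rule integral_nonneg_AE) (use u in auto)
    with max[of 1] show ?thesis by simp
  qed
  obtain n where n: "2 / d < 2 ^ n"
    using real_arch_pow[of 2 "2 / d"] by auto
  define c where "c = (\<lambda>k. 8 * (1 + \<alpha>)\<^sup>2 / (4 ^ k * d))"
  define arc where "arc = (\<lambda>k. sphere 0 1 \<inter> ball \<zeta> (2 ^ k * d))"
  have c0: "c k \<ge> 0" for k using d0 by (simp add: c_def)
  have ker: "poisson_kernel z \<xi> \<le> (\<Sum>k\<le>n. c k * indicator (arc k) \<xi>)" if \<xi>: "norm \<xi> = 1" for \<xi>
  proof -
    have ex: "norm (\<xi> - \<zeta>) < 2 ^ n * d"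
      using norm_triangle_ineq4[of \<xi> \<zeta>] \<xi> \<open>norm \<zeta> = 1\<close> n d0 by (simp add: field_simps)
    define k where "k = (LEAST k. norm (\<xi> - \<zeta>) < 2 ^ k * d)"
    have k: "norm (\<xi> - \<zeta>) < 2 ^ k * d" "k \<le> n"
      unfolding k_def using ex by (rule LeastI, rule Least_le)
    have far: "norm (\<xi> - z) \<ge> d" using norm_diff_ge[OF \<xi>] by (simp add: d_def)
    have "norm (\<xi> - \<zeta>) \<le> norm (\<xi> - z) + norm (z - \<zeta>)"
      using norm_triangle_ineq[of "\<xi> - z" "z - \<zeta>"] by simp
    also have "\<dots> \<le> norm (\<xi> - z) + \<alpha> * norm (\<xi> - z)"
      using zd far \<open>\<alpha> > 1\<close> mult_left_mono[of d "norm (\<xi> - z)" \<alpha>] by linarith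
    finally have f2: "norm (\<xi> - \<zeta>) \<le> (1 + \<alpha>) * norm (\<xi> - z)" by (simp add: algebra_simps)
    have "2 ^ k * d / 2 \<le> (1 + \<alpha>) * norm (\<xi> - z)"
    proof (cases k)
      case 0
      have "d \<le> (1 + \<alpha>) * norm (\<xi> - z)"
        using far \<open>\<alpha> > 1\<close> d0 mult_mono[of 1 "1 + \<alpha>" d "norm (\<xi> - z)"] by simp
      then show ?thesis using 0 d0 by simp
    next
      case (Suc m)
      then have "\<not> norm (\<xi> - \<zeta>) < 2 ^ m * d"
        unfolding k_def using not_less_Least[of m "\<lambda>k. norm (\<xi> - \<zeta>) < 2 ^ k * d"] by linarith
      with f2 Suc show ?thesis by simp
    qed
    then have "(2 ^ k * d / 2)\<^sup>2 \<le> ((1 + \<alpha>) * norm (\<xi> - z))\<^sup>2"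
      using d0 by (intro power_mono) auto
    moreover have "(2 ^ k * d / 2)\<^sup>2 = 4 ^ k * d\<^sup>2 / 4"
      by (simp add: power_mult_distrib power_divide power_mult[symmetric] mult.commute[of k] power_mult)
    ultimately have sq: "4 ^ k * d\<^sup>2 \<le> 4 * (1 + \<alpha>)\<^sup>2 * (norm (\<xi> - z))\<^sup>2"
      by (simp add: power_mult_distrib)
    have "1 - (norm z)\<^sup>2 = d * (1 + norm z)"
      by (simp add: d_def power2_eq_square algebra_simps)
    also have "\<dots> \<le> d * 2" using d0 z1 by (intro mult_left_mono) auto
    finally have "poisson_kernel z \<xi> \<le> d * 2 / (norm (\<xi> - z))\<^sup>2"
      unfolding poisson_kernel_def by (rule divide_right_mono) simp
    also have "\<dots> \<le> c k"
    proof -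
      have "norm (\<xi> - z) > 0" using far d0 by linarith
      then show ?thesis
        using sq d0 by (simp add: c_def field_simps power2_eq_square)
    qed
    also have "\<dots> = c k * indicator (arc k) \<xi>"
      using k(1) \<xi> by (simp add: arc_def dist_norm norm_minus_commute)
    also have "\<dots> \<le> (\<Sum>k\<le>n. c k * indicator (arc k) \<xi>)"
      by (rule member_le_sum) (use k(2) c0 in auto)
    finally show ?thesis .
  qed
  have arcM: "arc k \<in> sets circle_measure" for k
    unfolding arc_def by (rule Int_sphere_in_sets_circle) auto
  have int: "integrable circle_measure (\<lambda>\<xi>. indicator (arc k) \<xi> * u \<xi>)" for k
    using integrable_mult_indicator[OF arcM u(1)] by simp
  have "poisson u z \<le> (\<integral>\<xi>. (\<Sum>k\<le>n. c k * (indicator (arc k) \<xi> * u \<xi>)) \<partial>circle_measure)"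
    unfolding poisson_def
  proof (rule integral_mono)
    show "integrable circle_measure (\<lambda>\<xi>. poisson_kernel z \<xi> *\<^sub>R u \<xi>)"
      by (rule poisson_kernel_integrable[OF z1 u(1)])
    show "integrable circle_measure (\<lambda>\<xi>. \<Sum>k\<le>n. c k * (indicator (arc k) \<xi> * u \<xi>))"
      using int by auto
    fix \<xi> assume "\<xi> \<in> space circle_measure"
    then have "norm \<xi> = 1" by simp
    from mult_right_mono[OF ker[OF this] u(2)[of \<xi>]]
    show "poisson_kernel z \<xi> *\<^sub>R u \<xi> \<le> (\<Sum>k\<le>n. c k * (indicator (arc k) \<xi> * u \<xi>))"
      unfolding sum_distrib_right mult.assoc real_scaleR_def .
  qed
  also have "\<dots> = (\<Sum>k\<le>n. c k * (\<integral>\<xi>. indicator (arc k) \<xi> * u \<xi> \<partial>circle_measure))"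
    using int by (subst Bochner_Integration.integral_sum) auto
  also have "\<dots> \<le> (\<Sum>k\<le>n. c k * (L * (2 ^ k * d)))"
    unfolding arc_def using c0 d0 by (intro sum_mono mult_left_mono max) auto
  also have "\<dots> = (\<Sum>k\<le>n. 8 * (1 + \<alpha>)\<^sup>2 * L * (1 / 2) ^ k)"
  proof (rule sum.cong[OF refl])
    fix k
    have "(4::real) ^ k = 2 ^ k * 2 ^ k" by (simp flip: power_mult_distrib)
    then show "c k * (L * (2 ^ k * d)) = 8 * (1 + \<alpha>)\<^sup>2 * L * (1 / 2) ^ k"
      using d0 by (simp add: c_def field_simps)
  qed
  also have "\<dots> = 8 * (1 + \<alpha>)\<^sup>2 * L * (\<Sum>k\<le>n. (1 / 2) ^ k)" by (rule sum_distrib_left[symmetric])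
  also have "\<dots> \<le> 8 * (1 + \<alpha>)\<^sup>2 * L * 2"
  proof (rule mult_left_mono)
    have "(\<Sum>k\<le>n. (1 / 2 :: real) ^ k) \<le> (\<Sum>k. (1 / 2) ^ k)"
      by (intro sum_le_suminf) (auto intro: summable_geometric)
    also have "\<dots> = 2" by (subst suminf_geometric) auto
    finally show "(\<Sum>k\<le>n. (1 / 2 :: real) ^ k) \<le> 2" .
  qed (use L0 in auto)
  finally show ?thesis by simp
qed

section \<open>Angular limits of Poisson integrals\<close>

lemma eventually_in_stolz: "eventually (\<lambda>z. z \<in> stolz_region \<alpha> \<zeta>) (at \<zeta> within stolz_region \<alpha> \<zeta>)"
  by (simp add: eventually_at_filter)

lemma eventually_stolz_in_disk: "eventually (\<lambda>z. norm z < 1) (at \<zeta> within stolz_region \<alpha> \<zeta>)"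
  using eventually_in_stolz by (rule eventually_mono) (auto simp: stolz_region_def)

lemma radius_in_stolz:
  assumes "norm \<zeta> = 1" "\<alpha> > 1" "0 \<le> r" "r < 1"
  shows "of_real r * \<zeta> \<in> stolz_region \<alpha> \<zeta>"
proof -
  have "of_real r * \<zeta> - \<zeta> = of_real (r - 1) * \<zeta>"
    by (simp add: algebra_simps)
  then have "norm (of_real r * \<zeta> - \<zeta>) = 1 - r"
    using assms by (simp add: norm_mult del: of_real_diff)
  with assms show ?thesis
    by (auto simp: stolz_region_def norm_mult)
qed

text \<open>Radial limits are taken along one fixed sequence, which makes them limits of measurable functions.\<close>

definition radius_seq :: "nat \<Rightarrow> real" where
  "radius_seq n = 1 - 1 / (real n + 2)"

lemma radius_seq_bounds: "0 < radius_seq n" "0 \<le> radius_seq n" "radius_seq n < 1"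
  by (auto simp: radius_seq_def)

lemma radius_seq_tendsto: "radius_seq \<longlonglongrightarrow> 1"
proof -
  have "(\<lambda>n. 1 - 1 / real (n + 2)) \<longlonglongrightarrow> 1 - 0"
    by (intro tendsto_diff tendsto_const LIMSEQ_ignore_initial_segment[OF lim_1_over_n])
  then show ?thesis by (simp add: radius_seq_def[abs_def] add.commute)
qed

lemma radius_seq_filterlim:
  assumes "norm \<zeta> = 1" "\<alpha> > 1"
  shows "filterlim (\<lambda>n. of_real (radius_seq n) * \<zeta>) (at \<zeta> within stolz_region \<alpha> \<zeta>) sequentially"
  unfolding filterlim_at
proof
  have "(\<lambda>n. of_real (radius_seq n) * \<zeta>) \<longlonglongrightarrow> of_real 1 * \<zeta>"
    by (intro tendsto_intros radius_seq_tendsto)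
  then show "(\<lambda>n. of_real (radius_seq n) * \<zeta>) \<longlonglongrightarrow> \<zeta>" by simp
  have "of_real (radius_seq n) * \<zeta> \<noteq> \<zeta>" for n
    using radius_seq_bounds[of n] assms by auto
  then show "\<forall>\<^sub>F n in sequentially. of_real (radius_seq n) * \<zeta> \<in> stolz_region \<alpha> \<zeta> \<and>
      of_real (radius_seq n) * \<zeta> \<noteq> \<zeta>"
    using radius_in_stolz[OF assms radius_seq_bounds(2,3)] by auto
qed

lemma angular_limit_radial:
  assumes "has_angular_limit f \<zeta> w" "norm \<zeta> = 1"
  shows "(\<lambda>n. f (of_real (radius_seq n) * \<zeta>)) \<longlonglongrightarrow> w"
proof -
  have "(f \<longlongrightarrow> w) (at \<zeta> within stolz_region 2 \<zeta>)"
    using assms(1) by (auto simp: has_angular_limit_def)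
  from filterlim_compose[OF this radius_seq_filterlim] assms(2) show ?thesis by simp
qed

lemma angular_limit_unique:
  assumes "has_angular_limit f \<zeta> v" "has_angular_limit f \<zeta> w" "norm \<zeta> = 1"
  shows "v = w"
  using LIMSEQ_unique angular_limit_radial assms by blast

lemma bdry_eqI: "has_angular_limit f \<zeta> w \<Longrightarrow> norm \<zeta> = 1 \<Longrightarrow> bdry f \<zeta> = w"
  unfolding bdry_def using angular_limit_unique by (auto intro!: the_equality)

lemma angular_limit_cong:
  assumes "\<And>z. norm z < 1 \<Longrightarrow> f z = g z"
  shows "has_angular_limit f \<zeta> w \<longleftrightarrow> has_angular_limit g \<zeta> w"
proof -
  have "(f \<longlongrightarrow> w) (at \<zeta> within stolz_region \<alpha> \<zeta>) \<longleftrightarrow> (g \<longlongrightarrow> w) (at \<zeta> within stolz_region \<alpha> \<zeta>)" for \<alpha>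
    by (rule tendsto_cong) (rule eventually_mono[OF eventually_stolz_in_disk], use assms in auto)
  then show ?thesis by (simp add: has_angular_limit_def)
qed

lemma bdry_cong:
  assumes "\<And>z. norm z < 1 \<Longrightarrow> f z = g z"
  shows "bdry f = bdry g"
proof -
  have eq: "has_angular_limit f = has_angular_limit g"
    by (intro ext angular_limit_cong) (rule assms)
  show ?thesis unfolding bdry_def[abs_def] eq ..
qed

lemma angular_limit_compose:
  assumes "has_angular_limit f \<zeta> v" "isCont h v"
  shows "has_angular_limit (\<lambda>z. h (f z)) \<zeta> (h v)"
  using assms isCont_tendsto_compose by (fastforce simp: has_angular_limit_def)

lemma angular_limit_add:
  "has_angular_limit f \<zeta> v \<Longrightarrow> has_angular_limit g \<zeta> w \<Longrightarrow> has_angular_limit (\<lambda>z. f z + g z) \<zeta> (v + w)"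
  by (auto simp: has_angular_limit_def intro!: tendsto_add)

lemma angular_limit_mult:
  "has_angular_limit f \<zeta> v \<Longrightarrow> has_angular_limit g \<zeta> w \<Longrightarrow> has_angular_limit (\<lambda>z. f z * g z) \<zeta> (v * w)"
  by (auto simp: has_angular_limit_def intro!: tendsto_mult)

lemma angular_limit_divide:
  "has_angular_limit f \<zeta> v \<Longrightarrow> has_angular_limit g \<zeta> w \<Longrightarrow> w \<noteq> 0 \<Longrightarrow>
     has_angular_limit (\<lambda>z. f z / g z) \<zeta> (v / w)"
  by (auto simp: has_angular_limit_def intro!: tendsto_divide)

lemma angular_limit_const: "has_angular_limit (\<lambda>z. c) \<zeta> c"
  by (auto simp: has_angular_limit_def)

lemma angular_limit_ident: "has_angular_limit (\<lambda>z. z) \<zeta> \<zeta>"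
  by (auto simp: has_angular_limit_def intro: tendsto_ident_at)

lemma poisson_add:
  assumes "norm z < 1" "integrable circle_measure u" "integrable circle_measure v"
  shows "poisson (\<lambda>\<xi>. u \<xi> + v \<xi>) z = poisson u z + poisson v z"
  unfolding poisson_def scaleR_add_right
  by (rule Bochner_Integration.integral_add) (use poisson_kernel_integrable assms in auto)

lemma poisson_diff:
  assumes "norm z < 1" "integrable circle_measure u" "integrable circle_measure v"
  shows "poisson (\<lambda>\<xi>. u \<xi> - v \<xi>) z = poisson u z - poisson v z"
  unfolding poisson_def scaleR_diff_right
  by (rule Bochner_Integration.integral_diff) (use poisson_kernel_integrable assms in auto)

lemma poisson_norm_le:
  assumes "norm z < 1"
  shows "norm (poisson u z) \<le> poisson (\<lambda>\<xi>. norm (u \<xi>)) z"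
proof -
  have "norm (poisson u z) \<le> (\<integral>\<xi>. norm (poisson_kernel z \<xi> *\<^sub>R u \<xi>) \<partial>circle_measure)"
    unfolding poisson_def by (rule integral_norm_bound)
  also have "\<dots> = poisson (\<lambda>\<xi>. norm (u \<xi>)) z"
    unfolding poisson_def
    by (rule Bochner_Integration.integral_cong) (use poisson_kernel_pos[OF assms] in \<open>auto simp: abs_of_pos\<close>)
  finally show ?thesis .
qed

lemma poisson_constant: "norm z < 1 \<Longrightarrow> poisson (\<lambda>_. c) z = c"
  unfolding poisson_def using poisson_const[of z] integrable_circle_continuous[OF poisson_kernel_continuous]
  by (subst integral_scaleR_left) auto

lemma poisson_cong_AE:
  assumes "AE \<xi> in circle_measure. u \<xi> = v \<xi>"
    "u \<in> borel_measurable circle_measure" "v \<in> borel_measurable circle_measure"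
  shows "poisson u z = poisson v z"
  unfolding poisson_def
proof (rule integral_cong_AE)
  show "(\<lambda>\<zeta>. poisson_kernel z \<zeta> *\<^sub>R u \<zeta>) \<in> borel_measurable circle_measure"
    using assms(2) by measurable
  show "(\<lambda>\<zeta>. poisson_kernel z \<zeta> *\<^sub>R v \<zeta>) \<in> borel_measurable circle_measure"
    using assms(3) by measurable
qed (use assms(1) in auto)

lemma poisson_mono_AE:
  fixes u v :: "complex \<Rightarrow> real"
  assumes "norm z < 1" "integrable circle_measure u" "integrable circle_measure v"
    "AE \<xi> in circle_measure. u \<xi> \<le> v \<xi>"
  shows "poisson u z \<le> poisson v z"
  unfolding poisson_def
proof (rule integral_mono_AE)
  show "AE \<zeta> in circle_measure. poisson_kernel z \<zeta> *\<^sub>R u \<zeta> \<le> poisson_kernel z \<zeta> *\<^sub>R v \<zeta>"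
    using assms(4) AE_space
    by eventually_elim (use poisson_kernel_pos[OF assms(1)] in \<open>auto intro!: mult_left_mono simp: less_imp_le\<close>)
qed (rule poisson_kernel_integrable; use assms in simp)+

lemma poisson_of_real:
  "poisson (\<lambda>\<xi>. complex_of_real (u \<xi>)) z = of_real (poisson u z)"
  unfolding poisson_def integral_complex_of_real[symmetric] by (simp add: scaleR_conv_of_real)

text \<open>The functions for which Fatou's theorem holds. The class is shown to be a closed subspace of \<open>L\<^sup>1\<close>
  that contains all continuous functions, and hence to be \<open>L\<^sup>1\<close>.\<close>

definition fatou :: "(complex \<Rightarrow> complex) \<Rightarrow> bool" where
  "fatou u \<longleftrightarrow> integrable circle_measure u \<and> (AE \<zeta> in circle_measure. has_angular_limit (poisson u) \<zeta> (u \<zeta>))"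

lemma fatou_add:
  assumes "fatou u" "fatou v"
  shows "fatou (\<lambda>\<xi>. u \<xi> + v \<xi>)"
proof -
  have i: "integrable circle_measure u" "integrable circle_measure v"
    using assms by (auto simp: fatou_def)
  have "AE \<zeta> in circle_measure. has_angular_limit (poisson u) \<zeta> (u \<zeta>)"
    "AE \<zeta> in circle_measure. has_angular_limit (poisson v) \<zeta> (v \<zeta>)"
    using assms by (auto simp: fatou_def)
  then have "AE \<zeta> in circle_measure. has_angular_limit (poisson (\<lambda>\<xi>. u \<xi> + v \<xi>)) \<zeta> (u \<zeta> + v \<zeta>)"
  proof eventually_elim
    case (elim \<zeta>)
    have "has_angular_limit (\<lambda>z. poisson u z + poisson v z) \<zeta> (u \<zeta> + v \<zeta>)"
      by (rule angular_limit_add[OF elim])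
    then show ?case
      by (subst angular_limit_cong[of _ "\<lambda>z. poisson u z + poisson v z"]) (rule poisson_add[OF _ i])
  qed
  with i show ?thesis by (simp add: fatou_def)
qed

text \<open>The maximal inequality makes the property stable under \<open>L\<^sup>1\<close> limits: by Borel--Cantelli,
  almost every point is eventually outside the exceptional sets of a fast subsequence.\<close>

lemma fatou_closed:
  assumes s: "\<And>i::nat. fatou (s i)" and u: "integrable circle_measure u"
    and lim: "(\<lambda>i. \<integral>\<xi>. norm (s i \<xi> - u \<xi>) \<partial>circle_measure) \<longlonglongrightarrow> 0"
  shows "fatou u"
proof -
  let ?M = circle_measure
  have si: "integrable ?M (s i)" and sa: "AE \<zeta> in ?M. has_angular_limit (poisson (s i)) \<zeta> (s i \<zeta>)" for i
    using s by (auto simp: fatou_def)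
  have "\<exists>i. (\<integral>\<xi>. norm (s i \<xi> - u \<xi>) \<partial>?M) < (1 / 4) ^ j" for j
    using order_tendstoD(2)[OF lim, of "(1 / 4) ^ j"] by (auto simp: eventually_sequentially)
  then obtain \<nu> where \<nu>: "\<And>j. (\<integral>\<xi>. norm (s (\<nu> j) \<xi> - u \<xi>) \<partial>?M) < (1 / 4) ^ j"
    by metis
  define v where "v = (\<lambda>j \<xi>. norm (u \<xi> - s (\<nu> j) \<xi>))"
  have vi: "integrable ?M (v j)" for j
    unfolding v_def using u si by auto
  have v0: "v j \<xi> \<ge> 0" for j \<xi> by (simp add: v_def)
  have vI: "(\<integral>\<xi>. v j \<xi> \<partial>?M) < (1 / 4) ^ j" for j
    using \<nu>[of j] by (simp add: v_def norm_minus_commute)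
  define good where "good = (\<lambda>j \<zeta>. (\<forall>r>0. (\<integral>\<xi>. indicator (sphere 0 1 \<inter> ball \<zeta> r) \<xi> * v j \<xi> \<partial>?M)
     \<le> (1 / 2) ^ j * r) \<and> v j \<zeta> \<le> (1 / 2) ^ j)"
  have "\<exists>N. N \<in> sets ?M \<and> measure ?M N \<le> 21 * (1 / 2) ^ j \<and>
     (\<forall>\<zeta>. norm \<zeta> = 1 \<longrightarrow> \<zeta> \<notin> N \<longrightarrow> good j \<zeta>)" for j
  proof -
    obtain N where N: "N \<in> sets ?M"
      "measure ?M N \<le> 21 / (1 / 2) ^ j * (\<integral>\<zeta>. v j \<zeta> \<partial>?M)"
      "\<And>\<zeta> r. norm \<zeta> = 1 \<Longrightarrow> \<zeta> \<notin> N \<Longrightarrow> r > 0 \<Longrightarrow>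
         (\<integral>\<xi>. indicator (sphere 0 1 \<inter> ball \<zeta> r) \<xi> * v j \<xi> \<partial>?M) \<le> (1 / 2) ^ j * r"
      "\<And>\<zeta>. norm \<zeta> = 1 \<Longrightarrow> \<zeta> \<notin> N \<Longrightarrow> v j \<zeta> \<le> (1 / 2) ^ j"
      by (rule maximal_weak_type[OF vi[of j] v0, of "(1 / 2) ^ j"]) auto
    have "measure ?M N \<le> 21 / (1 / 2) ^ j * (1 / 4) ^ j"
      using N(2) vI[of j] by (elim order_trans) (intro mult_left_mono, auto)
    also have "\<dots> = 21 * ((1 / 4) ^ j / (1 / 2) ^ j)" by simp
    also have "(1 / 4 :: real) ^ j / (1 / 2) ^ j = (1 / 2) ^ j"
      by (subst power_divide[symmetric]) simp
    finally show ?thesis using N by (auto simp: good_def)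
  qed
  then obtain N where N: "\<And>j. N j \<in> sets ?M" "\<And>j. measure ?M (N j) \<le> 21 * (1 / 2) ^ j"
    "\<And>j \<zeta>. norm \<zeta> = 1 \<Longrightarrow> \<zeta> \<notin> N j \<Longrightarrow> good j \<zeta>"
    by metis
  have "AE \<zeta> in ?M. eventually (\<lambda>j. \<zeta> \<in> space ?M - N j) sequentially"
  proof (rule borel_cantelli_AE1)
    show "N j \<in> sets ?M" for j by (rule N)
    show "emeasure ?M (N j) < \<infinity>" for j
      by (metis circle.emeasure_finite infinity_ennreal_def top.not_eq_extremum)
    show "summable (\<lambda>j. measure ?M (N j))"
      by (rule summable_comparison_test[OF _ summable_mult[OF summable_geometric, of "1 / 2 :: real" 21]])
         (use N(2) in auto)
  qed
  moreover have "AE \<zeta> in ?M. \<forall>i. has_angular_limit (poisson (s i)) \<zeta> (s i \<zeta>)"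
    using sa by (simp add: AE_all_countable)
  ultimately have "AE \<zeta> in ?M. has_angular_limit (poisson u) \<zeta> (u \<zeta>)"
    using AE_space
  proof eventually_elim
    case (elim \<zeta>)
    then have \<zeta>1: "norm \<zeta> = 1" by simp
    show ?case unfolding has_angular_limit_def
    proof (intro allI impI tendstoI)
      fix \<alpha> e :: real assume \<alpha>: "\<alpha> > 1" and e: "e > 0"
      define C where "C = 16 * (1 + \<alpha>)\<^sup>2 + 1"
      have C0: "C > 0" unfolding C_def by (simp add: add_nonneg_pos)
      have "(\<lambda>j. (1 / 2 :: real) ^ j) \<longlonglongrightarrow> 0" by (rule LIMSEQ_realpow_zero) auto
      then have "eventually (\<lambda>j. (1 / 2) ^ j < e / 2 / C) sequentially"
        using e C0 by (intro order_tendstoD(2)) auto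
      with elim(1) have "eventually (\<lambda>j. (1 / 2) ^ j < e / 2 / C \<and> \<zeta> \<in> space ?M - N j) sequentially"
        by eventually_elim auto
      then obtain j where j: "(1 / 2) ^ j < e / 2 / C" "\<zeta> \<notin> N j"
        by (auto simp: eventually_sequentially)
      have gj: "good j \<zeta>" using N(3)[OF \<zeta>1 j(2)] .
      have "((poisson (s (\<nu> j))) \<longlongrightarrow> s (\<nu> j) \<zeta>) (at \<zeta> within stolz_region \<alpha> \<zeta>)"
        using elim(2) \<alpha> by (auto simp: has_angular_limit_def)
      from tendstoD[OF this, of "e / 2"] e
      have "eventually (\<lambda>z. dist (poisson (s (\<nu> j)) z) (s (\<nu> j) \<zeta>) < e / 2) (at \<zeta> within stolz_region \<alpha> \<zeta>)"
        by simp
      with eventually_in_stolz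
      show "eventually (\<lambda>z. dist (poisson u z) (u \<zeta>) < e) (at \<zeta> within stolz_region \<alpha> \<zeta>)"
      proof eventually_elim
        case (elim z)
        have z1: "norm z < 1" using elim(1) by (auto simp: stolz_region_def)
        have "norm (poisson u z - poisson (s (\<nu> j)) z) \<le> poisson (v j) z"
          unfolding v_def using poisson_norm_le[OF z1] poisson_diff[OF z1 u si] by metis
        also have "\<dots> \<le> 16 * (1 + \<alpha>)\<^sup>2 * (1 / 2) ^ j"
          using gj by (intro poisson_le_maximal[OF vi v0 _ \<zeta>1 \<alpha> elim(1)]) (auto simp: good_def)
        finally have 1: "norm (poisson u z - poisson (s (\<nu> j)) z) \<le> 16 * (1 + \<alpha>)\<^sup>2 * (1 / 2) ^ j" .
        have 2: "norm (u \<zeta> - s (\<nu> j) \<zeta>) \<le> (1 / 2) ^ j"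
          using gj by (simp add: good_def v_def)
        have 3: "C * (1 / 2) ^ j < e / 2"
          using j(1) C0 by (simp add: pos_less_divide_eq mult.commute)
        have "norm (poisson u z - u \<zeta>) \<le> norm (poisson u z - poisson (s (\<nu> j)) z)
           + norm (poisson (s (\<nu> j)) z - s (\<nu> j) \<zeta>) + norm (u \<zeta> - s (\<nu> j) \<zeta>)"
          using norm_triangle_ineq[of "poisson u z - poisson (s (\<nu> j)) z" "poisson (s (\<nu> j)) z - u \<zeta>"]
            norm_triangle_ineq4[of "poisson (s (\<nu> j)) z - s (\<nu> j) \<zeta>" "u \<zeta> - s (\<nu> j) \<zeta>"] by simp
        also have "\<dots> < C * (1 / 2) ^ j + e / 2"
          using 1 2 elim(2) by (simp add: C_def dist_norm algebra_simps)
        also have "\<dots> < e" using 3 by simp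
        finally show ?case by (simp add: dist_norm)
      qed
    qed
  qed
  with u show ?thesis by (simp add: fatou_def)
qed

text \<open>Away from \<open>\<zeta>\<close> the kernel tends to 0 as its pole approaches \<open>\<zeta>\<close>; the Poisson
  average of a continuous function is therefore dominated by points where the function is close to its
  value at \<open>\<zeta>\<close>.\<close>

lemma poisson_kernel_far:
  assumes "norm \<xi> = 1" "norm \<zeta> = 1" "norm z < 1" "\<delta> > 0" "norm (\<xi> - \<zeta>) \<ge> \<delta>" "norm (z - \<zeta>) < \<delta> / 2"
  shows "poisson_kernel z \<xi> \<le> 8 * norm (z - \<zeta>) / \<delta>\<^sup>2"
proof -
  have "norm (\<xi> - z) \<ge> \<delta> / 2"
    using norm_triangle_ineq[of "\<xi> - z" "z - \<zeta>"] assms by simp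
  then have "(\<delta> / 2)\<^sup>2 \<le> (norm (\<xi> - z))\<^sup>2" using assms by (intro power_mono) auto
  moreover have "1 - (norm z)\<^sup>2 \<le> 2 * norm (z - \<zeta>)"
  proof -
    have "1 - (norm z)\<^sup>2 \<le> 2 * (1 - norm z)"
      using zero_le_power2[of "1 - norm z"] by (simp add: power2_diff)
    moreover have "1 - norm z \<le> norm (z - \<zeta>)"
      using norm_diff_ge[OF assms(2), of z] by (simp add: norm_minus_commute)
    then have "2 * (1 - norm z) \<le> 2 * norm (z - \<zeta>)" by simp
    ultimately show ?thesis by (rule order_trans)
  qed
  ultimately have "poisson_kernel z \<xi> \<le> 2 * norm (z - \<zeta>) / (\<delta> / 2)\<^sup>2"
    unfolding poisson_kernel_def using assms by (intro frac_le) auto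
  then show ?thesis by (simp add: power_divide)
qed

lemma fatou_continuous:
  fixes u :: "complex \<Rightarrow> complex"
  assumes "continuous_on (sphere 0 1) u"
  shows "fatou u"
proof -
  let ?M = circle_measure
  have ui: "integrable ?M u" by (rule integrable_circle_continuous[OF assms])
  have "compact (u ` sphere 0 1)" by (rule compact_continuous_image[OF assms]) auto
  then obtain B where B: "B > 0" "\<And>x. x \<in> u ` sphere 0 1 \<Longrightarrow> norm x \<le> B"
    using compact_imp_bounded bounded_pos by metis
  have "has_angular_limit (poisson u) \<zeta> (u \<zeta>)" if \<zeta>: "norm \<zeta> = 1" for \<zeta>
    unfolding has_angular_limit_def
  proof (intro allI impI tendstoI)
    fix \<alpha> e :: real assume \<alpha>: "\<alpha> > 1" and e: "e > 0"
    obtain \<delta> where \<delta>: "\<delta> > 0" "\<And>\<xi>. norm \<xi> = 1 \<Longrightarrow> norm (\<xi> - \<zeta>) < \<delta> \<Longrightarrow> norm (u \<xi> - u \<zeta>) < e / 2"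
      using assms \<zeta> e unfolding continuous_on_iff dist_norm by (metis half_gt_zero mem_sphere_0)
    define \<eta> where "\<eta> = min (\<delta> / 2) (e * \<delta>\<^sup>2 / (32 * B))"
    have \<eta>: "\<eta> > 0" using \<delta> e B by (simp add: \<eta>_def)
    have "eventually (\<lambda>z. dist z \<zeta> < \<eta>) (at \<zeta> within stolz_region \<alpha> \<zeta>)"
      using \<eta> by (auto simp: eventually_at)
    with eventually_stolz_in_disk
    show "eventually (\<lambda>z. dist (poisson u z) (u \<zeta>) < e) (at \<zeta> within stolz_region \<alpha> \<zeta>)"
    proof eventually_elim
      case (elim z)
      have zd: "norm (z - \<zeta>) < \<delta> / 2" "norm (z - \<zeta>) < e * \<delta>\<^sup>2 / (32 * B)"
        using elim(2) by (auto simp: \<eta>_def dist_norm)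
      have "poisson u z - u \<zeta> = poisson (\<lambda>\<xi>. u \<xi> - u \<zeta>) z"
        using poisson_diff[OF elim(1) ui, of "\<lambda>_. u \<zeta>"] poisson_constant[OF elim(1), of "u \<zeta>"] by simp
      also have "norm \<dots> \<le> poisson (\<lambda>\<xi>. norm (u \<xi> - u \<zeta>)) z"
        by (rule poisson_norm_le[OF elim(1)])
      also have "\<dots> \<le> (\<integral>\<xi>. poisson_kernel z \<xi> * (e / 2) + 16 * B * norm (z - \<zeta>) / \<delta>\<^sup>2 \<partial>?M)"
        unfolding poisson_def
      proof (rule integral_mono)
        show "integrable ?M (\<lambda>\<xi>. poisson_kernel z \<xi> *\<^sub>R norm (u \<xi> - u \<zeta>))"
          using ui by (intro poisson_kernel_integrable elim) auto
        show "integrable ?M (\<lambda>\<xi>. poisson_kernel z \<xi> * (e / 2) + 16 * B * norm (z - \<zeta>) / \<delta>\<^sup>2)"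
          using integrable_circle_continuous[OF poisson_kernel_continuous[OF elim(1)]] by auto
        fix \<xi> assume "\<xi> \<in> space ?M"
        then have \<xi>: "norm \<xi> = 1" by simp
        have k0: "poisson_kernel z \<xi> > 0" by (rule poisson_kernel_pos[OF elim(1) \<xi>])
        show "poisson_kernel z \<xi> *\<^sub>R norm (u \<xi> - u \<zeta>)
            \<le> poisson_kernel z \<xi> * (e / 2) + 16 * B * norm (z - \<zeta>) / \<delta>\<^sup>2"
        proof (cases "norm (\<xi> - \<zeta>) < \<delta>")
          case True
          have "poisson_kernel z \<xi> * norm (u \<xi> - u \<zeta>) \<le> poisson_kernel z \<xi> * (e / 2)"
            using \<delta>(2)[OF \<xi> True] k0 by (intro mult_left_mono) auto
          moreover have "16 * B * norm (z - \<zeta>) / \<delta>\<^sup>2 \<ge> 0" using B by simp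
          ultimately show ?thesis by simp
        next
          case False
          have "norm (u \<xi> - u \<zeta>) \<le> 2 * B"
            using norm_triangle_ineq4[of "u \<xi>" "u \<zeta>"] B(2)[of "u \<xi>"] B(2)[of "u \<zeta>"] \<xi> \<zeta> by simp
          then have "poisson_kernel z \<xi> * norm (u \<xi> - u \<zeta>) \<le> (8 * norm (z - \<zeta>) / \<delta>\<^sup>2) * (2 * B)"
            using poisson_kernel_far[OF \<xi> \<zeta> elim(1) \<delta>(1) _ zd(1)] False k0 by (intro mult_mono) auto
          moreover have "poisson_kernel z \<xi> * (e / 2) \<ge> 0" using k0 e by simp
          moreover have "8 * norm (z - \<zeta>) / \<delta>\<^sup>2 * (2 * B) = 16 * B * norm (z - \<zeta>) / \<delta>\<^sup>2" by simp
          ultimately show ?thesis unfolding real_scaleR_def by linarith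
        qed
      qed
      also have "\<dots> = e / 2 + 16 * B * norm (z - \<zeta>) / \<delta>\<^sup>2"
        using integrable_circle_continuous[OF poisson_kernel_continuous[OF elim(1)]]
        by (subst Bochner_Integration.integral_add) (auto simp: poisson_const[OF elim(1)])
      also have "\<dots> < e"
        using zd(2) B \<delta>(1) by (simp add: field_simps)
      finally show ?case by (simp add: dist_norm)
    qed
  qed
  with ui show ?thesis by (auto simp: fatou_def intro!: AE_I2)
qed

lemma fatou_dominated:
  assumes s: "\<And>i::nat. fatou (s i)" and w: "integrable circle_measure w"
    and u: "u \<in> borel_measurable circle_measure"
    and lim: "\<And>\<xi>. norm \<xi> = 1 \<Longrightarrow> (\<lambda>i. s i \<xi>) \<longlonglongrightarrow> u \<xi>"
    and bd: "\<And>i \<xi>. norm \<xi> = 1 \<Longrightarrow> norm (s i \<xi>) \<le> w \<xi>"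
  shows "fatou u"
proof -
  let ?M = circle_measure
  have sm: "s i \<in> borel_measurable ?M" for i
    using s[of i] unfolding fatou_def by auto
  have ui: "integrable ?M u"
    by (rule integrable_dominated_convergence[OF u sm w]) (auto intro!: AE_I2 lim bd)
  have ub: "norm (u \<xi>) \<le> w \<xi>" if "norm \<xi> = 1" for \<xi>
    by (rule LIMSEQ_le_const2[OF tendsto_norm[OF lim[OF that]]]) (use bd that in auto)
  have "(\<lambda>i. \<integral>\<xi>. norm (s i \<xi> - u \<xi>) \<partial>?M) \<longlonglongrightarrow> (\<integral>\<xi>. 0 \<partial>?M)"
  proof (rule integral_dominated_convergence[where w = "\<lambda>\<xi>. 2 * w \<xi>"])
    show "(\<lambda>\<xi>. norm (s i \<xi> - u \<xi>)) \<in> borel_measurable ?M" for i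
      using sm u by measurable
    show "AE \<xi> in ?M. (\<lambda>i. norm (s i \<xi> - u \<xi>)) \<longlonglongrightarrow> 0"
      by (rule AE_I2) (use tendsto_norm_zero[OF LIM_zero[OF lim]] in auto)
    show "AE \<xi> in ?M. norm (norm (s i \<xi> - u \<xi>)) \<le> 2 * w \<xi>" for i
    proof (rule AE_I2)
      fix \<xi> assume "\<xi> \<in> space ?M"
      then have "norm \<xi> = 1" by simp
      from bd[OF this, of i] ub[OF this] norm_triangle_ineq4[of "s i \<xi>" "u \<xi>"]
      show "norm (norm (s i \<xi> - u \<xi>)) \<le> 2 * w \<xi>" by simp
    qed
  qed (use w in auto)
  then show ?thesis by (intro fatou_closed[OF s ui]) simp
qed

text \<open>The indicator of a closed set is a limit of continuous functions of the distance to it; Dynkin's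
  lemma then passes to Borel sets, and approximation by simple functions to all of \<open>L\<^sup>1\<close>.\<close>

lemma fatou_indicator_closed:
  fixes c :: complex
  assumes "closed C"
  shows "fatou (\<lambda>\<xi>. indicator C \<xi> *\<^sub>R c)"
proof (cases "C = {}")
  case True
  then show ?thesis using fatou_continuous[of "\<lambda>_. 0"] by simp
next
  case False
  define s where "s = (\<lambda>(i::nat) \<xi>. of_real (max 0 (1 - real i * infdist \<xi> C)) * c)"
  show ?thesis
  proof (rule fatou_dominated[where s = s and w = "\<lambda>_. norm c"])
    show "fatou (s i)" for i
      unfolding s_def by (intro fatou_continuous continuous_intros)
    show "(\<lambda>\<xi>. indicator C \<xi> *\<^sub>R c) \<in> borel_measurable circle_measure"
      using borel_closed[OF assms] by (intro borel_measurable_circle) auto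
    fix \<xi> :: complex
    have nn: "infdist \<xi> C \<ge> 0" by (rule infdist_nonneg)
    show "norm (s i \<xi>) \<le> norm c" for i
    proof -
      have "\<bar>max 0 (1 - real i * infdist \<xi> C)\<bar> * norm c \<le> 1 * norm c"
        using nn by (intro mult_right_mono) auto
      then show ?thesis unfolding s_def norm_mult norm_of_real by simp
    qed
    show "(\<lambda>i. s i \<xi>) \<longlonglongrightarrow> indicator C \<xi> *\<^sub>R c"
    proof (cases "\<xi> \<in> C")
      case True
      then have "infdist \<xi> C = 0" by simp
      then show ?thesis using True by (simp add: s_def)
    next
      case out: False
      then have d: "infdist \<xi> C > 0"
        using nn in_closed_iff_infdist_zero[OF assms False] by (metis order_le_less)
      obtain n where n: "1 / infdist \<xi> C < real n" using reals_Archimedean2 by blast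
      have "eventually (\<lambda>i. s i \<xi> = 0) sequentially"
        unfolding eventually_sequentially
      proof (intro exI[of _ n] allI impI)
        fix i assume "n \<le> i"
        then have "1 / infdist \<xi> C < real i" using n by linarith
        then have "1 < real i * infdist \<xi> C" using d by (simp add: field_simps)
        then show "s i \<xi> = 0" by (simp add: s_def)
      qed
      then show ?thesis using out by (simp add: tendsto_eventually)
    qed
  qed auto
qed

lemma fatou_cong:
  assumes "\<And>\<xi>. norm \<xi> = 1 \<Longrightarrow> u \<xi> = v \<xi>"
  shows "fatou u \<longleftrightarrow> fatou v"
proof -
  have "poisson u = poisson v"
    unfolding poisson_def by (intro ext Bochner_Integration.integral_cong) (use assms in auto)
  moreover have "integrable circle_measure u \<longleftrightarrow> integrable circle_measure v"
    by (rule Bochner_Integration.integrable_cong) (use assms in auto)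
  moreover have "(AE \<zeta> in circle_measure. has_angular_limit (poisson v) \<zeta> (u \<zeta>))
      \<longleftrightarrow> (AE \<zeta> in circle_measure. has_angular_limit (poisson v) \<zeta> (v \<zeta>))"
    by (rule AE_cong) (use assms in auto)
  ultimately show ?thesis by (simp add: fatou_def)
qed

lemma fatou_uminus:
  assumes "fatou u"
  shows "fatou (\<lambda>\<xi>. - u \<xi>)"
proof -
  have "poisson (\<lambda>\<xi>. - u \<xi>) = (\<lambda>z. - poisson u z)"
    by (simp add: poisson_def fun_eq_iff)
  moreover have "has_angular_limit (\<lambda>z. - f z) \<zeta> (- w)" if "has_angular_limit f \<zeta> w" for f \<zeta> w
    using that by (auto simp: has_angular_limit_def intro!: tendsto_minus)
  ultimately show ?thesis
    using assms by (auto simp: fatou_def elim!: eventually_mono)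
qed

lemma fatou_indicator_borel:
  fixes c :: complex
  assumes "A \<in> sets borel"
  shows "fatou (\<lambda>\<xi>. indicator A \<xi> *\<^sub>R c)"
proof -
  have "Int_stable (Collect closed :: complex set set)" "Collect closed \<subseteq> Pow (UNIV :: complex set)"
    by (auto simp: Int_stable_def)
  moreover have "A \<in> sigma_sets UNIV (Collect closed)"
    using assms by (simp add: borel_eq_closed)
  ultimately show ?thesis
  proof (induction rule: sigma_sets_induct_disjoint)
    case (basic A)
    then show ?case using fatou_indicator_closed by simp
  next
    case empty
    then show ?case using fatou_continuous[of "\<lambda>_. 0"] by simp
  next
    case (compl A)
    have "fatou (\<lambda>\<xi>. c + - (indicator A \<xi> *\<^sub>R c))"
      by (intro fatou_add fatou_continuous fatou_uminus compl continuous_intros)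
    then show ?case
      by (rule back_subst[of fatou]) (auto simp: indicator_def fun_eq_iff)
  next
    case (union A)
    define s where "s = (\<lambda>n \<xi>. \<Sum>i<n. indicator (A i) \<xi> *\<^sub>R c)"
    have part: "s n \<xi> = indicator (\<Union>i<n. A i) \<xi> *\<^sub>R c" for n \<xi>
    proof -
      have "disjoint_family_on A {..<n}"
        using union(1) by (auto simp: disjoint_family_on_def)
      then show ?thesis
        by (simp add: s_def indicator_UN_disjoint scaleR_left.sum)
    qed
    have meas: "A i \<in> sets borel" for i
      using union(2) by (auto simp: borel_eq_closed)
    show ?case
    proof (rule fatou_dominated[where s = s and w = "\<lambda>_. norm c"])
      show "fatou (s n)" for n
        unfolding s_def
      proof (induction n)
        case 0
        then show ?case using fatou_continuous[of "\<lambda>_. 0"] by simp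
      next
        case (Suc n)
        then show ?case using fatou_add union(3) by simp
      qed
      show "(\<lambda>\<xi>. indicator (\<Union> (range A)) \<xi> *\<^sub>R c) \<in> borel_measurable circle_measure"
        using meas by (intro borel_measurable_circle borel_measurable_scaleR borel_measurable_indicator) auto
      fix \<xi> :: complex
      show "norm (s n \<xi>) \<le> norm c" for n
        unfolding part by (auto simp: indicator_def)
      show "(\<lambda>n. s n \<xi>) \<longlonglongrightarrow> indicator (\<Union> (range A)) \<xi> *\<^sub>R c"
      proof (cases "\<xi> \<in> \<Union> (range A)")
        case True
        then obtain i where "\<xi> \<in> A i" by auto
        then have "eventually (\<lambda>n. s n \<xi> = c) sequentially"
          unfolding part eventually_sequentially by (intro exI[of _ "Suc i"]) (auto simp: indicator_def)
        then show ?thesis using True by (simp add: tendsto_eventually)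
      next
        case False
        then show ?thesis by (simp add: part)
      qed
    qed auto
  qed
qed

theorem fatou_integrable:
  assumes "integrable circle_measure u"
  shows "fatou u"
  using assms
proof (induction rule: integrable_induct)
  case (base A c)
  then obtain B where B: "B \<in> sets borel" "A = sphere 0 1 \<inter> B"
    by (auto simp: sets_circle_measure sets_restrict_space)
  have "fatou (\<lambda>\<xi>. indicator A \<xi> *\<^sub>R c) \<longleftrightarrow> fatou (\<lambda>\<xi>. indicator B \<xi> *\<^sub>R c)"
    by (rule fatou_cong) (auto simp: B indicator_def)
  then show ?case using fatou_indicator_borel[OF B(1)] by simp
next
  case (add f g)
  then show ?case by (intro fatou_add)
next
  case (lim f s)
  show ?case
  proof (rule fatou_dominated[where s = s and w = "\<lambda>\<xi>. 2 * norm (f \<xi>)"])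
    show "fatou (s i)" for i by (rule lim.IH)
    show "integrable circle_measure (\<lambda>\<xi>. 2 * norm (f \<xi>))"
      by (intro integrable_mult_right integrable_norm lim.hyps)
    show "f \<in> borel_measurable circle_measure"
      by (rule borel_measurable_integrable) (rule lim.hyps)
  qed (use lim.hyps in simp_all)
qed

lemma poisson_angular_limit:
  "integrable circle_measure u \<Longrightarrow> AE \<zeta> in circle_measure. has_angular_limit (poisson u) \<zeta> (u \<zeta>)"
  using fatou_integrable by (auto simp: fatou_def)

section \<open>Measurability of boundary functions\<close>

lemma stolz_region_mono:
  assumes "\<alpha> \<le> \<beta>"
  shows "stolz_region \<alpha> \<zeta> \<subseteq> stolz_region \<beta> \<zeta>"
proof
  fix z assume "z \<in> stolz_region \<alpha> \<zeta>"
  then have z: "norm (z - \<zeta>) < \<alpha> * (1 - norm z)" "norm z < 1"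
    by (auto simp: stolz_region_def)
  note z(1)
  also have "\<alpha> * (1 - norm z) \<le> \<beta> * (1 - norm z)"
    using assms z(2) by (intro mult_right_mono) auto
  finally show "z \<in> stolz_region \<beta> \<zeta>" using z(2) by (simp add: stolz_region_def)
qed

lemma unit_fraction_less: "e > 0 \<Longrightarrow> \<exists>m. 1 / (real m + 1) < e"
  using reals_Archimedean[of e] unfolding inverse_eq_divide of_nat_Suc by (simp add: add.commute)

text \<open>Existence of the angular limit is a Cauchy condition on the oscillation of the function over
  truncated Stolz regions. The set where the oscillation is large is open, because Stolz regions
  are defined by strict inequalities that are continuous in the vertex.\<close>

definition oscillating :: "(complex \<Rightarrow> complex) \<Rightarrow> nat \<Rightarrow> nat \<Rightarrow> nat \<Rightarrow> complex set" where
  "oscillating f n k m = {\<zeta>. \<exists>z z'. z \<in> stolz_region (real n + 2) \<zeta> \<and> z' \<in> stolz_region (real n + 2) \<zeta> \<and>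
     norm (z - \<zeta>) < 1 / (real m + 1) \<and> norm (z' - \<zeta>) < 1 / (real m + 1) \<and>
     norm (f z - f z') > 1 / (real k + 1)}"

lemma open_oscillating: "open (oscillating f n k m)"
proof -
  have "open {\<zeta>. z \<in> stolz_region (real n + 2) \<zeta> \<and> norm (z - \<zeta>) < 1 / (real m + 1)}" for z
  proof -
    have "open {\<zeta>. norm (z - \<zeta>) < (real n + 2) * (1 - norm z)}" "open {\<zeta>. norm (z - \<zeta>) < 1 / (real m + 1)}"
      by (intro open_Collect_less continuous_intros)+
    then have "open ({\<zeta>. norm (z - \<zeta>) < (real n + 2) * (1 - norm z)} \<inter> {\<zeta>. norm (z - \<zeta>) < 1 / (real m + 1)})"
      by (rule open_Int)
    moreover have "{\<zeta>. z \<in> stolz_region (real n + 2) \<zeta> \<and> norm (z - \<zeta>) < 1 / (real m + 1)} =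
       (if norm z < 1 then {\<zeta>. norm (z - \<zeta>) < (real n + 2) * (1 - norm z)} \<inter> {\<zeta>. norm (z - \<zeta>) < 1 / (real m + 1)} else {})"
      by (auto simp: stolz_region_def)
    ultimately show ?thesis by simp
  qed
  then have "open (\<Union>z. \<Union>z'\<in>{z'. norm (f z - f z') > 1 / (real k + 1)}.
     {\<zeta>. z \<in> stolz_region (real n + 2) \<zeta> \<and> norm (z - \<zeta>) < 1 / (real m + 1)} \<inter>
     {\<zeta>. z' \<in> stolz_region (real n + 2) \<zeta> \<and> norm (z' - \<zeta>) < 1 / (real m + 1)})"
    by (intro open_UN ballI open_Int) auto
  moreover have "\<dots> = oscillating f n k m"
    unfolding oscillating_def by blast
  ultimately show ?thesis by simp
qed

lemma angular_limit_iff_oscillation: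
  assumes "norm \<zeta> = 1"
  shows "(\<exists>w. has_angular_limit f \<zeta> w) \<longleftrightarrow> (\<forall>n k. \<exists>m. \<zeta> \<notin> oscillating f n k m)"
proof
  assume "\<exists>w. has_angular_limit f \<zeta> w"
  then obtain w where w: "has_angular_limit f \<zeta> w" ..
  show "\<forall>n k. \<exists>m. \<zeta> \<notin> oscillating f n k m"
  proof (intro allI)
    fix n k :: nat
    have "(f \<longlongrightarrow> w) (at \<zeta> within stolz_region (real n + 2) \<zeta>)"
      using w by (auto simp: has_angular_limit_def)
    from tendstoD[OF this, of "1 / (real k + 1) / 2"]
    have "eventually (\<lambda>z. dist (f z) w < 1 / (real k + 1) / 2) (at \<zeta> within stolz_region (real n + 2) \<zeta>)"
      by simp
    then obtain d where d: "d > 0"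
      "\<And>z. z \<in> stolz_region (real n + 2) \<zeta> \<Longrightarrow> z \<noteq> \<zeta> \<Longrightarrow> dist z \<zeta> < d \<Longrightarrow> dist (f z) w < 1 / (real k + 1) / 2"
      by (auto simp: eventually_at)
    obtain m where m: "1 / (real m + 1) < d"
      using unit_fraction_less[OF d(1)] by blast
    have near: "norm (f z - w) < 1 / (real k + 1) / 2"
      if "z \<in> stolz_region (real n + 2) \<zeta>" "norm (z - \<zeta>) < 1 / (real m + 1)" for z
    proof (rule d(2)[OF that(1), unfolded dist_norm])
      show "z \<noteq> \<zeta>" using that(1) assms by (auto simp: stolz_region_def)
    qed (use that(2) m in linarith)
    have "\<zeta> \<notin> oscillating f n k m"
    proof
      assume "\<zeta> \<in> oscillating f n k m"
      then obtain z z' where z: "norm (f z - w) < 1 / (real k + 1) / 2" "norm (f z' - w) < 1 / (real k + 1) / 2"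
        "norm (f z - f z') > 1 / (real k + 1)"
        using near by (auto simp: oscillating_def)
      have "norm (f z - f z') \<le> norm (f z - w) + norm (f z' - w)"
        using norm_triangle_ineq4[of "f z - w" "f z' - w"] by simp
      with z show False by linarith
    qed
    then show "\<exists>m. \<zeta> \<notin> oscillating f n k m" ..
  qed
next
  assume osc: "\<forall>n k. \<exists>m. \<zeta> \<notin> oscillating f n k m"
  define x where "x = (\<lambda>j. of_real (radius_seq j) * \<zeta>)"
  have xS: "x j \<in> stolz_region (real n + 2) \<zeta>" for j n
    unfolding x_def by (rule radius_in_stolz[OF assms]) (use radius_seq_bounds in auto)
  have "x \<longlonglongrightarrow> of_real 1 * \<zeta>"
    unfolding x_def by (intro tendsto_intros radius_seq_tendsto)
  then have xl: "eventually (\<lambda>j. norm (x j - \<zeta>) < 1 / (real m + 1)) sequentially" for m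
    using tendstoD[of x \<zeta> sequentially "1 / (real m + 1)"] by (simp add: dist_norm)
  have "Cauchy (\<lambda>j. f (x j))"
  proof (rule metric_CauchyI)
    fix e :: real assume "e > 0"
    then obtain k where k: "1 / (real k + 1) < e"
      using unit_fraction_less by blast
    obtain m where m: "\<zeta> \<notin> oscillating f 0 k m" using osc by blast
    obtain J where J: "\<And>j. j \<ge> J \<Longrightarrow> norm (x j - \<zeta>) < 1 / (real m + 1)"
      using xl[of m] by (auto simp: eventually_sequentially)
    have "dist (f (x i)) (f (x j)) < e" if "i \<ge> J" "j \<ge> J" for i j
    proof -
      have "norm (f (x i) - f (x j)) \<le> 1 / (real k + 1)"
        using m xS[of i 0] xS[of j 0] J[OF that(1)] J[OF that(2)] unfolding oscillating_def by force
      then show ?thesis using k by (simp add: dist_norm)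
    qed
    then show "\<exists>J. \<forall>i\<ge>J. \<forall>j\<ge>J. dist (f (x i)) (f (x j)) < e" by blast
  qed
  then obtain w where w: "(\<lambda>j. f (x j)) \<longlonglongrightarrow> w"
    using Cauchy_convergent convergent_def by blast
  have "has_angular_limit f \<zeta> w"
    unfolding has_angular_limit_def
  proof (intro allI impI)
    fix \<alpha> :: real assume "\<alpha> > 1"
    obtain n where n: "\<alpha> \<le> real n + 2"
      using real_arch_simple[of \<alpha>] by (metis add.commute add_increasing zero_le_numeral)
    have "(f \<longlongrightarrow> w) (at \<zeta> within stolz_region (real n + 2) \<zeta>)"
    proof (rule tendstoI)
      fix e :: real assume "e > 0"
      then obtain k where k: "1 / (real k + 1) < e"
        using unit_fraction_less by blast
      obtain m where m: "\<zeta> \<notin> oscillating f n k m" using osc by blast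
      have "norm (f z - w) \<le> 1 / (real k + 1)"
        if z: "z \<in> stolz_region (real n + 2) \<zeta>" "norm (z - \<zeta>) < 1 / (real m + 1)" for z
      proof (rule tendsto_upperbound)
        show "(\<lambda>j. norm (f z - f (x j))) \<longlonglongrightarrow> norm (f z - w)"
          by (intro tendsto_intros w)
        show "eventually (\<lambda>j. norm (f z - f (x j)) \<le> 1 / (real k + 1)) sequentially"
          using xl[of m]
        proof eventually_elim
          case (elim j)
          then show ?case using m z xS[of j n] unfolding oscillating_def by force
        qed
      qed auto
      then have "dist (f z) w < e"
        if "z \<in> stolz_region (real n + 2) \<zeta>" "dist z \<zeta> < 1 / (real m + 1)" for z
        using that k by (force simp: dist_norm)
      moreover have "0 < 1 / (real m + 1)" by simp
      ultimately show "eventually (\<lambda>z. dist (f z) w < e) (at \<zeta> within stolz_region (real n + 2) \<zeta>)"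
        unfolding eventually_at by blast
    qed
    then show "(f \<longlongrightarrow> w) (at \<zeta> within stolz_region \<alpha> \<zeta>)"
      by (rule tendsto_within_subset[OF _ stolz_region_mono[OF n]])
  qed
  then show "\<exists>w. has_angular_limit f \<zeta> w" ..
qed

lemma continuous_on_dilate:
  fixes f :: "complex \<Rightarrow> 'a::topological_space"
  assumes "continuous_on (ball 0 1) f" "\<bar>r\<bar> < 1"
  shows "continuous_on (cball 0 1) (\<lambda>\<xi>. f (of_real r * \<xi>))"
proof (rule continuous_on_compose2[OF assms(1)])
  show "(\<lambda>\<xi>. of_real r * \<xi>) ` cball (0 :: complex) 1 \<subseteq> ball 0 1"
  proof (rule image_subsetI)
    fix \<xi> :: complex assume "\<xi> \<in> cball 0 1"
    then have "norm (of_real r * \<xi>) \<le> \<bar>r\<bar> * 1" unfolding norm_mult norm_of_real by (intro mult_left_mono) auto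
    then show "of_real r * \<xi> \<in> ball 0 1" using assms(2) by simp
  qed
qed (intro continuous_intros)

lemma continuous_on_dilate_sphere:
  fixes f :: "complex \<Rightarrow> 'a::topological_space"
  assumes "continuous_on (ball 0 1) f" "\<bar>r\<bar> < 1"
  shows "continuous_on (sphere 0 1) (\<lambda>\<xi>. f (of_real r * \<xi>))"
  by (rule continuous_on_subset[OF continuous_on_dilate[OF assms]]) auto

lemma holomorphic_on_dilate:
  assumes "f holomorphic_on ball 0 1" "\<bar>r\<bar> < 1"
  shows "(\<lambda>\<xi>. f (of_real r * \<xi>)) holomorphic_on ball 0 1"
proof -
  have "(f \<circ> (\<lambda>\<xi>. of_real r * \<xi>)) holomorphic_on ball 0 1"
  proof (rule holomorphic_on_compose_gen[OF _ assms(1)])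
    show "(\<lambda>\<xi>. of_real r * \<xi>) ` ball (0 :: complex) 1 \<subseteq> ball 0 1"
    proof (rule image_subsetI)
      fix \<xi> :: complex assume "\<xi> \<in> ball 0 1"
      then have "norm (of_real r * \<xi>) \<le> \<bar>r\<bar> * 1" unfolding norm_mult norm_of_real by (intro mult_left_mono) auto
      then show "of_real r * \<xi> \<in> ball 0 1" using assms(2) by simp
    qed
  qed (intro holomorphic_intros)
  then show ?thesis by (simp add: o_def)
qed

lemma bdry_measurable:
  assumes "continuous_on (ball 0 1) f"
  shows "bdry f \<in> borel_measurable circle_measure"
proof -
  define E where "E = {\<zeta>. \<forall>n k. \<exists>m. \<zeta> \<notin> oscillating f n k m}"
  have "E = (\<Inter>n. \<Inter>k. \<Union>m. - oscillating f n k m)"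
    by (auto simp: E_def)
  moreover have "- oscillating f n k m \<in> sets borel" for n k m
    by (intro borel_closed closed_Compl open_oscillating)
  ultimately have "E \<in> sets borel" by auto
  define h where "h = (\<lambda>\<zeta>. indicator E \<zeta> *\<^sub>R lim (\<lambda>j. f (of_real (radius_seq j) * \<zeta>)))"
  have "(\<lambda>\<zeta>. f (of_real (radius_seq j) * \<zeta>)) \<in> borel_measurable circle_measure" for j
    by (intro continuous_measurable_circle continuous_on_dilate_sphere[OF assms])
       (use radius_seq_bounds[of j] in auto)
  moreover have "indicator E \<in> borel_measurable circle_measure"
    by (rule borel_measurable_circle[OF borel_measurable_indicator]) fact
  ultimately have "h \<in> borel_measurable circle_measure"
    unfolding h_def by measurable
  moreover have "bdry f \<zeta> = h \<zeta>" if "\<zeta> \<in> space circle_measure" for \<zeta>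
  proof -
    have \<zeta>: "norm \<zeta> = 1" using that by simp
    show ?thesis
    proof (cases "\<exists>w. has_angular_limit f \<zeta> w")
      case True
      then obtain w where w: "has_angular_limit f \<zeta> w" ..
      have "\<zeta> \<in> E" using True angular_limit_iff_oscillation[OF \<zeta>] by (simp add: E_def)
      moreover have "lim (\<lambda>j. f (of_real (radius_seq j) * \<zeta>)) = w"
        by (rule limI[OF angular_limit_radial[OF w \<zeta>]])
      ultimately show ?thesis using bdry_eqI[OF w \<zeta>] by (simp add: h_def)
    next
      case False
      then have "\<zeta> \<notin> E" using angular_limit_iff_oscillation[OF \<zeta>] by (simp add: E_def)
      then show ?thesis using False by (simp add: h_def bdry_def)
    qed
  qed
  ultimately show ?thesis by (subst measurable_cong)
qed

text \<open>Where no angular limit exists, \<open>bdry\<close> takes a dummy value; this predicate says that this happens on a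
  null set only.\<close>

definition has_bdry :: "(complex \<Rightarrow> complex) \<Rightarrow> bool" where
  "has_bdry f \<longleftrightarrow> (AE \<zeta> in circle_measure. has_angular_limit f \<zeta> (bdry f \<zeta>))"

lemma has_bdryI:
  assumes "AE \<zeta> in circle_measure. has_angular_limit f \<zeta> (\<phi> \<zeta>)"
  shows "has_bdry f" "AE \<zeta> in circle_measure. bdry f \<zeta> = \<phi> \<zeta>"
proof -
  show "AE \<zeta> in circle_measure. bdry f \<zeta> = \<phi> \<zeta>"
    using assms AE_space by eventually_elim (auto intro: bdry_eqI)
  then show "has_bdry f"
    unfolding has_bdry_def using assms by eventually_elim simp
qed

section \<open>Cauchy transforms\<close>

text \<open>Used with \<open>g = cnj\<close>, where it gives the Taylor series of the Cauchy transform, and with the identity,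
  where the coefficients are the moments that vanish for boundary functions of analytic functions.\<close>

lemma geometric_integral_sums:
  fixes \<phi> g :: "complex \<Rightarrow> complex"
  assumes \<phi>: "integrable circle_measure \<phi>" and g: "g \<in> borel_measurable circle_measure"
    and g1: "\<And>\<xi>. norm \<xi> = 1 \<Longrightarrow> norm (g \<xi>) = 1" and w: "norm w < 1"
  shows "(\<lambda>n. (\<integral>\<xi>. g \<xi> ^ n * \<phi> \<xi> \<partial>circle_measure) * w ^ n) sums
         (\<integral>\<xi>. \<phi> \<xi> / (1 - w * g \<xi>) \<partial>circle_measure)"
proof -
  let ?f = "\<lambda>n \<xi>. (w * g \<xi>) ^ n * \<phi> \<xi>"
  have nf: "norm (?f n \<xi>) = norm w ^ n * norm (\<phi> \<xi>)" if "norm \<xi> = 1" for n \<xi>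
    using g1[OF that] by (simp add: norm_mult norm_power)
  have int: "integrable circle_measure (?f n)" for n
  proof (rule Bochner_Integration.integrable_bound[OF \<phi>])
    show "?f n \<in> borel_measurable circle_measure"
      using g \<phi> by measurable
    show "AE \<xi> in circle_measure. norm (?f n \<xi>) \<le> norm (\<phi> \<xi>)"
    proof (rule AE_I2)
      fix \<xi> assume "\<xi> \<in> space circle_measure"
      then have "norm \<xi> = 1" by simp
      then show "norm (?f n \<xi>) \<le> norm (\<phi> \<xi>)"
        unfolding nf[OF \<open>norm \<xi> = 1\<close>] using w by (intro mult_left_le_one_le) (auto intro: power_le_one)
    qed
  qed
  have "(\<lambda>n. integral\<^sup>L circle_measure (?f n)) sums (\<integral>\<xi>. (\<Sum>n. ?f n \<xi>) \<partial>circle_measure)"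
  proof (rule sums_integral[OF int])
    show "AE \<xi> in circle_measure. summable (\<lambda>n. norm (?f n \<xi>))"
      by (rule AE_I2) (use w in \<open>auto simp: nf intro!: summable_mult2 summable_geometric\<close>)
    have "(\<integral>\<xi>. norm (?f n \<xi>) \<partial>circle_measure) = norm w ^ n * (\<integral>\<xi>. norm (\<phi> \<xi>) \<partial>circle_measure)" for n
      unfolding integral_mult_right_zero[symmetric]
      by (rule Bochner_Integration.integral_cong) (auto simp: nf)
    then show "summable (\<lambda>n. \<integral>\<xi>. norm (?f n \<xi>) \<partial>circle_measure)"
      using w by (auto intro!: summable_mult2 summable_geometric)
  qed
  also have "(\<integral>\<xi>. (\<Sum>n. ?f n \<xi>) \<partial>circle_measure) = (\<integral>\<xi>. \<phi> \<xi> / (1 - w * g \<xi>) \<partial>circle_measure)"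
  proof (rule Bochner_Integration.integral_cong[OF refl])
    fix \<xi> assume "\<xi> \<in> space circle_measure"
    then have "norm (w * g \<xi>) < 1" using w g1 by (simp add: norm_mult)
    then have "(\<lambda>n. (w * g \<xi>) ^ n * \<phi> \<xi>) sums (1 / (1 - w * g \<xi>) * \<phi> \<xi>)"
      by (intro sums_mult2 geometric_sums)
    then show "(\<Sum>n. ?f n \<xi>) = \<phi> \<xi> / (1 - w * g \<xi>)"
      by (simp add: sums_iff)
  qed
  also have "(\<lambda>n. integral\<^sup>L circle_measure (?f n)) = (\<lambda>n. (\<integral>\<xi>. g \<xi> ^ n * \<phi> \<xi> \<partial>circle_measure) * w ^ n)"
    by (rule ext, subst integral_mult_left_zero[symmetric])
       (simp add: power_mult_distrib mult_ac)
  finally show ?thesis .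
qed

lemma cnj_measurable_circle: "cnj \<in> borel_measurable circle_measure"
  by (intro continuous_measurable_circle continuous_intros)

lemma cauchy_kernel_eq:
  assumes "norm \<xi> = 1" "norm z < 1"
  shows "\<xi> / (\<xi> - z) = 1 / (1 - z * cnj \<xi>)"
proof -
  have "\<xi> * cnj \<xi> = 1" using assms(1) complex_norm_square[of \<xi>] by simp
  then have "\<xi> * (1 - z * cnj \<xi>) = \<xi> - z" by (simp add: algebra_simps)
  moreover have "\<xi> - z \<noteq> 0" using assms by auto
  moreover have "\<xi> \<noteq> 0" using assms by auto
  ultimately show ?thesis by (metis div_by_1 mult_divide_mult_cancel_left_if mult.right_neutral)
qed

lemma cauchy_transform_sums:
  assumes "integrable circle_measure \<phi>" "norm z < 1"
  shows "(\<lambda>n. (\<integral>\<xi>. cnj \<xi> ^ n * \<phi> \<xi> \<partial>circle_measure) * z ^ n) sums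
         (\<integral>\<xi>. \<xi> / (\<xi> - z) * \<phi> \<xi> \<partial>circle_measure)"
proof -
  have "(\<integral>\<xi>. \<xi> / (\<xi> - z) * \<phi> \<xi> \<partial>circle_measure) = (\<integral>\<xi>. \<phi> \<xi> / (1 - z * cnj \<xi>) \<partial>circle_measure)"
    by (rule Bochner_Integration.integral_cong) (auto simp: cauchy_kernel_eq assms(2))
  then show ?thesis
    using geometric_integral_sums[OF assms(1) cnj_measurable_circle _ assms(2)] by simp
qed

lemma cauchy_transform_holomorphic:
  assumes "integrable circle_measure \<phi>"
  shows "(\<lambda>z. \<integral>\<xi>. \<xi> / (\<xi> - z) * \<phi> \<xi> \<partial>circle_measure) holomorphic_on ball 0 1"
  using cauchy_transform_sums[OF assms] by (intro power_series_holomorphic[where z = 0]) auto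

lemma cauchy_kernel_integrable:
  assumes "integrable circle_measure (\<phi> :: complex \<Rightarrow> complex)" "norm z < 1"
  shows "integrable circle_measure (\<lambda>\<xi>. \<xi> / (\<xi> - z) * \<phi> \<xi>)"
proof (rule Bochner_Integration.integrable_bound)
  show "integrable circle_measure (\<lambda>\<xi>. of_real (1 / (1 - norm z)) * \<phi> \<xi>)"
    using assms(1) by (rule integrable_mult_right)
  show "(\<lambda>\<xi>. \<xi> / (\<xi> - z) * \<phi> \<xi>) \<in> borel_measurable circle_measure"
    using assms(1) by measurable
  show "AE \<xi> in circle_measure. norm (\<xi> / (\<xi> - z) * \<phi> \<xi>) \<le> norm (of_real (1 / (1 - norm z)) * \<phi> \<xi>)"
  proof (rule AE_I2)
    fix \<xi> assume "\<xi> \<in> space circle_measure"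
    then have \<xi>: "norm \<xi> = 1" by simp
    have "norm (\<xi> / (\<xi> - z)) \<le> 1 / (1 - norm z)"
      unfolding norm_divide \<xi> using norm_diff_ge[OF \<xi>, of z] assms(2) by (intro frac_le) auto
    also have "\<dots> \<le> \<bar>1 / (1 - norm z)\<bar>" by (rule abs_ge_self)
    finally show "norm (\<xi> / (\<xi> - z) * \<phi> \<xi>) \<le> norm (of_real (1 / (1 - norm z)) * \<phi> \<xi>)"
      unfolding norm_mult norm_of_real by (rule mult_right_mono) simp
  qed
qed

text \<open>When all moments \<open>\<integral> \<xi>\<^sup>n \<phi>\<close> vanish, the conjugate-analytic half of the Poisson integral
  drops out.\<close>

lemma poisson_eq_cauchy_transform:
  assumes \<phi>: "integrable circle_measure \<phi>" and "norm z < 1"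
    and orth: "\<And>n::nat. (\<integral>\<xi>. \<xi> ^ n * \<phi> \<xi> \<partial>circle_measure) = 0"
  shows "poisson \<phi> z = (\<integral>\<xi>. \<xi> / (\<xi> - z) * \<phi> \<xi> \<partial>circle_measure)"
proof -
  let ?M = circle_measure
  have w: "norm (cnj z) < 1" using assms by simp
  have "(\<lambda>n::nat. (\<integral>\<xi>. \<xi> ^ n * \<phi> \<xi> \<partial>?M) * cnj z ^ n) sums (\<integral>\<xi>. \<phi> \<xi> / (1 - cnj z * \<xi>) \<partial>?M)"
    using geometric_integral_sums[OF \<phi> ident_measurable_circle _ w] by simp
  then have 0: "(\<integral>\<xi>. \<phi> \<xi> / (1 - cnj z * \<xi>) \<partial>?M) = 0"
    using sums_unique2[OF _ sums_zero] by (simp add: orth)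
  have i1: "integrable ?M (\<lambda>\<xi>. \<xi> / (\<xi> - z) * \<phi> \<xi>)"
    by (rule cauchy_kernel_integrable[OF assms(1,2)])
  have i2: "integrable ?M (\<lambda>\<xi>. poisson_kernel z \<xi> *\<^sub>R \<phi> \<xi>)"
    by (rule poisson_kernel_integrable[OF assms(2,1)])
  have nz: "1 - cnj z * \<xi> \<noteq> 0" if "norm \<xi> = 1" for \<xi>
  proof
    assume "1 - cnj z * \<xi> = 0"
    then have "norm (cnj z * \<xi>) = 1" by simp
    then show False using that assms(2) by (simp add: norm_mult)
  qed
  have "poisson \<phi> z - (\<integral>\<xi>. \<xi> / (\<xi> - z) * \<phi> \<xi> \<partial>?M)
      = (\<integral>\<xi>. poisson_kernel z \<xi> *\<^sub>R \<phi> \<xi> - \<xi> / (\<xi> - z) * \<phi> \<xi> \<partial>?M)"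
    unfolding poisson_def by (rule Bochner_Integration.integral_diff[OF i2 i1, symmetric])
  also have "\<dots> = (\<integral>\<xi>. \<phi> \<xi> / (1 - cnj z * \<xi>) - \<phi> \<xi> \<partial>?M)"
  proof (rule Bochner_Integration.integral_cong[OF refl])
    fix \<xi> assume "\<xi> \<in> space ?M"
    then have \<xi>: "norm \<xi> = 1" by simp
    have "poisson_kernel z \<xi> *\<^sub>R \<phi> \<xi> - \<xi> / (\<xi> - z) * \<phi> \<xi> = cnj z * \<xi> / (1 - cnj z * \<xi>) * \<phi> \<xi>"
      unfolding scaleR_conv_of_real poisson_kernel_split[OF \<xi> assms(2)] distrib_right by simp
    also have "cnj z * \<xi> / (1 - cnj z * \<xi>) = 1 / (1 - cnj z * \<xi>) - 1"
      using nz[OF \<xi>] by (simp add: field_simps)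
    finally show "poisson_kernel z \<xi> *\<^sub>R \<phi> \<xi> - \<xi> / (\<xi> - z) * \<phi> \<xi> = \<phi> \<xi> / (1 - cnj z * \<xi>) - \<phi> \<xi>"
      by (simp add: left_diff_distrib)
  qed
  also have "\<dots> = (\<integral>\<xi>. \<phi> \<xi> / (1 - cnj z * \<xi>) \<partial>?M) - (\<integral>\<xi>. \<phi> \<xi> \<partial>?M)"
  proof (rule Bochner_Integration.integral_diff[OF _ \<phi>])
    have "integrable ?M (\<lambda>\<xi>. cnj (\<xi> / (\<xi> - z) * cnj (\<phi> \<xi>)))"
      by (intro integrable_cnj cauchy_kernel_integrable assms)
    then show "integrable ?M (\<lambda>\<xi>. \<phi> \<xi> / (1 - cnj z * \<xi>))"
    proof (rule Bochner_Integration.integrable_cong[THEN iffD1, rotated 2])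
      fix \<xi> assume "\<xi> \<in> space ?M"
      then have \<xi>: "norm \<xi> = 1" by simp
      show "cnj (\<xi> / (\<xi> - z) * cnj (\<phi> \<xi>)) = \<phi> \<xi> / (1 - cnj z * \<xi>)"
        unfolding cauchy_kernel_eq[OF \<xi> assms(2)] by simp
    qed simp
  qed
  also have "\<dots> = 0" using 0 orth[of 0] by simp
  finally show ?thesis by simp
qed

section \<open>Outer functions with given boundary modulus\<close>

text \<open>The real part of the Schwarz integral is the Poisson integral of \<open>u\<close>, so \<open>Outer u\<close> has boundary
  modulus \<open>exp u\<close>.\<close>

definition schwarz :: "(complex \<Rightarrow> real) \<Rightarrow> complex \<Rightarrow> complex" where
  "schwarz u z = (\<integral>\<zeta>. (\<zeta> + z) / (\<zeta> - z) * of_real (u \<zeta>) \<partial>circle_measure)"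

definition Outer :: "(complex \<Rightarrow> real) \<Rightarrow> complex \<Rightarrow> complex" where
  "Outer u z = exp (schwarz u z)"

lemma schwarz_kernel_eq:
  fixes \<xi> z :: complex
  assumes "norm \<xi> = 1" "norm z < 1"
  shows "(\<xi> + z) / (\<xi> - z) = 2 * (\<xi> / (\<xi> - z)) - 1"
proof -
  have "\<xi> - z \<noteq> 0" using assms by auto
  then show ?thesis by (simp add: field_simps)
qed

lemma schwarz_kernel_integrable:
  assumes "integrable circle_measure u" "norm z < 1"
  shows "integrable circle_measure (\<lambda>\<xi>. (\<xi> + z) / (\<xi> - z) * complex_of_real (u \<xi>))"
proof -
  have "integrable circle_measure (\<lambda>\<xi>. 2 * (\<xi> / (\<xi> - z) * of_real (u \<xi>)) - of_real (u \<xi>))"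
    using assms by (intro Bochner_Integration.integrable_diff integrable_mult_right cauchy_kernel_integrable) auto
  then show ?thesis
    by (rule Bochner_Integration.integrable_cong[THEN iffD1, rotated 2])
       (auto simp: schwarz_kernel_eq assms algebra_simps)
qed

lemma schwarz_eq_cauchy:
  assumes "integrable circle_measure u" "norm z < 1"
  shows "schwarz u z = 2 * (\<integral>\<xi>. \<xi> / (\<xi> - z) * of_real (u \<xi>) \<partial>circle_measure)
           - of_real (\<integral>\<xi>. u \<xi> \<partial>circle_measure)"
proof -
  have "schwarz u z = (\<integral>\<xi>. 2 * (\<xi> / (\<xi> - z) * of_real (u \<xi>)) - of_real (u \<xi>) \<partial>circle_measure)"
    unfolding schwarz_def
    by (rule Bochner_Integration.integral_cong) (auto simp: schwarz_kernel_eq assms algebra_simps)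
  also have "\<dots> = (\<integral>\<xi>. 2 * (\<xi> / (\<xi> - z) * of_real (u \<xi>)) \<partial>circle_measure) - (\<integral>\<xi>. of_real (u \<xi>) \<partial>circle_measure)"
    using assms by (intro Bochner_Integration.integral_diff integrable_mult_right cauchy_kernel_integrable) auto
  finally show ?thesis
    by (simp only: integral_mult_right_zero integral_complex_of_real)
qed

lemma schwarz_holomorphic:
  assumes "integrable circle_measure u"
  shows "schwarz u holomorphic_on ball 0 1"
proof -
  have "(\<lambda>z. 2 * (\<integral>\<xi>. \<xi> / (\<xi> - z) * of_real (u \<xi>) \<partial>circle_measure)
           - of_real (\<integral>\<xi>. u \<xi> \<partial>circle_measure)) holomorphic_on ball 0 1"
    using assms by (intro holomorphic_intros cauchy_transform_holomorphic) auto
  then show ?thesis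
    by (rule holomorphic_transform) (use schwarz_eq_cauchy[OF assms] in auto)
qed

lemma Outer_holomorphic: "integrable circle_measure u \<Longrightarrow> Outer u holomorphic_on ball 0 1"
  unfolding Outer_def[abs_def] by (intro holomorphic_intros schwarz_holomorphic)

lemma Re_schwarz_kernel:
  assumes "norm \<xi> = 1" "norm z < 1"
  shows "Re ((\<xi> + z) / (\<xi> - z)) = poisson_kernel z \<xi>"
proof -
  have "(\<xi> + z) / (\<xi> - z) = ((\<xi> + z) * cnj (\<xi> - z)) / of_real ((norm (\<xi> - z))\<^sup>2)"
    unfolding complex_norm_square using assms by auto
  then have "Re ((\<xi> + z) / (\<xi> - z)) = Re ((\<xi> + z) * cnj (\<xi> - z)) / (norm (\<xi> - z))\<^sup>2"
    by (simp add: Re_divide_of_real)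
  also have "Re ((\<xi> + z) * cnj (\<xi> - z)) = (norm \<xi>)\<^sup>2 - (norm z)\<^sup>2"
    unfolding cmod_power2 by (simp add: power2_eq_square algebra_simps)
  finally show ?thesis using assms by (simp add: poisson_kernel_def)
qed

lemma Re_schwarz:
  assumes "integrable circle_measure u" "norm z < 1"
  shows "Re (schwarz u z) = poisson u z"
proof -
  have "Re (schwarz u z) = (\<integral>\<xi>. Re ((\<xi> + z) / (\<xi> - z) * of_real (u \<xi>)) \<partial>circle_measure)"
    unfolding schwarz_def by (rule integral_Re[OF schwarz_kernel_integrable[OF assms], symmetric])
  also have "\<dots> = poisson u z"
    unfolding poisson_def
  proof (rule Bochner_Integration.integral_cong[OF refl])
    fix \<xi> assume "\<xi> \<in> space circle_measure"
    then have 1: "Re ((\<xi> + z) / (\<xi> - z)) = poisson_kernel z \<xi>"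
      using Re_schwarz_kernel assms(2) by simp
    have 2: "Re (a * of_real b) = Re a * b" for a b by simp
    show "Re ((\<xi> + z) / (\<xi> - z) * of_real (u \<xi>)) = poisson_kernel z \<xi> *\<^sub>R u \<xi>"
      unfolding 2 1 by simp
  qed
  finally show ?thesis .
qed

lemma norm_Outer:
  "integrable circle_measure u \<Longrightarrow> norm z < 1 \<Longrightarrow> norm (Outer u z) = exp (poisson u z)"
  by (simp add: Outer_def Re_schwarz)

lemma Outer_nonzero [simp]: "Outer u z \<noteq> 0"
  by (simp add: Outer_def)

lemma schwarz_add:
  assumes "integrable circle_measure u" "integrable circle_measure v" "norm z < 1"
  shows "schwarz (\<lambda>\<xi>. u \<xi> + v \<xi>) z = schwarz u z + schwarz v z"
  unfolding schwarz_def of_real_add distrib_left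
  by (rule Bochner_Integration.integral_add) (use schwarz_kernel_integrable assms in auto)

lemma schwarz_cmult: "schwarz (\<lambda>\<xi>. a * u \<xi>) z = of_real a * schwarz u z"
  unfolding schwarz_def integral_mult_right_zero[symmetric]
  by (rule Bochner_Integration.integral_cong) auto

lemma schwarz_cong_AE:
  assumes "AE \<xi> in circle_measure. u \<xi> = v \<xi>"
    "u \<in> borel_measurable circle_measure" "v \<in> borel_measurable circle_measure"
  shows "schwarz u z = schwarz v z"
  unfolding schwarz_def
proof (rule integral_cong_AE)
  show "(\<lambda>\<zeta>. (\<zeta> + z) / (\<zeta> - z) * of_real (u \<zeta>)) \<in> borel_measurable circle_measure"
    using assms(2) by measurable
  show "(\<lambda>\<zeta>. (\<zeta> + z) / (\<zeta> - z) * of_real (v \<zeta>)) \<in> borel_measurable circle_measure"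
    using assms(3) by measurable
qed (use assms(1) in auto)

lemma schwarz_0: "schwarz u 0 = of_real (\<integral>\<xi>. u \<xi> \<partial>circle_measure)"
  unfolding schwarz_def integral_complex_of_real[symmetric]
  by (rule Bochner_Integration.integral_cong) auto

section \<open>Bounded analytic functions\<close>

lemma circle_moment:
  "(\<integral>\<xi>. \<xi> ^ n * cnj \<xi> ^ m \<partial>circle_measure) = (if n = m then 1 else 0)"
proof -
  have pos: "(\<integral>\<xi>. \<xi> ^ k \<partial>circle_measure) = (if k = 0 then 1 else 0)" for k :: nat
    using circle_mean_value[of "\<lambda>\<xi>. \<xi> ^ k"]
    by (auto simp: continuous_intros holomorphic_intros)
  show ?thesis
  proof (cases "m \<le> n")
    case True
    have "(\<integral>\<xi>. \<xi> ^ n * cnj \<xi> ^ m \<partial>circle_measure) = (\<integral>\<xi>. \<xi> ^ (n - m) \<partial>circle_measure)"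
    proof (rule Bochner_Integration.integral_cong[OF refl])
      fix \<xi> assume "\<xi> \<in> space circle_measure"
      then have "\<xi> * cnj \<xi> = 1" using complex_norm_square[of \<xi>] by simp
      moreover have "\<xi> ^ n = \<xi> ^ (n - m) * \<xi> ^ m"
        using True by (simp flip: power_add)
      ultimately show "\<xi> ^ n * cnj \<xi> ^ m = \<xi> ^ (n - m)"
        by (simp add: mult.assoc power_mult_distrib[symmetric])
    qed
    then show ?thesis using True by (simp add: pos)
  next
    case False
    have "(\<integral>\<xi>. \<xi> ^ n * cnj \<xi> ^ m \<partial>circle_measure) = (\<integral>\<xi>. cnj (\<xi> ^ (m - n)) \<partial>circle_measure)"
    proof (rule Bochner_Integration.integral_cong[OF refl])
      fix \<xi> assume "\<xi> \<in> space circle_measure"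
      then have "\<xi> * cnj \<xi> = 1" using complex_norm_square[of \<xi>] by simp
      moreover have "cnj \<xi> ^ m = cnj \<xi> ^ n * cnj \<xi> ^ (m - n)"
        using False by (simp flip: power_add)
      ultimately show "\<xi> ^ n * cnj \<xi> ^ m = cnj (\<xi> ^ (m - n))"
        by (simp add: mult.assoc[symmetric] power_mult_distrib[symmetric])
    qed
    also have "\<dots> = cnj (\<integral>\<xi>. \<xi> ^ (m - n) \<partial>circle_measure)" by (rule Bochner_Integration.integral_cnj)
    finally show ?thesis using False by (simp add: pos)
  qed
qed

lemma power_series_integral_sums:
  fixes d :: "nat \<Rightarrow> complex"
  assumes d: "summable (\<lambda>n. norm (d n))" and h: "continuous_on (sphere 0 1) h"
    and D: "\<And>\<xi>. norm \<xi> = 1 \<Longrightarrow> (\<lambda>n. d n * \<xi> ^ n) sums D \<xi>"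
  shows "(\<lambda>n. d n * (\<integral>\<xi>. \<xi> ^ n * h \<xi> \<partial>circle_measure)) sums (\<integral>\<xi>. D \<xi> * h \<xi> \<partial>circle_measure)"
proof -
  let ?f = "\<lambda>n \<xi>. d n * (\<xi> ^ n * h \<xi>)"
  have nf: "norm (?f n \<xi>) = norm (d n) * norm (h \<xi>)" if "norm \<xi> = 1" for n \<xi>
    using that by (simp add: norm_mult norm_power)
  have int: "integrable circle_measure (?f n)" for n
    using h by (intro integrable_circle_continuous continuous_intros)
  have "(\<lambda>n. integral\<^sup>L circle_measure (?f n)) sums (\<integral>\<xi>. (\<Sum>n. ?f n \<xi>) \<partial>circle_measure)"
  proof (rule sums_integral[OF int])
    show "AE \<xi> in circle_measure. summable (\<lambda>n. norm (?f n \<xi>))"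
      by (rule AE_I2) (use d in \<open>auto simp: nf intro!: summable_mult2\<close>)
    have "(\<integral>\<xi>. norm (?f n \<xi>) \<partial>circle_measure) = norm (d n) * (\<integral>\<xi>. norm (h \<xi>) \<partial>circle_measure)" for n
      unfolding integral_mult_right_zero[symmetric]
      by (rule Bochner_Integration.integral_cong) (auto simp: nf)
    then show "summable (\<lambda>n. \<integral>\<xi>. norm (?f n \<xi>) \<partial>circle_measure)"
      using d by (auto intro!: summable_mult2)
  qed
  also have "(\<integral>\<xi>. (\<Sum>n. ?f n \<xi>) \<partial>circle_measure) = (\<integral>\<xi>. D \<xi> * h \<xi> \<partial>circle_measure)"
  proof (rule Bochner_Integration.integral_cong[OF refl])
    fix \<xi> assume "\<xi> \<in> space circle_measure"
    then have "(\<lambda>n. d n * \<xi> ^ n * h \<xi>) sums (D \<xi> * h \<xi>)"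
      by (intro sums_mult2 D) simp
    then show "(\<Sum>n. ?f n \<xi>) = D \<xi> * h \<xi>"
      by (simp add: sums_iff mult.assoc)
  qed
  finally show ?thesis by simp
qed

lemma parseval:
  fixes d :: "nat \<Rightarrow> complex"
  assumes d: "summable (\<lambda>n. norm (d n))" and cont: "continuous_on (sphere 0 1) D"
    and D: "\<And>\<xi>. norm \<xi> = 1 \<Longrightarrow> (\<lambda>n. d n * \<xi> ^ n) sums D \<xi>"
  shows "(\<lambda>n. (norm (d n))\<^sup>2) sums (\<integral>\<xi>. (norm (D \<xi>))\<^sup>2 \<partial>circle_measure)"
proof -
  let ?M = circle_measure
  have coeff: "(\<integral>\<xi>. \<xi> ^ n * cnj (D \<xi>) \<partial>?M) = cnj (d n)" for n
  proof -
    have "(\<lambda>m. d m * (\<integral>\<xi>. \<xi> ^ m * cnj \<xi> ^ n \<partial>?M)) sums (\<integral>\<xi>. D \<xi> * cnj \<xi> ^ n \<partial>?M)"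
      by (rule power_series_integral_sums[OF d _ D]) (auto intro!: continuous_intros)
    moreover have "(\<lambda>m. d m * (\<integral>\<xi>. \<xi> ^ m * cnj \<xi> ^ n \<partial>?M)) = (\<lambda>m. if m = n then d n else 0)"
      by (auto simp: circle_moment fun_eq_iff)
    moreover have "(\<lambda>m. if m = n then d n else 0) sums d n"
      by (rule sums_single)
    ultimately have "(\<integral>\<xi>. D \<xi> * cnj \<xi> ^ n \<partial>?M) = d n"
      by (simp add: sums_unique2)
    then have "cnj (\<integral>\<xi>. D \<xi> * cnj \<xi> ^ n \<partial>?M) = cnj (d n)" by simp
    then show ?thesis
      unfolding Bochner_Integration.integral_cnj[symmetric] by (simp add: mult.commute)
  qed
  have "(\<lambda>n. d n * (\<integral>\<xi>. \<xi> ^ n * cnj (D \<xi>) \<partial>?M)) sums (\<integral>\<xi>. D \<xi> * cnj (D \<xi>) \<partial>?M)"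
    by (rule power_series_integral_sums[OF d _ D]) (auto intro!: continuous_intros cont)
  then have "(\<lambda>n. complex_of_real ((norm (d n))\<^sup>2)) sums complex_of_real (\<integral>\<xi>. (norm (D \<xi>))\<^sup>2 \<partial>?M)"
    unfolding coeff integral_complex_of_real[symmetric] complex_norm_square .
  then show ?thesis by (simp only: sums_of_real_iff)
qed

lemma AE_summable_of_summable_integral:
  fixes h :: "nat \<Rightarrow> complex \<Rightarrow> real"
  assumes h: "\<And>j. integrable circle_measure (h j)" "\<And>j \<xi>. h j \<xi> \<ge> 0"
    and sum: "summable (\<lambda>j. \<integral>\<xi>. h j \<xi> \<partial>circle_measure)"
  shows "AE \<xi> in circle_measure. summable (\<lambda>j. h j \<xi>)"
proof -
  have nn: "0 \<le> (\<integral>\<xi>. h j \<xi> \<partial>circle_measure)" for j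
    by (rule integral_nonneg_AE) (simp add: h(2))
  have m: "(\<lambda>\<xi>. ennreal (h j \<xi>)) \<in> borel_measurable circle_measure" for j
    using h(1) by measurable
  have "(\<integral>\<^sup>+\<xi>. (\<Sum>j. ennreal (h j \<xi>)) \<partial>circle_measure) = (\<Sum>j. \<integral>\<^sup>+\<xi>. ennreal (h j \<xi>) \<partial>circle_measure)"
    by (rule nn_integral_suminf[OF m])
  also have "\<dots> = (\<Sum>j. ennreal (\<integral>\<xi>. h j \<xi> \<partial>circle_measure))"
    by (intro arg_cong[where f = suminf] ext nn_integral_eq_integral h) (use h(2) in auto)
  also have "\<dots> \<noteq> \<infinity>"
    using ennreal_suminf_neq_top[OF sum nn] by simp
  finally have "AE \<xi> in circle_measure. (\<Sum>j. ennreal (h j \<xi>)) \<noteq> \<infinity>"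
    by (rule nn_integral_PInf_AE[rotated]) (use m in measurable)
  then show ?thesis
  proof eventually_elim
    case (elim \<xi>)
    then show ?case using summable_suminf_not_top[of "\<lambda>j. h j \<xi>"] h(2) by simp
  qed
qed

text \<open>By Parseval the dilates of a bounded analytic function form a Cauchy net in \<open>L\<^sup>2\<close>; a fast
  subsequence converges almost everywhere, and its limit is the boundary function.\<close>

theorem bounded_analytic_bdry:
  assumes f: "f holomorphic_on ball 0 1" and B: "\<And>z. norm z < 1 \<Longrightarrow> norm (f z) \<le> B"
  shows "has_bdry f" "AE \<zeta> in circle_measure. norm (bdry f \<zeta>) \<le> B"
    "\<And>z. norm z < 1 \<Longrightarrow> f z = poisson (bdry f) z"
proof -
  let ?M = circle_measure
  define a where "a = (\<lambda>n. (deriv ^^ n) f 0 / fact n)"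
  have cf: "continuous_on (ball 0 1) f" by (rule holomorphic_on_imp_continuous_on[OF f])
  have B0: "B \<ge> 0" using B[of 0] norm_ge_zero[of "f 0"] by (simp del: norm_ge_zero)
  have ser: "(\<lambda>n. a n * w ^ n) sums f w" if "norm w < 1" for w
    using holomorphic_power_series[OF f, of w] that by (simp add: a_def)
  have serr: "(\<lambda>n. (a n * of_real r ^ n) * \<xi> ^ n) sums f (of_real r * \<xi>)"
    if "0 \<le> r" "r < 1" "norm \<xi> = 1" for r \<xi>
    using ser[of "of_real r * \<xi>"] that by (simp add: norm_mult power_mult_distrib mult_ac)
  have summ: "summable (\<lambda>n. norm (a n * of_real r ^ n))" if "0 \<le> r" "r < 1" for r
  proof (rule powser_insidea)
    show "summable (\<lambda>n. a n * of_real ((1 + r) / 2) ^ n)"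
      using ser[of "of_real ((1 + r) / 2)"] that
      by (auto simp: sums_iff abs_of_nonneg simp del: of_real_divide of_real_add)
    show "norm (complex_of_real r) < norm (complex_of_real ((1 + r) / 2))"
      unfolding norm_of_real using that by simp
  qed
  have contr: "continuous_on (sphere 0 1) (\<lambda>\<xi>. f (of_real r * \<xi>))" if "0 \<le> r" "r < 1" for r
    by (rule continuous_on_dilate_sphere[OF cf]) (use that in auto)
  have nr: "norm (of_real r * \<xi>) < 1" if "0 \<le> r" "r < 1" "norm \<xi> = 1" for r and \<xi> :: complex
    using that by (simp add: norm_mult)
  have bess: "(\<Sum>n<N. (norm (a n * of_real r ^ n))\<^sup>2) \<le> B\<^sup>2" if "0 \<le> r" "r < 1" for N r
  proof -
    have s: "(\<lambda>n. (norm (a n * of_real r ^ n))\<^sup>2) sums (\<integral>\<xi>. (norm (f (of_real r * \<xi>)))\<^sup>2 \<partial>?M)"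
      by (rule parseval[OF summ[OF that] contr[OF that] serr[OF that]])
    then have "(\<Sum>n<N. (norm (a n * of_real r ^ n))\<^sup>2) \<le> (\<integral>\<xi>. (norm (f (of_real r * \<xi>)))\<^sup>2 \<partial>?M)"
      using sum_le_suminf[of "\<lambda>n. (norm (a n * of_real r ^ n))\<^sup>2" "{..<N}"] by (auto simp: sums_iff)
    also have "\<dots> \<le> (\<integral>\<xi>. B\<^sup>2 \<partial>?M)"
      by (intro integral_mono integrable_circle_continuous continuous_intros contr power_mono B nr that) auto
    finally show ?thesis by simp
  qed
  have bess1: "(\<Sum>n<N. (norm (a n))\<^sup>2) \<le> B\<^sup>2" for N
  proof (rule tendsto_upperbound)
    have "(\<lambda>j. \<Sum>n<N. (norm (a n * of_real (radius_seq j) ^ n))\<^sup>2) \<longlonglongrightarrow> (\<Sum>n<N. (norm (a n * of_real 1 ^ n))\<^sup>2)"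
      by (intro tendsto_intros radius_seq_tendsto)
    then show "(\<lambda>j. \<Sum>n<N. (norm (a n * of_real (radius_seq j) ^ n))\<^sup>2) \<longlonglongrightarrow> (\<Sum>n<N. (norm (a n))\<^sup>2)"
      by simp
    show "eventually (\<lambda>j. (\<Sum>n<N. (norm (a n * of_real (radius_seq j) ^ n))\<^sup>2) \<le> B\<^sup>2) sequentially"
      by (intro always_eventually allI bess radius_seq_bounds)
  qed auto
  have sa: "summable (\<lambda>n. (norm (a n))\<^sup>2)"
    by (rule summableI_nonneg_bounded[OF _ bess1]) auto
  \<comment> \<open>\<open>T j\<close> is the squared \<open>L\<^sup>2\<close> distance between the boundary function and the \<open>j\<close>-th dilate\<close>
  define T where "T = (\<lambda>j. \<Sum>n. (norm (a n))\<^sup>2 * (1 - radius_seq j ^ n)\<^sup>2)"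
  have pw: "0 \<le> radius_seq j ^ n" "radius_seq j ^ n \<le> 1" for j n
    using radius_seq_bounds[of j] by (auto intro: power_le_one)
  have sq1: "(1 - radius_seq j ^ n)\<^sup>2 \<le> 1" for j n
    using pw[of j n] by (intro power_le_one) auto
  have sT: "summable (\<lambda>n. (norm (a n))\<^sup>2 * (1 - radius_seq j ^ n)\<^sup>2)" for j
    by (rule summable_comparison_test[OF _ sa])
       (use sq1 in \<open>auto intro!: mult_left_le simp: abs_mult\<close>)
  have "(\<lambda>j. \<Sum>n. (norm (a n))\<^sup>2 * (1 - radius_seq j ^ n)\<^sup>2) \<longlonglongrightarrow> (\<Sum>n. 0)"
  proof (rule tannerys_theorem[THEN conjunct2, THEN conjunct2])
    fix n
    have "(\<lambda>j. (norm (a n))\<^sup>2 * (1 - radius_seq j ^ n)\<^sup>2) \<longlonglongrightarrow> (norm (a n))\<^sup>2 * (1 - 1 ^ n)\<^sup>2"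
      by (intro tendsto_intros radius_seq_tendsto)
    then show "(\<lambda>j. (norm (a n))\<^sup>2 * (1 - radius_seq j ^ n)\<^sup>2) \<longlonglongrightarrow> 0" by simp
    show "\<forall>\<^sub>F (k, j) in sequentially \<times>\<^sub>F sequentially.
        norm ((norm (a k))\<^sup>2 * (1 - radius_seq j ^ k)\<^sup>2) \<le> (norm (a k))\<^sup>2"
      by (rule always_eventually) (use sq1 in \<open>auto intro!: mult_left_le simp: abs_mult\<close>)
  qed (use sa in auto)
  then have T0: "T \<longlonglongrightarrow> 0" by (simp add: T_def)
  have "\<exists>i\<ge>j. T i < (1 / 4) ^ j" for j
  proof -
    have "eventually (\<lambda>i. T i < (1 / 4) ^ j) sequentially"
      using T0 by (rule order_tendstoD) simp
    then obtain N where "\<And>i. i \<ge> N \<Longrightarrow> T i < (1 / 4) ^ j"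
      by (auto simp: eventually_sequentially)
    then show ?thesis by (intro exI[of _ "max N j"]) auto
  qed
  then obtain \<nu> where \<nu>: "\<And>j. \<nu> j \<ge> j" "\<And>j. T (\<nu> j) < (1 / 4) ^ j" by metis
  define \<rho> where "\<rho> = (\<lambda>j. radius_seq (\<nu> j))"
  have \<rho>: "0 \<le> \<rho> j" "\<rho> j < 1" for j unfolding \<rho>_def by (rule radius_seq_bounds)+
  have "filterlim \<nu> at_top sequentially"
    by (rule filterlim_at_top_mono[OF filterlim_ident]) (use \<nu>(1) in auto)
  then have \<rho>1: "\<rho> \<longlonglongrightarrow> 1"
    unfolding \<rho>_def by (rule filterlim_compose[OF radius_seq_tendsto])
  define g where "g = (\<lambda>j \<xi>. f (of_real (\<rho> j) * \<xi>))"
  have gc: "continuous_on (sphere 0 1) (g j)" for j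
    unfolding g_def by (rule contr[OF \<rho>])
  define h where "h = (\<lambda>j \<xi>. norm (g (Suc j) \<xi> - g j \<xi>))"
  have hi: "integrable ?M (h j)" for j
    unfolding h_def by (intro integrable_circle_continuous continuous_intros gc)
  have hI: "(\<integral>\<xi>. h j \<xi> \<partial>?M) \<le> 5 * (1 / 2) ^ j" for j
  proof -
    let ?d = "\<lambda>n. a n * of_real (\<rho> (Suc j)) ^ n - a n * of_real (\<rho> j) ^ n"
    have sm: "(\<lambda>n. (norm (?d n))\<^sup>2) sums (\<integral>\<xi>. (norm (g (Suc j) \<xi> - g j \<xi>))\<^sup>2 \<partial>?M)"
    proof (rule parseval)
      show "summable (\<lambda>n. norm (?d n))"
        by (rule summable_comparison_test[OF _ summable_add[OF summ[OF \<rho>(1,2)[of "Suc j"]] summ[OF \<rho>(1,2)[of j]]]])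
           (auto intro: norm_triangle_ineq4)
      show "continuous_on (sphere 0 1) (\<lambda>\<xi>. g (Suc j) \<xi> - g j \<xi>)" by (intro continuous_intros gc)
      show "(\<lambda>n. ?d n * \<xi> ^ n) sums (g (Suc j) \<xi> - g j \<xi>)" if "norm \<xi> = 1" for \<xi>
        unfolding g_def left_diff_distrib by (intro sums_diff serr \<rho> that)
    qed
    have le: "(norm (?d n))\<^sup>2 \<le> 2 * ((norm (a n))\<^sup>2 * (1 - \<rho> (Suc j) ^ n)\<^sup>2) + 2 * ((norm (a n))\<^sup>2 * (1 - \<rho> j ^ n)\<^sup>2)" for n
    proof -
      have "?d n = a n * of_real (\<rho> (Suc j) ^ n - \<rho> j ^ n)" by (simp add: right_diff_distrib)
      then have "(norm (?d n))\<^sup>2 = (norm (a n))\<^sup>2 * (\<rho> (Suc j) ^ n - \<rho> j ^ n)\<^sup>2"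
        by (simp add: norm_mult power_mult_distrib del: of_real_diff)
      also have "\<dots> \<le> (norm (a n))\<^sup>2 * (2 * (1 - \<rho> (Suc j) ^ n)\<^sup>2 + 2 * (1 - \<rho> j ^ n)\<^sup>2)"
      proof (rule mult_left_mono)
        have "0 \<le> ((1 - x) + (1 - y))\<^sup>2" for x y :: real by simp
        from this[of "\<rho> (Suc j) ^ n" "\<rho> j ^ n"]
        show "(\<rho> (Suc j) ^ n - \<rho> j ^ n)\<^sup>2 \<le> 2 * (1 - \<rho> (Suc j) ^ n)\<^sup>2 + 2 * (1 - \<rho> j ^ n)\<^sup>2"
          by (simp add: power2_eq_square algebra_simps)
      qed auto
      finally show ?thesis by (simp add: algebra_simps)
    qed
    have "(\<integral>\<xi>. (norm (g (Suc j) \<xi> - g j \<xi>))\<^sup>2 \<partial>?M)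
        \<le> (\<Sum>n. 2 * ((norm (a n))\<^sup>2 * (1 - \<rho> (Suc j) ^ n)\<^sup>2) + 2 * ((norm (a n))\<^sup>2 * (1 - \<rho> j ^ n)\<^sup>2))"
      unfolding sums_unique[OF sm]
      by (rule suminf_le[OF le sums_summable[OF sm]])
         (unfold \<rho>_def, intro summable_add summable_mult sT)
    also have "\<dots> = 2 * T (\<nu> (Suc j)) + 2 * T (\<nu> j)"
      unfolding \<rho>_def T_def by (simp add: suminf_add[symmetric] suminf_mult sT summable_mult)
    also have "\<dots> \<le> 2 * (1 / 4) ^ j + 2 * (1 / 4) ^ j"
    proof -
      have "(1 / 4 :: real) ^ Suc j \<le> (1 / 4) ^ j" by simp
      then show ?thesis using \<nu>(2)[of j] \<nu>(2)[of "Suc j"] by linarith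
    qed
    finally have L2: "(\<integral>\<xi>. (norm (g (Suc j) \<xi> - g j \<xi>))\<^sup>2 \<partial>?M) \<le> 4 * (1 / 4) ^ j" by simp
    have hi2: "integrable ?M (\<lambda>\<xi>. (norm (g (Suc j) \<xi> - g j \<xi>))\<^sup>2)"
      by (intro integrable_circle_continuous continuous_intros gc)
    \<comment> \<open>from \<open>L\<^sup>2\<close> to \<open>L\<^sup>1\<close>: with weight \<open>t = 2\<^sup>j\<close>, \<open>x \<le> t x\<^sup>2 + 1/t\<close> makes both terms of order \<open>2\<^sup>-\<^sup>j\<close>\<close>
    have "(\<integral>\<xi>. h j \<xi> \<partial>?M) \<le> (\<integral>\<xi>. 2 ^ j * (norm (g (Suc j) \<xi> - g j \<xi>))\<^sup>2 + (1 / 2) ^ j \<partial>?M)"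
    proof (rule integral_mono[OF hi])
      show "integrable ?M (\<lambda>\<xi>. 2 ^ j * (norm (g (Suc j) \<xi> - g j \<xi>))\<^sup>2 + (1 / 2) ^ j)"
        using hi2 by auto
      fix \<xi>
      have am: "x \<le> t * x\<^sup>2 + 1 / t" if "x \<ge> 0" "t > 0" for x t :: real
      proof (cases "x * t \<le> 1")
        case True
        then have "x \<le> 1 / t" using that by (simp add: field_simps)
        then show ?thesis using that by (simp add: add_increasing)
      next
        case False
        then have "x * 1 \<le> x * (x * t)" using that by (intro mult_left_mono) auto
        moreover have "1 / t \<ge> 0" using that by simp
        ultimately show ?thesis by (simp add: power2_eq_square mult_ac add_increasing2)
      qed
      show "h j \<xi> \<le> 2 ^ j * (norm (g (Suc j) \<xi> - g j \<xi>))\<^sup>2 + (1 / 2) ^ j"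
        using am[of "h j \<xi>" "2 ^ j"] by (simp add: h_def power_one_over)
    qed
    also have "\<dots> = 2 ^ j * (\<integral>\<xi>. (norm (g (Suc j) \<xi> - g j \<xi>))\<^sup>2 \<partial>?M) + (1 / 2) ^ j"
      using hi2 by simp
    also have "\<dots> \<le> 2 ^ j * (4 * (1 / 4) ^ j) + (1 / 2) ^ j"
      using L2 by (intro add_right_mono mult_left_mono) auto
    also have "(2::real) ^ j * (4 * (1 / 4) ^ j) = 4 * (2 * (1 / 4)) ^ j"
      unfolding power_mult_distrib by simp
    finally show ?thesis by simp
  qed
  have "AE \<xi> in ?M. summable (\<lambda>j. h j \<xi>)"
  proof (rule AE_summable_of_summable_integral[OF hi])
    show "h j \<xi> \<ge> 0" for j \<xi> by (simp add: h_def)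
    show "summable (\<lambda>j. \<integral>\<xi>. h j \<xi> \<partial>?M)"
      by (rule summable_comparison_test[OF _ summable_mult[OF summable_geometric, of "1 / 2 :: real" 5]])
         (use hI in \<open>auto simp: h_def\<close>)
  qed
  then have conv: "AE \<xi> in ?M. convergent (\<lambda>j. g j \<xi>)"
  proof eventually_elim
    case (elim \<xi>)
    then have "summable (\<lambda>j. g (Suc j) \<xi> - g j \<xi>)"
      unfolding h_def by (rule summable_norm_cancel)
    then have "convergent (\<lambda>n. \<Sum>j<n. g (Suc j) \<xi> - g j \<xi>)" by (simp add: summable_iff_convergent)
    then have "convergent (\<lambda>n. g n \<xi> - g 0 \<xi>)" by (simp add: sum_lessThan_telescope[of "\<lambda>j. g j \<xi>"])
    then have "convergent (\<lambda>n. (g n \<xi> - g 0 \<xi>) + g 0 \<xi>)" by (intro convergent_add convergent_const)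
    then show ?case by simp
  qed
  define \<phi> where "\<phi> = (\<lambda>\<xi>. lim (\<lambda>j. g j \<xi>))"
  have gm: "g j \<in> borel_measurable ?M" for j by (rule continuous_measurable_circle[OF gc])
  have \<phi>m: "\<phi> \<in> borel_measurable ?M" unfolding \<phi>_def using gm by measurable
  have lim: "AE \<xi> in ?M. (\<lambda>j. g j \<xi>) \<longlonglongrightarrow> \<phi> \<xi>"
    using conv unfolding \<phi>_def by eventually_elim (simp add: convergent_LIMSEQ_iff)
  have gB: "norm (g j \<xi>) \<le> B" if "norm \<xi> = 1" for j \<xi>
    unfolding g_def by (intro B nr \<rho> that)
  have \<phi>B: "AE \<xi> in ?M. norm (\<phi> \<xi>) \<le> B"
    using lim AE_space
  proof eventually_elim
    case (elim \<xi>)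
    then show ?case by (intro tendsto_upperbound[OF tendsto_norm[OF elim(1)]]) (auto intro!: always_eventually gB)
  qed
  have \<phi>i: "integrable ?M \<phi>"
    by (rule circle.integrable_const_bound[OF \<phi>B \<phi>m])
  have rep: "f z = poisson \<phi> z" if z: "norm z < 1" for z
  proof -
    have "(\<lambda>j. poisson (g j) z) \<longlonglongrightarrow> poisson \<phi> z"
      unfolding poisson_def
    proof (rule integral_dominated_convergence[where w = "\<lambda>\<xi>. poisson_kernel z \<xi> * B"])
      show "(\<lambda>\<xi>. poisson_kernel z \<xi> *\<^sub>R \<phi> \<xi>) \<in> borel_measurable ?M" using \<phi>m by measurable
      show "(\<lambda>\<xi>. poisson_kernel z \<xi> *\<^sub>R g j \<xi>) \<in> borel_measurable ?M" for j using gm by measurable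
      show "integrable ?M (\<lambda>\<xi>. poisson_kernel z \<xi> * B)"
        using integrable_circle_continuous[OF poisson_kernel_continuous[OF z]] by simp
      show "AE \<xi> in ?M. (\<lambda>j. poisson_kernel z \<xi> *\<^sub>R g j \<xi>) \<longlonglongrightarrow> poisson_kernel z \<xi> *\<^sub>R \<phi> \<xi>"
        using lim by eventually_elim (intro tendsto_intros)
      show "AE \<xi> in ?M. norm (poisson_kernel z \<xi> *\<^sub>R g j \<xi>) \<le> poisson_kernel z \<xi> * B" for j
      proof (rule AE_I2)
        fix \<xi> assume "\<xi> \<in> space ?M"
        then have "norm \<xi> = 1" by simp
        with poisson_kernel_pos[OF z this] gB[OF this, of j]
        show "norm (poisson_kernel z \<xi> *\<^sub>R g j \<xi>) \<le> poisson_kernel z \<xi> * B"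
          by (auto intro!: mult_left_mono simp: abs_of_pos)
      qed
    qed
    moreover have "poisson (g j) z = f (of_real (\<rho> j) * z)" for j
    proof (unfold g_def, rule poisson_formula[OF _ _ z])
      show "continuous_on (cball 0 1) (\<lambda>\<xi>. f (of_real (\<rho> j) * \<xi>))"
        by (rule continuous_on_dilate[OF cf]) (use \<rho>[of j] in auto)
      show "(\<lambda>\<xi>. f (of_real (\<rho> j) * \<xi>)) holomorphic_on ball 0 1"
        by (rule holomorphic_on_dilate[OF f]) (use \<rho>[of j] in auto)
    qed
    moreover have "(\<lambda>j. f (of_real (\<rho> j) * z)) \<longlonglongrightarrow> f z"
    proof (rule isCont_tendsto_compose[where g = f])
      show "isCont f z" using cf z by (simp add: continuous_on_eq_continuous_at)
      have "(\<lambda>j. of_real (\<rho> j) * z) \<longlonglongrightarrow> of_real 1 * z" by (intro tendsto_intros \<rho>1)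
      then show "(\<lambda>j. of_real (\<rho> j) * z) \<longlonglongrightarrow> z" by simp
    qed
    ultimately show ?thesis using LIMSEQ_unique by simp
  qed
  have "AE \<zeta> in ?M. has_angular_limit (poisson \<phi>) \<zeta> (\<phi> \<zeta>)"
    by (rule poisson_angular_limit[OF \<phi>i])
  moreover have "has_angular_limit (poisson \<phi>) \<zeta> w = has_angular_limit f \<zeta> w" for \<zeta> w
    by (rule angular_limit_cong) (use rep in auto)
  ultimately have al: "AE \<zeta> in ?M. has_angular_limit f \<zeta> (\<phi> \<zeta>)" by simp
  show "has_bdry f" by (rule has_bdryI(1)[OF al])
  have eq: "AE \<zeta> in ?M. bdry f \<zeta> = \<phi> \<zeta>" by (rule has_bdryI(2)[OF al])
  with \<phi>B show "AE \<zeta> in circle_measure. norm (bdry f \<zeta>) \<le> B" by eventually_elim simp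
  show "f z = poisson (bdry f) z" if "norm z < 1" for z
    unfolding rep[OF that] by (rule poisson_cong_AE[symmetric, OF eq bdry_measurable[OF cf] \<phi>m])
qed

lemma has_bdry_radial:
  assumes "has_bdry f"
  shows "AE \<zeta> in circle_measure. (\<lambda>n. f (of_real (radius_seq n) * \<zeta>)) \<longlonglongrightarrow> bdry f \<zeta>"
  using assms[unfolded has_bdry_def] AE_space by eventually_elim (auto intro: angular_limit_radial)

lemma bounded_analytic_max:
  assumes f: "f holomorphic_on ball 0 1" and B: "\<And>z. norm z < 1 \<Longrightarrow> norm (f z) \<le> B"
    and C: "AE \<zeta> in circle_measure. norm (bdry f \<zeta>) \<le> C" and z: "norm z < 1"
  shows "norm (f z) \<le> C"
proof -
  note b = bounded_analytic_bdry[OF f B]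
  have m: "bdry f \<in> borel_measurable circle_measure"
    by (rule bdry_measurable[OF holomorphic_on_imp_continuous_on[OF f]])
  have i: "integrable circle_measure (bdry f)"
    by (rule circle.integrable_const_bound[OF b(2) m]) auto
  have "norm (f z) \<le> poisson (\<lambda>\<xi>. norm (bdry f \<xi>)) z"
    using poisson_norm_le[OF z] b(3)[OF _ z] by simp
  also have "\<dots> \<le> poisson (\<lambda>\<xi>. C) z"
    by (rule poisson_mono_AE[OF z]) (use i C in auto)
  also have "\<dots> = C" by (rule poisson_constant[OF z])
  finally show ?thesis .
qed

section \<open>The logarithm of the boundary modulus\<close>

lemma ln_le_ln: "0 < x \<Longrightarrow> x \<le> y \<Longrightarrow> ln x \<le> ln y" for x y :: real
  by (subst ln_le_cancel_iff) auto

lemma poisson_radial: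
  fixes u :: "complex \<Rightarrow> real"
  assumes "integrable circle_measure u"
  shows "AE \<zeta> in circle_measure. (\<lambda>n. poisson u (of_real (radius_seq n) * \<zeta>)) \<longlonglongrightarrow> u \<zeta>"
proof -
  have "integrable circle_measure (\<lambda>\<xi>. complex_of_real (u \<xi>))" using assms by auto
  from poisson_angular_limit[OF this] AE_space show ?thesis
  proof eventually_elim
    case (elim \<zeta>)
    then have "(\<lambda>n. poisson (\<lambda>\<xi>. complex_of_real (u \<xi>)) (of_real (radius_seq n) * \<zeta>)) \<longlonglongrightarrow> of_real (u \<zeta>)"
      by (intro angular_limit_radial) auto
    then show ?case
      unfolding poisson_of_real tendsto_of_real_iff .
  qed
qed

lemma radius_in_disk: "norm \<zeta> = 1 \<Longrightarrow> norm (of_real (radius_seq n) * \<zeta>) < 1" for \<zeta> :: complex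
  using radius_seq_bounds[of n] by (simp add: norm_mult)

lemma norm_Outer_radial:
  assumes "integrable circle_measure u"
  shows "AE \<zeta> in circle_measure. (\<lambda>n. norm (Outer u (of_real (radius_seq n) * \<zeta>))) \<longlonglongrightarrow> exp (u \<zeta>)"
  using poisson_radial[OF assms] AE_space
proof eventually_elim
  case (elim \<zeta>)
  then have "norm (Outer u (of_real (radius_seq n) * \<zeta>)) = exp (poisson u (of_real (radius_seq n) * \<zeta>))" for n
    using assms by (intro norm_Outer radius_in_disk) auto
  then show ?case using tendsto_exp[OF elim(1)] by simp
qed

lemma norm_bdry_quotient:
  assumes u: "integrable circle_measure u" and f: "has_bdry f" and g: "has_bdry (\<lambda>z. f z / Outer u z)"
  shows "AE \<zeta> in circle_measure. norm (bdry (\<lambda>z. f z / Outer u z) \<zeta>) = norm (bdry f \<zeta>) / exp (u \<zeta>)"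
  using has_bdry_radial[OF g] has_bdry_radial[OF f] norm_Outer_radial[OF u]
proof eventually_elim
  case (elim \<zeta>)
  have "(\<lambda>n. norm (f (of_real (radius_seq n) * \<zeta>)) / norm (Outer u (of_real (radius_seq n) * \<zeta>)))
      \<longlonglongrightarrow> norm (bdry f \<zeta>) / exp (u \<zeta>)"
    by (intro tendsto_intros elim) simp
  with tendsto_norm[OF elim(1)] show ?case
    unfolding norm_divide by (rule LIMSEQ_unique)
qed

lemma poisson_lower:
  fixes u :: "complex \<Rightarrow> real"
  assumes "norm z < 1" "integrable circle_measure u" "AE \<xi> in circle_measure. c \<le> u \<xi>"
  shows "c \<le> poisson u z"
  using poisson_mono_AE[OF assms(1) _ assms(2,3)] poisson_constant[OF assms(1), of c] by simp

lemma poisson_upper: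
  fixes u :: "complex \<Rightarrow> real"
  assumes "norm z < 1" "integrable circle_measure u" "AE \<xi> in circle_measure. u \<xi> \<le> c"
  shows "poisson u z \<le> c"
  using poisson_mono_AE[OF assms(1,2) _ assms(3)] poisson_constant[OF assms(1), of c] by simp

text \<open>Dividing by the outer function with boundary modulus \<open>\<bar>f\<bar> + \<epsilon>\<close>, which is bounded away
  from 0, leaves a bounded function of boundary modulus at most 1, hence bounded by 1 in the disk.\<close>

lemma bounded_analytic_le_regularized:
  assumes f: "f holomorphic_on ball 0 1" and B: "\<And>z. norm z < 1 \<Longrightarrow> norm (f z) \<le> B"
    and \<epsilon>: "\<epsilon> > 0" and z: "norm z < 1"
  shows "integrable circle_measure (\<lambda>\<zeta>. ln (norm (bdry f \<zeta>) + \<epsilon>))"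
    and "norm (f z) \<le> exp (poisson (\<lambda>\<zeta>. ln (norm (bdry f \<zeta>) + \<epsilon>)) z)"
proof -
  let ?M = circle_measure
  let ?u = "\<lambda>\<zeta>. ln (norm (bdry f \<zeta>) + \<epsilon>)"
  note b = bounded_analytic_bdry[OF f B, simplified]
  have B0: "B \<ge> 0" using B[of 0] norm_ge_zero[of "f 0"] by (simp del: norm_ge_zero)
  have fm: "bdry f \<in> borel_measurable ?M"
    by (rule bdry_measurable[OF holomorphic_on_imp_continuous_on[OF f]])
  have um: "?u \<in> borel_measurable ?M" using fm by measurable
  have "AE \<zeta> in ?M. norm (?u \<zeta>) \<le> max \<bar>ln \<epsilon>\<bar> \<bar>ln (B + \<epsilon>)\<bar>"
    using b(2)
  proof eventually_elim
    case (elim \<zeta>)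
    have pos: "0 < norm (bdry f \<zeta>) + \<epsilon>" "0 < B + \<epsilon>" using \<epsilon> B0 by (auto simp: add_nonneg_pos)
    have "ln \<epsilon> \<le> ?u \<zeta>" "?u \<zeta> \<le> ln (B + \<epsilon>)"
      unfolding ln_le_cancel_iff[OF \<epsilon> pos(1)] ln_le_cancel_iff[OF pos] using elim by simp_all
    then show ?case by auto
  qed
  then show ui: "integrable ?M ?u" by (rule circle.integrable_const_bound[OF _ um])
  let ?q = "\<lambda>z. f z / Outer ?u z"
  have qh: "?q holomorphic_on ball 0 1"
    by (intro holomorphic_intros f Outer_holomorphic ui) auto
  have qB: "norm (?q z) \<le> B / \<epsilon>" if z: "norm z < 1" for z
  proof -
    have "ln \<epsilon> \<le> poisson ?u z"
      by (rule poisson_lower[OF z ui]) (use \<epsilon> in \<open>auto intro!: AE_I2 ln_le_ln\<close>)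
    then have "\<epsilon> \<le> norm (Outer ?u z)"
      unfolding norm_Outer[OF ui z] using \<epsilon> by (metis exp_le_cancel_iff exp_ln)
    then show ?thesis unfolding norm_divide using B[OF z] \<epsilon> B0 by (intro frac_le) auto
  qed
  have hq: "has_bdry ?q"
    by (rule bounded_analytic_bdry(1)[OF qh qB])
  have "AE \<zeta> in ?M. norm (bdry ?q \<zeta>) \<le> 1"
    using norm_bdry_quotient[OF ui b(1) hq]
  proof eventually_elim
    case (elim \<zeta>)
    have pos: "norm (bdry f \<zeta>) + \<epsilon> > 0" using \<epsilon> by (simp add: add_nonneg_pos)
    have "norm (bdry ?q \<zeta>) = norm (bdry f \<zeta>) / (norm (bdry f \<zeta>) + \<epsilon>)"
      using elim by (simp only: exp_ln[OF pos])
    also have "\<dots> \<le> 1" using \<epsilon> pos by simp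
    finally show ?case .
  qed
  from bounded_analytic_max[OF qh qB this z]
  show "norm (f z) \<le> exp (poisson ?u z)"
    unfolding norm_divide norm_Outer[OF ui z] by (simp add: divide_le_eq)
qed

text \<open>Let \<open>\<epsilon> = 1/(n + 1)\<close> tend to 0 in the regularized inequality. At a point \<open>z0\<close> with \<open>f z0 \<noteq> 0\<close> it bounds
  the increasing integrals of \<open>L - log (\<bar>f\<bar> + \<epsilon>)\<close>, so monotone convergence gives the integrability of
  \<open>log \<bar>f\<bar>\<close>, and a boundary zero set of positive measure would make these integrals unbounded.\<close>

theorem bounded_analytic_log_bdry:
  assumes f: "f holomorphic_on ball 0 1" and B: "\<And>z. norm z < 1 \<Longrightarrow> norm (f z) \<le> B"
    and z0: "norm z0 < 1" "f z0 \<noteq> 0"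
  shows "AE \<zeta> in circle_measure. bdry f \<zeta> \<noteq> 0"
    and "integrable circle_measure (\<lambda>\<zeta>. ln (norm (bdry f \<zeta>)))"
    and "\<And>z. norm z < 1 \<Longrightarrow> norm (f z) \<le> exp (poisson (\<lambda>\<zeta>. ln (norm (bdry f \<zeta>))) z)"
proof -
  let ?M = circle_measure
  note b = bounded_analytic_bdry[OF f B, simplified]
  have B0: "B \<ge> 0" using B[of 0] norm_ge_zero[of "f 0"] by (simp del: norm_ge_zero)
  have fm: "bdry f \<in> borel_measurable ?M"
    by (rule bdry_measurable[OF holomorphic_on_imp_continuous_on[OF f]])
  define u where "u = (\<lambda>n \<zeta>. ln (norm (bdry f \<zeta>) + 1 / (real n + 1)))"
  have ui: "integrable ?M (u n)" for n
    unfolding u_def by (rule bounded_analytic_le_regularized(1)[OF f B _ z0(1)]) auto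
  have fu: "norm (f z) \<le> exp (poisson (u n) z)" if "norm z < 1" for n z
    unfolding u_def by (rule bounded_analytic_le_regularized(2)[OF f B _ that]) auto
  define L where "L = ln (B + 1)"
  define v where "v = (\<lambda>n \<zeta>. L - u n \<zeta>)"
  have vi: "integrable ?M (v n)" for n unfolding v_def using ui by auto
  have v0: "AE \<zeta> in ?M. 0 \<le> v n \<zeta>" for n
    using b(2)
  proof eventually_elim
    case (elim \<zeta>)
    have "1 / (real n + 1) \<le> 1" by simp
    then have "norm (bdry f \<zeta>) + 1 / (real n + 1) \<le> B + 1" using elim by linarith
    moreover have "0 < norm (bdry f \<zeta>) + 1 / (real n + 1)" by (simp add: add_nonneg_pos)
    ultimately show ?case by (simp add: v_def u_def L_def)
  qed
  define c where "c = (1 - norm z0) / 4"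
  have c0: "c > 0" using z0 by (simp add: c_def)
  define K where "K = (L - ln (norm (f z0))) / c"
  have vK: "(\<integral>\<zeta>. v n \<zeta> \<partial>?M) \<le> K" for n
  proof -
    have "c * (\<integral>\<zeta>. v n \<zeta> \<partial>?M) = (\<integral>\<zeta>. c * v n \<zeta> \<partial>?M)" by simp
    also have "\<dots> \<le> (\<integral>\<zeta>. poisson_kernel z0 \<zeta> *\<^sub>R v n \<zeta> \<partial>?M)"
    proof (rule integral_mono_AE)
      show "integrable ?M (\<lambda>\<zeta>. c * v n \<zeta>)" using vi by auto
      show "integrable ?M (\<lambda>\<zeta>. poisson_kernel z0 \<zeta> *\<^sub>R v n \<zeta>)"
        by (rule poisson_kernel_integrable[OF z0(1) vi])
      show "AE \<zeta> in ?M. c * v n \<zeta> \<le> poisson_kernel z0 \<zeta> *\<^sub>R v n \<zeta>"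
        using v0[of n] AE_space
      proof eventually_elim
        case (elim \<zeta>)
        have "c \<le> poisson_kernel z0 \<zeta>"
          unfolding c_def using elim(2) by (intro poisson_kernel_ge z0) simp
        from mult_right_mono[OF this elim(1)] show ?case by simp
      qed
    qed
    also have "\<dots> = poisson (\<lambda>\<zeta>. L - u n \<zeta>) z0" by (simp add: poisson_def v_def)
    also have "\<dots> = L - poisson (u n) z0"
      using poisson_diff[OF z0(1) _ ui, of "\<lambda>_. L"] poisson_constant[OF z0(1), of L] by simp
    also have "\<dots> \<le> L - ln (norm (f z0))"
      using fu[OF z0(1), of n] z0(2) by (metis diff_left_mono exp_gt_zero ln_exp ln_le_cancel_iff zero_less_norm_iff)
    finally show ?thesis using c0 by (simp add: K_def field_simps)
  qed
  \<comment> \<open>on \<open>N\<close> the integrand is at least \<open>ln (n + 1)\<close>, which is unbounded in \<open>n\<close>\<close>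
  define N where "N = {\<zeta> \<in> space ?M. bdry f \<zeta> = 0}"
  have NM: "N \<in> sets ?M" unfolding N_def using fm by measurable
  have mN: "measure ?M N * ln (real n + 1) \<le> K" for n
  proof -
    have "measure ?M N * ln (real n + 1) = (\<integral>\<zeta>. indicator N \<zeta> * ln (real n + 1) \<partial>?M)"
      using NM sets.sets_into_space[OF NM] by (simp add: Int_absorb2)
    also have "\<dots> \<le> (\<integral>\<zeta>. v n \<zeta> \<partial>?M)"
    proof (rule integral_mono_AE[OF _ vi])
      have "emeasure ?M N < \<infinity>" by (metis circle.emeasure_finite infinity_ennreal_def top.not_eq_extremum)
      then show "integrable ?M (\<lambda>\<zeta>. indicator N \<zeta> * ln (real n + 1))"
        using NM by (intro integrable_mult_left integrable_real_indicator)
      show "AE \<zeta> in ?M. indicator N \<zeta> * ln (real n + 1) \<le> v n \<zeta>"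
        using v0[of n]
      proof eventually_elim
        case (elim \<zeta>)
        have "ln (1 / (real n + 1)) = - ln (real n + 1)" by (simp add: ln_div)
        then show ?case using elim B0 by (auto simp: indicator_def N_def v_def u_def L_def)
      qed
    qed
    also have "\<dots> \<le> K" by (rule vK)
    finally show ?thesis .
  qed
  have "measure ?M N = 0"
  proof (rule ccontr)
    assume "measure ?M N \<noteq> 0"
    then have p: "measure ?M N > 0" by (simp add: zero_less_measure_iff)
    obtain n where n: "exp (K / measure ?M N) < real n" using reals_Archimedean2 by blast
    then have "K / measure ?M N < ln (real n + 1)"
      by (metis add_pos_nonneg exp_gt_zero less_add_one less_trans ln_exp ln_less_cancel_iff)
    then have "K < measure ?M N * ln (real n + 1)" using p by (simp add: field_simps)
    with mN[of n] show False by simp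
  qed
  then have "emeasure ?M N = 0" by (simp add: circle.emeasure_eq_measure)
  then have "N \<in> null_sets ?M" using NM by auto
  then show nz: "AE \<zeta> in ?M. bdry f \<zeta> \<noteq> 0"
    by (rule AE_I') (auto simp: N_def)
  let ?l = "\<lambda>\<zeta>. ln (norm (bdry f \<zeta>))"
  have lm: "?l \<in> borel_measurable ?M" using fm by measurable
  have unit: "(\<lambda>n. 1 / (real n + 1)) \<longlonglongrightarrow> 0"
    using LIMSEQ_inverse_real_of_nat by (simp add: inverse_eq_divide add.commute)
  have ul: "AE \<zeta> in ?M. (\<lambda>n. u n \<zeta>) \<longlonglongrightarrow> ?l \<zeta>"
    using nz
  proof eventually_elim
    case (elim \<zeta>)
    have "(\<lambda>n. norm (bdry f \<zeta>) + 1 / (real n + 1)) \<longlonglongrightarrow> norm (bdry f \<zeta>) + 0"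
      by (intro tendsto_intros unit)
    then show ?case unfolding u_def using elim by (intro tendsto_ln) auto
  qed
  have dec: "u n \<zeta> \<le> u m \<zeta>" if "m \<le> n" for m n \<zeta>
  proof -
    have "1 / (real n + 1) \<le> 1 / (real m + 1)" using that by (intro divide_left_mono) auto
    then show ?thesis unfolding u_def by (subst ln_le_cancel_iff) (auto simp: add_nonneg_pos)
  qed
  have vmono: "mono (\<lambda>n. v n \<zeta>)" for \<zeta>
    using dec by (auto simp: v_def mono_def)
  have "incseq (\<lambda>n. \<integral>\<zeta>. v n \<zeta> \<partial>?M)"
    by (auto simp: incseq_def intro!: integral_mono vi dest: monoD[OF vmono])
  then obtain x where x: "(\<lambda>n. \<integral>\<zeta>. v n \<zeta> \<partial>?M) \<longlonglongrightarrow> x"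
    using incseq_convergent[of _ K] vK by blast
  have "integrable ?M (\<lambda>\<zeta>. L - ?l \<zeta>)"
  proof (rule integral_monotone_convergence_nonneg[OF vi _ v0 _ x])
    show "AE \<zeta> in ?M. (\<lambda>n. v n \<zeta>) \<longlonglongrightarrow> L - ?l \<zeta>"
      using ul by eventually_elim (auto simp: v_def intro!: tendsto_intros)
  qed (use lm vmono in auto)
  from Bochner_Integration.integrable_diff[OF circle.integrable_const[of L] this]
  show li: "integrable ?M ?l" by simp
  show "norm (f z) \<le> exp (poisson ?l z)" if z: "norm z < 1" for z
  proof -
    have "(\<lambda>n. poisson (u n) z) \<longlonglongrightarrow> poisson ?l z"
      unfolding poisson_def
    proof (rule integral_dominated_convergence[where w = "\<lambda>\<zeta>. poisson_kernel z \<zeta> *\<^sub>R (\<bar>?l \<zeta>\<bar> + \<bar>u 0 \<zeta>\<bar>)"])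
      show "(\<lambda>\<zeta>. poisson_kernel z \<zeta> *\<^sub>R ?l \<zeta>) \<in> borel_measurable ?M" using lm by measurable
      show "(\<lambda>\<zeta>. poisson_kernel z \<zeta> *\<^sub>R u n \<zeta>) \<in> borel_measurable ?M" for n using ui[of n] by measurable
      show "integrable ?M (\<lambda>\<zeta>. poisson_kernel z \<zeta> *\<^sub>R (\<bar>?l \<zeta>\<bar> + \<bar>u 0 \<zeta>\<bar>))"
        using li ui[of 0] by (intro poisson_kernel_integrable[OF z]) auto
      show "AE \<zeta> in ?M. (\<lambda>n. poisson_kernel z \<zeta> *\<^sub>R u n \<zeta>) \<longlonglongrightarrow> poisson_kernel z \<zeta> *\<^sub>R ?l \<zeta>"
        using ul by eventually_elim (intro tendsto_intros)
      show "AE \<zeta> in ?M. norm (poisson_kernel z \<zeta> *\<^sub>R u n \<zeta>) \<le> poisson_kernel z \<zeta> *\<^sub>R (\<bar>?l \<zeta>\<bar> + \<bar>u 0 \<zeta>\<bar>)" for n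
        using nz AE_space
      proof eventually_elim
        case (elim \<zeta>)
        have "?l \<zeta> \<le> u n \<zeta>"
          unfolding u_def using elim(1) by (subst ln_le_cancel_iff) (auto simp: add_pos_nonneg)
        moreover have "u n \<zeta> \<le> u 0 \<zeta>" by (rule dec) simp
        ultimately have "\<bar>u n \<zeta>\<bar> \<le> \<bar>?l \<zeta>\<bar> + \<bar>u 0 \<zeta>\<bar>" by linarith
        then show ?case
          using poisson_kernel_pos[OF z, of \<zeta>] elim(2) by (auto simp: abs_mult intro!: mult_left_mono)
      qed
    qed
    then have "(\<lambda>n. exp (poisson (u n) z)) \<longlonglongrightarrow> exp (poisson ?l z)" by (rule tendsto_exp)
    then show ?thesis by (rule tendsto_lowerbound) (use fu[OF z] in auto)
  qed
qed

text \<open>Values in the right half-plane force equality: \<open>1/(f + \<epsilon>)\<close> is bounded as well, and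
  \<open>\<bar>f + \<epsilon>\<bar> \<ge> \<bar>f\<bar>\<close> on the boundary.\<close>

lemma right_half_plane_norm_eq:
  assumes f: "f holomorphic_on ball 0 1" and B: "\<And>z. norm z < 1 \<Longrightarrow> norm (f z) \<le> B"
    and pos: "\<And>z. norm z < 1 \<Longrightarrow> Re (f z) > 0" and z: "norm z < 1"
  shows "norm (f z) = exp (poisson (\<lambda>\<zeta>. ln (norm (bdry f \<zeta>))) z)"
proof (rule antisym)
  let ?M = circle_measure
  let ?l = "\<lambda>\<zeta>. ln (norm (bdry f \<zeta>))"
  have f0: "f 0 \<noteq> 0" using pos[of 0] by auto
  note L = bounded_analytic_log_bdry[OF f B _ f0, simplified]
  show "norm (f z) \<le> exp (poisson ?l z)" by (rule L(3)[OF z])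
  have hb: "has_bdry f" by (rule bounded_analytic_bdry(1)[OF f B])
  have low: "exp (poisson ?l z) \<le> norm (f z + of_real \<epsilon>)" if \<epsilon>: "\<epsilon> > 0" for \<epsilon>
  proof -
    let ?g = "\<lambda>z. 1 / (f z + of_real \<epsilon>)"
    have re: "Re (f z + of_real \<epsilon>) \<ge> \<epsilon>" if "norm z < 1" for z using pos[OF that] by simp
    have ne: "f z + of_real \<epsilon> \<noteq> 0" if "norm z < 1" for z
    proof
      assume "f z + of_real \<epsilon> = 0"
      then have "Re (f z + of_real \<epsilon>) = 0" by (simp only: zero_complex.sel)
      with re[OF that] \<epsilon> show False by linarith
    qed
    have gh: "?g holomorphic_on ball 0 1" by (intro holomorphic_intros f) (use ne in auto)
    have gB: "norm (?g z) \<le> 1 / \<epsilon>" if z: "norm z < 1" for z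
    proof -
      have "\<epsilon> \<le> norm (f z + of_real \<epsilon>)" using re[OF z] complex_Re_le_cmod order_trans by blast
      then show ?thesis unfolding norm_divide using \<epsilon> by (auto intro!: divide_left_mono mult_pos_pos)
    qed
    have g0: "?g 0 \<noteq> 0" using ne[of 0] by simp
    note G = bounded_analytic_log_bdry[OF gh gB _ g0, simplified]
    have ghb: "has_bdry ?g" by (rule bounded_analytic_bdry(1)[OF gh gB])
    have "AE \<zeta> in ?M. ln (norm (bdry ?g \<zeta>)) \<le> - ?l \<zeta>"
      using has_bdry_radial[OF ghb] has_bdry_radial[OF hb] L(1) AE_space
    proof eventually_elim
      case (elim \<zeta>)
      have rd: "norm (of_real (radius_seq n) * \<zeta>) < 1" for n using elim by (intro radius_in_disk) auto
      have "0 \<le> Re (bdry f \<zeta>)"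
        by (rule tendsto_lowerbound[OF tendsto_Re[OF elim(2)]]) (use pos[OF rd] in \<open>auto intro!: always_eventually less_imp_le\<close>)
      then have "(norm (bdry f \<zeta>))\<^sup>2 \<le> (norm (bdry f \<zeta> + of_real \<epsilon>))\<^sup>2"
        unfolding cmod_power2 using \<epsilon> by (auto intro!: add_mono power_mono)
      then have le: "norm (bdry f \<zeta>) \<le> norm (bdry f \<zeta> + of_real \<epsilon>)"
        by (rule power2_le_imp_le) simp
      have ne': "bdry f \<zeta> + of_real \<epsilon> \<noteq> 0" using le elim(3) by auto
      have "(\<lambda>n. ?g (of_real (radius_seq n) * \<zeta>)) \<longlonglongrightarrow> 1 / (bdry f \<zeta> + of_real \<epsilon>)"
        by (intro tendsto_intros elim ne')
      with elim(1) have "bdry ?g \<zeta> = 1 / (bdry f \<zeta> + of_real \<epsilon>)" by (rule LIMSEQ_unique)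
      then have "ln (norm (bdry ?g \<zeta>)) = - ln (norm (bdry f \<zeta> + of_real \<epsilon>))"
        using ne' by (simp add: norm_divide ln_div)
      also have "\<dots> \<le> - ?l \<zeta>" using ln_le_ln[OF _ le] elim(3) by simp
      finally show ?case .
    qed
    then have "poisson (\<lambda>\<zeta>. ln (norm (bdry ?g \<zeta>))) z \<le> poisson (\<lambda>\<zeta>. - ?l \<zeta>) z"
      using G(2) L(2) by (intro poisson_mono_AE[OF z]) auto
    also have "\<dots> = - poisson ?l z" by (simp add: poisson_def)
    finally have "exp (poisson (\<lambda>\<zeta>. ln (norm (bdry ?g \<zeta>))) z) \<le> exp (- poisson ?l z)" by simp
    with G(3)[OF z] have "norm (?g z) \<le> exp (- poisson ?l z)" by (meson order_trans)
    then have "1 / norm (f z + of_real \<epsilon>) \<le> 1 / exp (poisson ?l z)"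
      by (simp add: norm_divide exp_minus inverse_eq_divide)
    then show ?thesis using ne[OF z] by (simp add: divide_le_eq field_simps)
  qed
  show "exp (poisson ?l z) \<le> norm (f z)"
  proof (rule field_le_epsilon)
    fix e :: real assume e: "e > 0"
    have "norm (f z + of_real e) \<le> norm (f z) + e"
      using norm_triangle_ineq[of "f z" "of_real e"] e by simp
    with low[OF e] show "exp (poisson ?l z) \<le> norm (f z) + e" by linarith
  qed
qed

text \<open>Splitting \<open>u\<close> into its positive and negative parts writes \<open>Outer u\<close> as a quotient of two outer functions
  bounded by 1, whose boundary functions vanish almost nowhere.\<close>

lemma Outer_bdry:
  assumes u: "integrable circle_measure u"
  shows "has_bdry (Outer u)" "AE \<zeta> in circle_measure. norm (bdry (Outer u) \<zeta>) = exp (u \<zeta>)"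
proof -
  let ?M = circle_measure
  let ?v = "\<lambda>\<zeta>. min (u \<zeta>) 0" and ?w = "\<lambda>\<zeta>. - max (u \<zeta>) 0"
  have vi: "integrable ?M ?v" and wi: "integrable ?M ?w" using u by auto
  have b1: "norm (Outer s z) \<le> 1" if "integrable ?M s" "\<And>\<zeta>. s \<zeta> \<le> 0" "norm z < 1" for s z
    using poisson_upper[OF that(3,1), of 0] that by (simp add: norm_Outer)
  note V = bounded_analytic_bdry[OF Outer_holomorphic[OF vi] b1[OF vi], simplified]
  note W = bounded_analytic_bdry[OF Outer_holomorphic[OF wi] b1[OF wi], simplified]
  note W0 = bounded_analytic_log_bdry[OF Outer_holomorphic[OF wi] b1[OF wi] _ Outer_nonzero[of ?w 0], simplified]
  have quot: "Outer ?v z / Outer ?w z = Outer u z" if z: "norm z < 1" for z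
  proof -
    have "schwarz ?v z = schwarz (\<lambda>\<zeta>. u \<zeta> + ?w \<zeta>) z"
      by (rule arg_cong[where f = "\<lambda>u. schwarz u z"]) (auto simp: fun_eq_iff min_def max_def)
    also have "\<dots> = schwarz u z + schwarz ?w z" by (rule schwarz_add[OF u wi z])
    finally show ?thesis by (simp add: Outer_def exp_add)
  qed
  have "AE \<zeta> in ?M. has_angular_limit (Outer u) \<zeta> (bdry (Outer ?v) \<zeta> / bdry (Outer ?w) \<zeta>)"
    using V(1)[unfolded has_bdry_def] W(1)[unfolded has_bdry_def] W0(1)
  proof eventually_elim
    case (elim \<zeta>)
    from angular_limit_divide[OF elim]
    show ?case using angular_limit_cong[of "\<lambda>z. Outer ?v z / Outer ?w z" "Outer u"] quot by simp
  qed
  then show hb: "has_bdry (Outer u)" by (rule has_bdryI)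
  show "AE \<zeta> in ?M. norm (bdry (Outer u) \<zeta>) = exp (u \<zeta>)"
    using has_bdry_radial[OF hb] norm_Outer_radial[OF u]
  proof eventually_elim
    case (elim \<zeta>)
    show ?case by (rule LIMSEQ_unique[OF tendsto_norm[OF elim(1)] elim(2)])
  qed
qed

section \<open>Hardy spaces\<close>

lemma hardy_holomorphic: "f \<in> hardy p \<Longrightarrow> f holomorphic_on ball 0 1"
  by (simp add: hardy_def)

lemma hardy_continuous: "f \<in> hardy p \<Longrightarrow> continuous_on (ball 0 1) f"
  by (intro holomorphic_on_imp_continuous_on hardy_holomorphic)

lemma hardy_bdry_measurable: "f \<in> hardy p \<Longrightarrow> bdry f \<in> borel_measurable circle_measure"
  by (intro bdry_measurable hardy_continuous)

lemma dilate_powr_integrable: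
  assumes "continuous_on (ball 0 1) f" "0 \<le> r" "r < 1" "p > 0"
  shows "integrable circle_measure (\<lambda>\<zeta>. norm (f (of_real r * \<zeta>)) powr p)"
  by (intro integrable_circle_continuous continuous_on_powr' continuous_intros continuous_on_dilate_sphere assms)
     (use assms in auto)

lemma hardyI:
  assumes "f holomorphic_on ball 0 1"
    "\<And>r. 0 \<le> r \<Longrightarrow> r < 1 \<Longrightarrow> (\<integral>\<zeta>. norm (f (of_real r * \<zeta>)) powr p \<partial>circle_measure) \<le> B"
  shows "f \<in> hardy p"
  unfolding hardy_def by (intro CollectI conjI exI[of _ B] ballI) (use assms in auto)

lemma hardyE:
  assumes "f \<in> hardy p"
  obtains B where "\<And>r. 0 \<le> r \<Longrightarrow> r < 1 \<Longrightarrow> (\<integral>\<zeta>. norm (f (of_real r * \<zeta>)) powr p \<partial>circle_measure) \<le> B"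
proof -
  from assms obtain B where
    B: "\<forall>r\<in>{0..<1}. (\<integral>\<zeta>. norm (f (of_real r * \<zeta>)) powr p \<partial>circle_measure) \<le> B"
    unfolding hardy_def by blast
  show thesis by (rule that[of B]) (use B in auto)
qed

lemma hardy_add:
  assumes f: "f \<in> hardy p" and g: "g \<in> hardy p" and p: "p > 0"
  shows "(\<lambda>z. f z + g z) \<in> hardy p"
proof -
  obtain A where A: "\<And>r. 0 \<le> r \<Longrightarrow> r < 1 \<Longrightarrow> (\<integral>\<zeta>. norm (f (of_real r * \<zeta>)) powr p \<partial>circle_measure) \<le> A"
    by (rule hardyE[OF f]) blast
  obtain B where B: "\<And>r. 0 \<le> r \<Longrightarrow> r < 1 \<Longrightarrow> (\<integral>\<zeta>. norm (g (of_real r * \<zeta>)) powr p \<partial>circle_measure) \<le> B"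
    by (rule hardyE[OF g]) blast
  show ?thesis
  proof (rule hardyI)
    show hol: "(\<lambda>z. f z + g z) holomorphic_on ball 0 1"
      by (intro holomorphic_intros hardy_holomorphic[OF f] hardy_holomorphic[OF g])
    fix r :: real assume r: "0 \<le> r" "r < 1"
    have fi: "integrable circle_measure (\<lambda>\<zeta>. norm (f (of_real r * \<zeta>)) powr p)"
      by (rule dilate_powr_integrable[OF hardy_continuous[OF f] r p])
    have gi: "integrable circle_measure (\<lambda>\<zeta>. norm (g (of_real r * \<zeta>)) powr p)"
      by (rule dilate_powr_integrable[OF hardy_continuous[OF g] r p])
    have "(\<integral>\<zeta>. norm (f (of_real r * \<zeta>) + g (of_real r * \<zeta>)) powr p \<partial>circle_measure)
        \<le> (\<integral>\<zeta>. 2 powr p * (norm (f (of_real r * \<zeta>)) powr p + norm (g (of_real r * \<zeta>)) powr p) \<partial>circle_measure)"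
    proof (rule integral_mono)
      show "integrable circle_measure (\<lambda>\<zeta>. norm (f (of_real r * \<zeta>) + g (of_real r * \<zeta>)) powr p)"
        by (rule dilate_powr_integrable[OF holomorphic_on_imp_continuous_on[OF hol] r p])
      show "integrable circle_measure (\<lambda>\<zeta>. 2 powr p * (norm (f (of_real r * \<zeta>)) powr p + norm (g (of_real r * \<zeta>)) powr p))"
        using fi gi by auto
      fix \<zeta>
      define a b where "a = norm (f (of_real r * \<zeta>))" and "b = norm (g (of_real r * \<zeta>))"
      have ab: "a \<ge> 0" "b \<ge> 0" by (auto simp: a_def b_def)
      have "norm (f (of_real r * \<zeta>) + g (of_real r * \<zeta>)) \<le> 2 * max a b"
        using norm_triangle_ineq[of "f (of_real r * \<zeta>)" "g (of_real r * \<zeta>)"] by (simp add: a_def b_def max_def)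
      then have "norm (f (of_real r * \<zeta>) + g (of_real r * \<zeta>)) powr p \<le> (2 * max a b) powr p"
        using p by (intro powr_mono2) auto
      also have "\<dots> = 2 powr p * max a b powr p" using ab by (intro powr_mult)
      also have "\<dots> \<le> 2 powr p * (a powr p + b powr p)" by (intro mult_left_mono) (auto simp: max_def)
      finally show "norm (f (of_real r * \<zeta>) + g (of_real r * \<zeta>)) powr p
          \<le> 2 powr p * (norm (f (of_real r * \<zeta>)) powr p + norm (g (of_real r * \<zeta>)) powr p)"
        by (simp add: a_def b_def)
    qed
    also have "\<dots> = 2 powr p * ((\<integral>\<zeta>. norm (f (of_real r * \<zeta>)) powr p \<partial>circle_measure)
        + (\<integral>\<zeta>. norm (g (of_real r * \<zeta>)) powr p \<partial>circle_measure))"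
      using fi gi by simp
    also have "\<dots> \<le> 2 powr p * (A + B)"
      using A[OF r] B[OF r] by (intro mult_left_mono add_mono) auto
    finally show "(\<integral>\<zeta>. norm (f (of_real r * \<zeta>) + g (of_real r * \<zeta>)) powr p \<partial>circle_measure) \<le> 2 powr p * (A + B)" .
  qed
qed

lemma hardy_mult_bounded:
  assumes f: "f \<in> hardy p" and h: "h holomorphic_on ball 0 1"
    and C: "\<And>z. norm z < 1 \<Longrightarrow> norm (h z) \<le> C" and p: "p > 0"
  shows "(\<lambda>z. h z * f z) \<in> hardy p"
proof -
  obtain A where A: "\<And>r. 0 \<le> r \<Longrightarrow> r < 1 \<Longrightarrow> (\<integral>\<zeta>. norm (f (of_real r * \<zeta>)) powr p \<partial>circle_measure) \<le> A"
    by (rule hardyE[OF f]) blast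
  show ?thesis
  proof (rule hardyI)
    show hol: "(\<lambda>z. h z * f z) holomorphic_on ball 0 1"
      by (intro holomorphic_intros hardy_holomorphic[OF f] h)
    fix r :: real assume r: "0 \<le> r" "r < 1"
    have fi: "integrable circle_measure (\<lambda>\<zeta>. norm (f (of_real r * \<zeta>)) powr p)"
      by (rule dilate_powr_integrable[OF hardy_continuous[OF f] r p])
    have "(\<integral>\<zeta>. norm (h (of_real r * \<zeta>) * f (of_real r * \<zeta>)) powr p \<partial>circle_measure)
        \<le> (\<integral>\<zeta>. C powr p * norm (f (of_real r * \<zeta>)) powr p \<partial>circle_measure)"
    proof (rule integral_mono)
      show "integrable circle_measure (\<lambda>\<zeta>. norm (h (of_real r * \<zeta>) * f (of_real r * \<zeta>)) powr p)"
        by (rule dilate_powr_integrable[OF holomorphic_on_imp_continuous_on[OF hol] r p])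
      fix \<zeta> assume "\<zeta> \<in> space circle_measure"
      then have "norm (h (of_real r * \<zeta>)) \<le> C" using r by (intro C) (simp add: norm_mult)
      then have "norm (h (of_real r * \<zeta>)) powr p \<le> C powr p" using p by (intro powr_mono2) auto
      then show "norm (h (of_real r * \<zeta>) * f (of_real r * \<zeta>)) powr p \<le> C powr p * norm (f (of_real r * \<zeta>)) powr p"
        unfolding norm_mult by (subst powr_mult) (auto intro: mult_right_mono)
    qed (use fi in auto)
    also have "\<dots> = C powr p * (\<integral>\<zeta>. norm (f (of_real r * \<zeta>)) powr p \<partial>circle_measure)" by simp
    also have "\<dots> \<le> C powr p * A" by (intro mult_left_mono A r) auto
    finally show "(\<integral>\<zeta>. norm (h (of_real r * \<zeta>) * f (of_real r * \<zeta>)) powr p \<partial>circle_measure) \<le> C powr p * A" .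
  qed
qed

lemma hardy_bounded:
  assumes h: "h holomorphic_on ball 0 1" and C: "\<And>z. norm z < 1 \<Longrightarrow> norm (h z) \<le> C" and p: "p > 0"
  shows "h \<in> hardy p"
proof -
  have "(\<lambda>_. 1) \<in> hardy p" by (rule hardyI[where B = 1]) auto
  from hardy_mult_bounded[OF this h C p] show ?thesis by simp
qed

lemma hardy_subset_hardy_1:
  assumes f: "f \<in> hardy p" and p: "1 \<le> p"
  shows "f \<in> hardy 1"
proof -
  obtain A where A: "\<And>r. 0 \<le> r \<Longrightarrow> r < 1 \<Longrightarrow> (\<integral>\<zeta>. norm (f (of_real r * \<zeta>)) powr p \<partial>circle_measure) \<le> A"
    by (rule hardyE[OF f]) blast
  show ?thesis
  proof (rule hardyI[OF hardy_holomorphic[OF f]])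
    fix r :: real assume r: "0 \<le> r" "r < 1"
    have fi: "integrable circle_measure (\<lambda>\<zeta>. norm (f (of_real r * \<zeta>)) powr p)"
      by (rule dilate_powr_integrable[OF hardy_continuous[OF f] r]) (use p in auto)
    have "(\<integral>\<zeta>. norm (f (of_real r * \<zeta>)) powr 1 \<partial>circle_measure)
        \<le> (\<integral>\<zeta>. 1 + norm (f (of_real r * \<zeta>)) powr p \<partial>circle_measure)"
    proof (rule integral_mono)
      show "integrable circle_measure (\<lambda>\<zeta>. norm (f (of_real r * \<zeta>)) powr 1)"
        by (rule dilate_powr_integrable[OF hardy_continuous[OF f] r]) auto
      fix \<zeta>
      have "x \<le> 1 + x powr p" if "x \<ge> 0" for x :: real
      proof (cases "x \<le> 1")
        case False
        then have "x powr 1 \<le> x powr p" using p by (intro powr_mono) auto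
        then show ?thesis using False by simp
      qed (simp add: add_increasing2)
      then show "norm (f (of_real r * \<zeta>)) powr 1 \<le> 1 + norm (f (of_real r * \<zeta>)) powr p" by simp
    qed (use fi in auto)
    also have "\<dots> \<le> 1 + A" using fi A[OF r] by simp
    finally show "(\<integral>\<zeta>. norm (f (of_real r * \<zeta>)) powr 1 \<partial>circle_measure) \<le> 1 + A" .
  qed
qed

lemma norm_schwarz_le:
  assumes u: "integrable circle_measure u" and z: "norm z < 1"
  shows "norm (schwarz u z) \<le> 2 / (1 - norm z) * (\<integral>\<xi>. \<bar>u \<xi>\<bar> \<partial>circle_measure)"
proof -
  have "norm (schwarz u z) \<le> (\<integral>\<xi>. norm ((\<xi> + z) / (\<xi> - z) * of_real (u \<xi>)) \<partial>circle_measure)"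
    unfolding schwarz_def by (rule integral_norm_bound)
  also have "\<dots> \<le> (\<integral>\<xi>. 2 / (1 - norm z) * \<bar>u \<xi>\<bar> \<partial>circle_measure)"
  proof (rule integral_mono)
    show "integrable circle_measure (\<lambda>\<xi>. norm ((\<xi> + z) / (\<xi> - z) * of_real (u \<xi>)))"
      by (intro integrable_norm schwarz_kernel_integrable u z)
    show "integrable circle_measure (\<lambda>\<xi>. 2 / (1 - norm z) * \<bar>u \<xi>\<bar>)"
      by (intro integrable_mult_right integrable_abs u)
    fix \<xi> assume "\<xi> \<in> space circle_measure"
    then have \<xi>: "norm \<xi> = 1" by simp
    have "norm ((\<xi> + z) / (\<xi> - z)) \<le> 2 / (1 - norm z)"
      unfolding norm_divide using norm_diff_ge[OF \<xi>, of z] norm_triangle_ineq[of \<xi> z] \<xi> z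
      by (intro frac_le) auto
    then show "norm ((\<xi> + z) / (\<xi> - z) * of_real (u \<xi>)) \<le> 2 / (1 - norm z) * \<bar>u \<xi>\<bar>"
      unfolding norm_mult norm_of_real by (rule mult_right_mono) simp
  qed
  finally show ?thesis by simp
qed

lemma poisson_dilate:
  assumes f: "f holomorphic_on ball 0 1" and "0 \<le> r" "r < 1" "norm z < 1"
  shows "poisson (\<lambda>\<xi>. f (of_real r * \<xi>)) z = f (of_real r * z)"
  using assms
  by (intro poisson_formula continuous_on_dilate holomorphic_on_dilate holomorphic_on_imp_continuous_on) auto

text \<open>A normal family argument turns bounded means into a holomorphic function with
  \<open>\<bar>f\<bar> \<le> Re A\<close>, hence writes \<open>f\<close> as a quotient of bounded functions whose denominator
  \<open>1/(1 + A)\<close> takes values in the right half-plane.\<close>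

lemma hardy_1_harmonic_majorant:
  assumes f: "f \<in> hardy 1"
  obtains A where "A holomorphic_on ball 0 1" "\<And>z. norm z < 1 \<Longrightarrow> norm (f z) \<le> Re (A z)"
proof -
  let ?M = circle_measure
  obtain B where B: "\<And>r. 0 \<le> r \<Longrightarrow> r < 1 \<Longrightarrow> (\<integral>\<zeta>. norm (f (of_real r * \<zeta>)) powr 1 \<partial>?M) \<le> B"
    by (rule hardyE[OF f]) blast
  have fh: "f holomorphic_on ball 0 1" and cf: "continuous_on (ball 0 1) f"
    using hardy_holomorphic[OF f] hardy_continuous[OF f] by auto
  define u where "u = (\<lambda>n \<xi>. norm (f (of_real (radius_seq n) * \<xi>)))"
  have ui: "integrable ?M (u n)" for n
    unfolding u_def by (intro integrable_circle_continuous continuous_intros continuous_on_dilate_sphere[OF cf])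
      (use radius_seq_bounds[of n] in auto)
  have uB: "(\<integral>\<xi>. \<bar>u n \<xi>\<bar> \<partial>?M) \<le> B" for n
    using B[of "radius_seq n"] radius_seq_bounds[of n] by (simp add: u_def)
  define F where "F = (\<lambda>n. schwarz (u n))"
  have Fb: "norm (F n z) \<le> 2 / (1 - norm z) * B" if "norm z < 1" for n z
    unfolding F_def using that uB
    by (intro order_trans[OF norm_schwarz_le[OF ui that]] mult_left_mono) auto
  have lower: "norm (f (of_real (radius_seq n) * z)) \<le> Re (F n z)" if "norm z < 1" for n z
  proof -
    have "Re (F n z) = poisson (u n) z" unfolding F_def by (rule Re_schwarz[OF ui that])
    then show ?thesis
      using poisson_norm_le[OF that, of "\<lambda>\<xi>. f (of_real (radius_seq n) * \<xi>)"] radius_seq_bounds[of n]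
      by (simp add: poisson_dilate[OF fh _ _ that] u_def)
  qed
  obtain A r where A: "A holomorphic_on ball 0 1" "strict_mono (r :: nat \<Rightarrow> nat)"
    "\<And>x. x \<in> ball 0 1 \<Longrightarrow> ((\<lambda>n. F (r n) x) \<longlongrightarrow> A x) sequentially"
  proof (rule Montel[of "ball 0 1" "range F" F])
    show "h holomorphic_on ball 0 1" if "h \<in> range F" for h
      using that schwarz_holomorphic[OF ui] by (auto simp: F_def)
    fix K :: "complex set" assume K: "compact K" "K \<subseteq> ball 0 1"
    show "\<exists>C. \<forall>h\<in>range F. \<forall>z\<in>K. norm (h z) \<le> C"
    proof (cases "K = {}")
      case False
      have "continuous_on K norm" by (intro continuous_intros)
      from continuous_attains_sup[OF K(1) False this]
      obtain x where x: "x \<in> K" "\<And>z. z \<in> K \<Longrightarrow> norm z \<le> norm x" by auto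
      have x1: "norm x < 1" using x K by auto
      have "0 \<le> (\<integral>\<xi>. \<bar>u 0 \<xi>\<bar> \<partial>?M)" by (rule integral_nonneg_AE) simp
      then have B0: "B \<ge> 0" using uB[of 0] by linarith
      have "norm (F n z) \<le> 2 / (1 - norm x) * B" if "z \<in> K" for n z
      proof -
        have z: "norm z < 1" using that K by auto
        have "2 / (1 - norm z) \<le> 2 / (1 - norm x)"
          using x(2)[OF that] x1 by (intro frac_le) auto
        then show ?thesis using Fb[OF z, of n] B0 mult_right_mono by (meson order_trans)
      qed
      then show ?thesis by blast
    qed auto
  qed (auto intro: that)
  show thesis
  proof (rule that[OF A(1)])
    fix z :: complex assume z: "norm z < 1"
    have "(\<lambda>n. of_real (radius_seq n) * z) \<longlonglongrightarrow> of_real 1 * z"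
      by (intro tendsto_intros radius_seq_tendsto)
    then have "(\<lambda>n. of_real (radius_seq n) * z) \<longlonglongrightarrow> z" by simp
    moreover have "isCont f z" using cf z by (simp add: continuous_on_eq_continuous_at)
    ultimately have "(\<lambda>n. f (of_real (radius_seq n) * z)) \<longlonglongrightarrow> f z"
      using isCont_tendsto_compose[where g = f] by blast
    then have a: "(\<lambda>n. norm (f (of_real (radius_seq (r n)) * z))) \<longlonglongrightarrow> norm (f z)"
      using LIMSEQ_subseq_LIMSEQ[OF _ A(2)] tendsto_norm by (fastforce simp: o_def)
    have "(\<lambda>n. Re (F (r n) z)) \<longlonglongrightarrow> Re (A z)"
      using A(3)[of z] z by (intro tendsto_Re) auto
    then show "norm (f z) \<le> Re (A z)"
      by (rule tendsto_le[OF trivial_limit_sequentially _ a]) (use lower[OF z] in auto)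
  qed
qed

text \<open>With \<open>f2 = 1/(1 + A)\<close> and \<open>f1 = f f2\<close>, both bounded by 1, all claims pass from \<open>f1\<close> and \<open>f2\<close> to
  \<open>f = f1/f2\<close>. The inequality survives the division because it is an equality for \<open>f2\<close>, whose values
  lie in the right half-plane.\<close>

theorem hardy_1_bdry:
  assumes f: "f \<in> hardy 1" and z0: "norm z0 < 1" "f z0 \<noteq> 0"
  shows "has_bdry f" "AE \<zeta> in circle_measure. bdry f \<zeta> \<noteq> 0"
    "integrable circle_measure (\<lambda>\<zeta>. ln (norm (bdry f \<zeta>)))"
    "\<And>z. norm z < 1 \<Longrightarrow> norm (f z) \<le> exp (poisson (\<lambda>\<zeta>. ln (norm (bdry f \<zeta>))) z)"
proof -
  let ?M = circle_measure
  obtain A where A: "A holomorphic_on ball 0 1" "\<And>z. norm z < 1 \<Longrightarrow> norm (f z) \<le> Re (A z)"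
    by (rule hardy_1_harmonic_majorant[OF f]) blast
  have fh: "f holomorphic_on ball 0 1" by (rule hardy_holomorphic[OF f])
  have ReA: "Re (1 + A z) \<ge> 1" if "norm z < 1" for z
    using A(2)[OF that] norm_ge_zero[of "f z"] by (simp del: norm_ge_zero)
  have n1: "norm (1 + A z) \<ge> 1" if "norm z < 1" for z
    using ReA[OF that] complex_Re_le_cmod[of "1 + A z"] by linarith
  have ne: "1 + A z \<noteq> 0" if "norm z < 1" for z using n1[OF that] by auto
  define f2 where "f2 = (\<lambda>z. 1 / (1 + A z))"
  define f1 where "f1 = (\<lambda>z. f z * f2 z)"
  have h2: "f2 holomorphic_on ball 0 1" unfolding f2_def by (intro holomorphic_intros A) (use ne in auto)
  have h1: "f1 holomorphic_on ball 0 1" unfolding f1_def by (intro holomorphic_intros fh h2)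
  have b2: "norm (f2 z) \<le> 1" if "norm z < 1" for z
    using n1[OF that] by (simp add: f2_def norm_divide divide_le_eq)
  have b1: "norm (f1 z) \<le> 1" if "norm z < 1" for z
  proof -
    have "norm (f z) \<le> norm (1 + A z)"
      using A(2)[OF that] complex_Re_le_cmod[of "1 + A z"] by simp
    then show ?thesis using n1[OF that] by (simp add: f1_def f2_def norm_mult norm_divide divide_le_eq)
  qed
  have p2: "Re (f2 z) > 0" if "norm z < 1" for z
  proof -
    have "Re (1 + A z) > 0" using ReA[OF that] by linarith
    then show ?thesis unfolding f2_def by (simp add: Re_divide complex_neq_0[symmetric] ne[OF that] del: plus_complex.sel)
  qed
  have nz2: "f2 z \<noteq> 0" if "norm z < 1" for z using p2[OF that] by auto
  have nz1: "f1 z0 \<noteq> 0" using z0 nz2 by (simp add: f1_def)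
  have quot: "f z = f1 z / f2 z" if "norm z < 1" for z using nz2[OF that] by (simp add: f1_def)
  note B1 = bounded_analytic_bdry[OF h1 b1, simplified]
  note B2 = bounded_analytic_bdry[OF h2 b2, simplified]
  note L1 = bounded_analytic_log_bdry[OF h1 b1 z0(1) nz1, simplified]
  note L2 = bounded_analytic_log_bdry[OF h2 b2 z0(1) nz2[OF z0(1)], simplified]
  have "AE \<zeta> in ?M. has_angular_limit f \<zeta> (bdry f1 \<zeta> / bdry f2 \<zeta>)"
    using B1(1)[unfolded has_bdry_def] B2(1)[unfolded has_bdry_def] L2(1)
  proof eventually_elim
    case (elim \<zeta>)
    from angular_limit_divide[OF elim]
    show ?case using angular_limit_cong[of f "\<lambda>z. f1 z / f2 z"] quot by simp
  qed
  note H = has_bdryI[OF this]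
  show "has_bdry f" by (rule H)
  show nz: "AE \<zeta> in ?M. bdry f \<zeta> \<noteq> 0"
    using H(2) L1(1) L2(1) by eventually_elim simp
  have leq: "AE \<zeta> in ?M. ln (norm (bdry f1 \<zeta>)) - ln (norm (bdry f2 \<zeta>)) = ln (norm (bdry f \<zeta>))"
    using H(2) L1(1) L2(1) by eventually_elim (simp add: norm_divide ln_div)
  have bm: "bdry f \<in> borel_measurable ?M" by (rule hardy_bdry_measurable[OF f])
  have lm: "(\<lambda>\<zeta>. ln (norm (bdry f \<zeta>))) \<in> borel_measurable ?M" using bm by measurable
  have di: "integrable ?M (\<lambda>\<zeta>. ln (norm (bdry f1 \<zeta>)) - ln (norm (bdry f2 \<zeta>)))"
    using L1(2) L2(2) by (rule Bochner_Integration.integrable_diff)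
  have dm: "(\<lambda>\<zeta>. ln (norm (bdry f1 \<zeta>)) - ln (norm (bdry f2 \<zeta>))) \<in> borel_measurable ?M"
    using di by (rule borel_measurable_integrable)
  show li: "integrable ?M (\<lambda>\<zeta>. ln (norm (bdry f \<zeta>)))"
    by (rule integrable_cong_AE_imp[OF di lm]) (use leq in auto)
  show "norm (f z) \<le> exp (poisson (\<lambda>\<zeta>. ln (norm (bdry f \<zeta>))) z)" if z: "norm z < 1" for z
  proof -
    have "norm (f z) = norm (f1 z) / norm (f2 z)" using quot[OF z] by (simp add: norm_divide)
    also have "norm (f2 z) = exp (poisson (\<lambda>\<zeta>. ln (norm (bdry f2 \<zeta>))) z)"
      by (rule right_half_plane_norm_eq[OF h2 b2 p2 z])
    also have "norm (f1 z) / \<dots> \<le> exp (poisson (\<lambda>\<zeta>. ln (norm (bdry f1 \<zeta>))) z) / \<dots>"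
      by (rule divide_right_mono[OF L1(3)[OF z]]) simp
    also have "\<dots> = exp (poisson (\<lambda>\<zeta>. ln (norm (bdry f1 \<zeta>)) - ln (norm (bdry f2 \<zeta>))) z)"
      by (simp add: poisson_diff[OF z L1(2) L2(2)] exp_diff)
    also have "poisson (\<lambda>\<zeta>. ln (norm (bdry f1 \<zeta>)) - ln (norm (bdry f2 \<zeta>))) z = poisson (\<lambda>\<zeta>. ln (norm (bdry f \<zeta>))) z"
      by (rule poisson_cong_AE[OF leq dm lm])
    finally show ?thesis .
  qed
qed

lemma hardy_has_bdry:
  assumes "f \<in> hardy p" "1 \<le> p"
  shows "has_bdry f"
proof (cases "\<exists>z. norm z < 1 \<and> f z \<noteq> 0")
  case True
  then show ?thesis using hardy_1_bdry(1)[OF hardy_subset_hardy_1[OF assms]] by blast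
next
  case False
  then have "has_angular_limit f \<zeta> 0" for \<zeta>
    using angular_limit_cong[of f "\<lambda>_. 0"] angular_limit_const[of 0 \<zeta>] by blast
  then show ?thesis by (intro has_bdryI(1)[of _ "\<lambda>_. 0"]) auto
qed

text \<open>Fatou's lemma along the radii.\<close>

lemma hardy_bdry_powr_integrable:
  assumes f: "f \<in> hardy p" and p: "1 \<le> p"
  shows "integrable circle_measure (\<lambda>\<zeta>. norm (bdry f \<zeta>) powr p)"
proof -
  let ?M = circle_measure
  obtain B where B: "\<And>r. 0 \<le> r \<Longrightarrow> r < 1 \<Longrightarrow> (\<integral>\<zeta>. norm (f (of_real r * \<zeta>)) powr p \<partial>?M) \<le> B"
    by (rule hardyE[OF f]) blast
  let ?g = "\<lambda>n \<zeta>. norm (f (of_real (radius_seq n) * \<zeta>)) powr p"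
  have gi: "integrable ?M (?g n)" for n
    by (rule dilate_powr_integrable[OF hardy_continuous[OF f]]) (use radius_seq_bounds p in auto)
  have "(\<integral>\<^sup>+\<zeta>. ennreal (norm (bdry f \<zeta>) powr p) \<partial>?M) = (\<integral>\<^sup>+\<zeta>. liminf (\<lambda>n. ennreal (?g n \<zeta>)) \<partial>?M)"
  proof (rule nn_integral_cong_AE)
    show "AE \<zeta> in ?M. ennreal (norm (bdry f \<zeta>) powr p) = liminf (\<lambda>n. ennreal (?g n \<zeta>))"
      using has_bdry_radial[OF hardy_has_bdry[OF f p]]
    proof eventually_elim
      case (elim \<zeta>)
      have "(\<lambda>n. ?g n \<zeta>) \<longlonglongrightarrow> norm (bdry f \<zeta>) powr p"
        by (rule tendsto_powr'[OF tendsto_norm[OF elim] tendsto_const]) (use p in auto)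
      then have "(\<lambda>n. ennreal (?g n \<zeta>)) \<longlonglongrightarrow> ennreal (norm (bdry f \<zeta>) powr p)" by (rule tendsto_ennrealI)
      then show ?case using lim_imp_Liminf[OF trivial_limit_sequentially] by metis
    qed
  qed
  also have "\<dots> \<le> liminf (\<lambda>n. \<integral>\<^sup>+\<zeta>. ennreal (?g n \<zeta>) \<partial>?M)"
    by (rule nn_integral_liminf) (use gi in measurable)
  also have "\<dots> \<le> liminf (\<lambda>n. ennreal B)"
  proof (rule Liminf_mono, rule always_eventually, rule allI)
    fix n
    have "(\<integral>\<^sup>+\<zeta>. ennreal (?g n \<zeta>) \<partial>?M) = ennreal (\<integral>\<zeta>. ?g n \<zeta> \<partial>?M)"
      by (rule nn_integral_eq_integral[OF gi]) auto
    also have "\<dots> \<le> ennreal B" by (intro ennreal_leI B radius_seq_bounds)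
    finally show "(\<integral>\<^sup>+\<zeta>. ennreal (?g n \<zeta>) \<partial>?M) \<le> ennreal B" .
  qed
  also have "\<dots> < \<infinity>" by (simp add: Liminf_const)
  finally have "(\<integral>\<^sup>+\<zeta>. ennreal (norm (bdry f \<zeta>) powr p) \<partial>?M) < \<infinity>" .
  moreover have "(\<lambda>\<zeta>. norm (bdry f \<zeta>)) \<in> borel_measurable ?M"
    using hardy_bdry_measurable[OF f] by measurable
  then have "(\<lambda>\<zeta>. norm (bdry f \<zeta>) powr p) \<in> borel_measurable ?M"
    by (rule powr_real_measurable) simp
  ultimately show ?thesis by (intro integrableI_bounded) auto
qed

lemma inner_function_bounded:
  assumes "inner_function I"
  shows "I holomorphic_on ball 0 1" "\<And>z. norm z < 1 \<Longrightarrow> norm (I z) \<le> 1" "has_bdry I"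
    "AE \<zeta> in circle_measure. norm (bdry I \<zeta>) = 1"
proof -
  show h: "I holomorphic_on ball 0 1" and a: "AE \<zeta> in circle_measure. norm (bdry I \<zeta>) = 1"
    using assms by (auto simp: inner_function_def)
  from assms obtain B where "\<forall>x\<in>I ` ball 0 1. norm x \<le> B"
    unfolding inner_function_def bounded_iff by blast
  then have B: "\<And>z. norm z < 1 \<Longrightarrow> norm (I z) \<le> B" by simp
  show "has_bdry I" by (rule bounded_analytic_bdry(1)[OF h B])
  show "norm (I z) \<le> 1" if "norm z < 1" for z
    by (rule bounded_analytic_max[OF h B _ that]) (use a in auto)
qed

lemma inner_functionI:
  assumes "I holomorphic_on ball 0 1" "\<And>z. norm z < 1 \<Longrightarrow> norm (I z) \<le> B"
    "AE \<zeta> in circle_measure. norm (bdry I \<zeta>) = 1"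
  shows "inner_function I"
proof -
  have "bounded (I ` ball 0 1)"
    unfolding bounded_iff using assms(2) by (intro exI[of _ B]) auto
  with assms show ?thesis by (simp add: inner_function_def)
qed

text \<open>The logarithmic inequality says exactly that the quotient of \<open>f\<close> by the outer function of the same
  boundary modulus is bounded by 1.\<close>

theorem inner_outer_factorization:
  assumes f: "f \<in> hardy 1" and z0: "norm z0 < 1" "f z0 \<noteq> 0"
  obtains I where "inner_function I"
    "\<And>z. norm z < 1 \<Longrightarrow> f z = I z * Outer (\<lambda>\<zeta>. ln (norm (bdry f \<zeta>))) z"
proof -
  let ?u = "\<lambda>\<zeta>. ln (norm (bdry f \<zeta>))"
  let ?I = "\<lambda>z. f z / Outer ?u z"
  note H = hardy_1_bdry[OF f z0]
  have h: "?I holomorphic_on ball 0 1"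
    by (intro holomorphic_intros hardy_holomorphic[OF f] Outer_holomorphic H) auto
  have b: "norm (?I z) \<le> 1" if z: "norm z < 1" for z
    using H(4)[OF z] by (simp add: norm_divide norm_Outer[OF H(3) z] divide_le_eq)
  have hb: "has_bdry ?I" by (rule bounded_analytic_bdry(1)[OF h b])
  have "AE \<zeta> in circle_measure. norm (bdry ?I \<zeta>) = 1"
    using norm_bdry_quotient[OF H(3) H(1) hb] H(2) by eventually_elim simp
  with h b have "inner_function ?I" by (rule inner_functionI)
  then show thesis by (rule that) simp
qed

section \<open>Constructing functions in Hardy spaces\<close>

text \<open>The Poisson integral is the real part of the Schwarz integral, to which the mean value property
  applies.\<close>

lemma poisson_dilate_integral:
  fixes u :: "complex \<Rightarrow> real"
  assumes u: "integrable circle_measure u" and r: "0 \<le> r" "r < 1"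
  shows "integrable circle_measure (\<lambda>\<zeta>. poisson u (of_real r * \<zeta>))"
    and "(\<integral>\<zeta>. poisson u (of_real r * \<zeta>) \<partial>circle_measure) = (\<integral>\<zeta>. u \<zeta> \<partial>circle_measure)"
proof -
  let ?M = circle_measure
  have h: "schwarz u holomorphic_on ball 0 1" by (rule schwarz_holomorphic[OF u])
  then have c: "continuous_on (ball 0 1) (schwarz u)" by (rule holomorphic_on_imp_continuous_on)
  have i: "integrable ?M (\<lambda>\<zeta>. schwarz u (of_real r * \<zeta>))"
    by (intro integrable_circle_continuous continuous_on_dilate_sphere c) (use r in auto)
  have eq: "Re (schwarz u (of_real r * \<zeta>)) = poisson u (of_real r * \<zeta>)" if "\<zeta> \<in> space ?M" for \<zeta>
    using that r by (intro Re_schwarz u) (simp add: norm_mult)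
  have "integrable ?M (\<lambda>\<zeta>. Re (schwarz u (of_real r * \<zeta>)))" by (rule integrable_Re[OF i])
  then show "integrable ?M (\<lambda>\<zeta>. poisson u (of_real r * \<zeta>))"
    by (rule Bochner_Integration.integrable_cong[THEN iffD1, rotated 2]) (auto simp: eq)
  have "(\<integral>\<zeta>. poisson u (of_real r * \<zeta>) \<partial>?M) = (\<integral>\<zeta>. Re (schwarz u (of_real r * \<zeta>)) \<partial>?M)"
    by (rule Bochner_Integration.integral_cong) (auto simp: eq)
  also have "\<dots> = Re (\<integral>\<zeta>. schwarz u (of_real r * \<zeta>) \<partial>?M)" by (rule integral_Re[OF i])
  also have "(\<integral>\<zeta>. schwarz u (of_real r * \<zeta>) \<partial>?M) = schwarz u (of_real r * 0)"
    by (intro circle_mean_value continuous_on_dilate[OF c] holomorphic_on_dilate[OF h]) (use r in auto)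
  finally show "(\<integral>\<zeta>. poisson u (of_real r * \<zeta>) \<partial>?M) = (\<integral>\<zeta>. u \<zeta> \<partial>?M)"
    by (simp add: schwarz_0)
qed

text \<open>Jensen's inequality for the probability measure with density \<open>poisson_kernel z\<close>. It is what bounds the
  means of an outer function.\<close>

lemma exp_poisson_le:
  fixes u :: "complex \<Rightarrow> real"
  assumes u: "integrable circle_measure u" and e: "integrable circle_measure (\<lambda>\<zeta>. exp (u \<zeta>))"
    and z: "norm z < 1"
  shows "exp (poisson u z) \<le> poisson (\<lambda>\<zeta>. exp (u \<zeta>)) z"
proof -
  define m where "m = poisson u z"
  have lin: "integrable circle_measure (\<lambda>\<zeta>. exp m * (1 - m) + exp m * u \<zeta>)"
    using u by auto
  \<comment> \<open>the tangent to the exponential at \<open>m\<close> lies below its graph\<close>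
  have tangent: "exp m * (1 - m) + exp m * x \<le> exp x" for x
  proof -
    have "exp m * (1 + (x - m)) \<le> exp m * exp (x - m)"
      by (intro mult_left_mono exp_ge_add_one_self) auto
    then show ?thesis by (simp add: exp_diff algebra_simps)
  qed
  have "poisson (\<lambda>\<zeta>. exp m * (1 - m) + exp m * u \<zeta>) z \<le> poisson (\<lambda>\<zeta>. exp (u \<zeta>)) z"
    by (rule poisson_mono_AE[OF z lin e]) (use tangent in auto)
  moreover have "poisson (\<lambda>\<zeta>. exp m * (1 - m) + exp m * u \<zeta>) z = exp m * (1 - m) + poisson (\<lambda>\<zeta>. exp m * u \<zeta>) z"
    using poisson_add[OF z, of "\<lambda>_. exp m * (1 - m)" "\<lambda>\<zeta>. exp m * u \<zeta>"] u
    by (simp add: poisson_constant[OF z])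
  moreover have "poisson (\<lambda>\<zeta>. exp m * u \<zeta>) z = exp m * m"
    unfolding m_def poisson_def integral_mult_right_zero[symmetric]
    by (rule Bochner_Integration.integral_cong) auto
  ultimately show ?thesis unfolding m_def[symmetric] by (simp add: algebra_simps)
qed

lemma Outer_in_hardy:
  assumes u: "integrable circle_measure u" and e: "integrable circle_measure (\<lambda>\<zeta>. exp (p * u \<zeta>))"
  shows "Outer u \<in> hardy p"
proof (rule hardyI[OF Outer_holomorphic[OF u]])
  fix r :: real assume r: "0 \<le> r" "r < 1"
  let ?M = circle_measure
  have pu: "integrable ?M (\<lambda>\<zeta>. p * u \<zeta>)" using u by auto
  have le: "norm (Outer u z) powr p \<le> poisson (\<lambda>\<zeta>. exp (p * u \<zeta>)) z" if z: "norm z < 1" for z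
  proof -
    have "p * poisson u z = poisson (\<lambda>\<zeta>. p * u \<zeta>) z"
      unfolding poisson_def integral_mult_right_zero[symmetric]
      by (rule Bochner_Integration.integral_cong) auto
    then have "norm (Outer u z) powr p = exp (poisson (\<lambda>\<zeta>. p * u \<zeta>) z)"
      by (simp add: norm_Outer[OF u z] powr_def)
    with exp_poisson_le[OF pu e z] show ?thesis by simp
  qed
  have "(\<integral>\<zeta>. norm (Outer u (of_real r * \<zeta>)) powr p \<partial>?M)
      \<le> (\<integral>\<zeta>. poisson (\<lambda>\<zeta>. exp (p * u \<zeta>)) (of_real r * \<zeta>) \<partial>?M)"
  proof (rule integral_mono_AE')
    show "integrable ?M (\<lambda>\<zeta>. poisson (\<lambda>\<zeta>. exp (p * u \<zeta>)) (of_real r * \<zeta>))"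
      by (rule poisson_dilate_integral[OF e r])
    show "AE \<zeta> in ?M. norm (Outer u (of_real r * \<zeta>)) powr p \<le> poisson (\<lambda>\<zeta>. exp (p * u \<zeta>)) (of_real r * \<zeta>)"
      by (rule AE_I2, rule le) (use r in \<open>simp add: norm_mult\<close>)
    show "AE \<zeta> in ?M. 0 \<le> poisson (\<lambda>\<zeta>. exp (p * u \<zeta>)) (of_real r * \<zeta>)"
    proof (rule AE_I2)
      fix \<zeta> assume "\<zeta> \<in> space ?M"
      then have "norm (of_real r * \<zeta>) < 1" using r by (simp add: norm_mult)
      from order_trans[OF powr_ge_zero le[OF this]]
      show "0 \<le> poisson (\<lambda>\<zeta>. exp (p * u \<zeta>)) (of_real r * \<zeta>)" .
    qed
  qed
  also have "\<dots> = (\<integral>\<zeta>. exp (p * u \<zeta>) \<partial>?M)" by (rule poisson_dilate_integral[OF e r])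
  finally show "(\<integral>\<zeta>. norm (Outer u (of_real r * \<zeta>)) powr p \<partial>?M) \<le> (\<integral>\<zeta>. exp (p * u \<zeta>) \<partial>?M)" .
qed

text \<open>The vanishing moments are the Fourier coefficients of nonpositive index, so the Poisson integral is
  the Cauchy transform of \<open>\<phi>\<close>, which is analytic; its means are at most \<open>\<integral> \<bar>\<phi>\<bar>\<close>.\<close>

theorem analytic_of_vanishing_moments:
  assumes \<phi>: "integrable circle_measure \<phi>"
    and orth: "\<And>n::nat. (\<integral>\<xi>. \<xi> ^ n * \<phi> \<xi> \<partial>circle_measure) = 0"
  shows "poisson \<phi> \<in> hardy 1" "poisson \<phi> 0 = 0"
    "AE \<zeta> in circle_measure. bdry (poisson \<phi>) \<zeta> = \<phi> \<zeta>"
proof -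
  let ?M = circle_measure
  have hol: "poisson \<phi> holomorphic_on ball 0 1"
    by (rule holomorphic_transform[OF cauchy_transform_holomorphic[OF \<phi>]])
       (use poisson_eq_cauchy_transform[OF \<phi> _ orth] in simp)
  show "poisson \<phi> \<in> hardy 1"
  proof (rule hardyI[OF hol])
    fix r :: real assume r: "0 \<le> r" "r < 1"
    have ni: "integrable ?M (\<lambda>\<xi>. norm (\<phi> \<xi>))" using \<phi> by auto
    have "(\<integral>\<zeta>. norm (poisson \<phi> (of_real r * \<zeta>)) powr 1 \<partial>?M)
        \<le> (\<integral>\<zeta>. poisson (\<lambda>\<xi>. norm (\<phi> \<xi>)) (of_real r * \<zeta>) \<partial>?M)"
    proof (rule integral_mono[OF _ poisson_dilate_integral(1)[OF ni r]])
      show "integrable ?M (\<lambda>\<zeta>. norm (poisson \<phi> (of_real r * \<zeta>)) powr 1)"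
        by (rule dilate_powr_integrable[OF holomorphic_on_imp_continuous_on[OF hol] r]) simp
      fix \<zeta> assume "\<zeta> \<in> space ?M"
      then have "norm (of_real r * \<zeta>) < 1" using r by (simp add: norm_mult)
      from poisson_norm_le[OF this]
      show "norm (poisson \<phi> (of_real r * \<zeta>)) powr 1 \<le> poisson (\<lambda>\<xi>. norm (\<phi> \<xi>)) (of_real r * \<zeta>)"
        by simp
    qed
    also have "\<dots> = (\<integral>\<xi>. norm (\<phi> \<xi>) \<partial>?M)" by (rule poisson_dilate_integral(2)[OF ni r])
    finally show "(\<integral>\<zeta>. norm (poisson \<phi> (of_real r * \<zeta>)) powr 1 \<partial>?M) \<le> (\<integral>\<xi>. norm (\<phi> \<xi>) \<partial>?M)" .
  qed
  have "poisson \<phi> 0 = (\<integral>\<xi>. \<xi> ^ 0 * \<phi> \<xi> \<partial>?M)"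
    unfolding poisson_def by (rule Bochner_Integration.integral_cong) (auto simp: poisson_kernel_def)
  then show "poisson \<phi> 0 = 0" using orth[of 0] by simp
  show "AE \<zeta> in ?M. bdry (poisson \<phi>) \<zeta> = \<phi> \<zeta>"
    by (rule has_bdryI(2)[OF poisson_angular_limit[OF \<phi>]])
qed

text \<open>Two analytic logarithms differ by a locally constant multiple of \<open>2\<pi>\<i>\<close>, which is 0 at the origin
  where both are real.\<close>

lemma disk_log_Outer:
  assumes u: "integrable circle_measure u" and z: "norm z < 1"
  shows "disk_log (Outer u) z = schwarz u z"
proof -
  define L where "L = disk_log (Outer u)"
  have S: "schwarz u holomorphic_on ball 0 1" by (rule schwarz_holomorphic[OF u])
  have "L holomorphic_on ball 0 1 \<and> (\<forall>z\<in>ball 0 1. exp (L z) = Outer u z) \<and> Im (L 0) = 0"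
    unfolding L_def disk_log_def
    by (rule someI[of _ "schwarz u"]) (use S in \<open>auto simp: Outer_def schwarz_0\<close>)
  then have L: "L holomorphic_on ball 0 1" "\<And>z. z \<in> ball 0 1 \<Longrightarrow> exp (L z) = Outer u z" "Im (L 0) = 0"
    by auto
  define D where "D = (\<lambda>z. L z - schwarz u z)"
  have Dh: "D holomorphic_on ball 0 1" unfolding D_def by (intro holomorphic_intros L S)
  have eD: "exp (D z) = 1" if "z \<in> ball 0 1" for z
    using L(2)[OF that] by (simp add: D_def exp_diff Outer_def)
  have "\<exists>c. \<forall>z\<in>ball 0 1. D z = c"
  proof (rule has_field_derivative_zero_constant)
    fix z :: complex assume z: "z \<in> ball 0 1"
    have d: "(D has_field_derivative deriv D z) (at z)"
      by (rule holomorphic_derivI[OF Dh _ z]) auto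
    have "((\<lambda>z. exp (D z)) has_field_derivative exp (D z) * deriv D z) (at z)"
      by (rule DERIV_chain2[OF DERIV_exp d])
    moreover have "((\<lambda>z. exp (D z)) has_field_derivative 0) (at z)"
      by (rule has_field_derivative_transform_within_open[OF DERIV_const[of 1] open_ball z])
         (use eD in auto)
    ultimately have "exp (D z) * deriv D z = 0" by (rule DERIV_unique)
    then have "deriv D z = 0" by simp
    with d show "(D has_field_derivative 0) (at z within ball 0 1)"
      using has_field_derivative_at_within by metis
  qed auto
  then have "D z = D 0" using z by auto
  moreover have "D 0 = 0"
  proof -
    have "exp (D 0) = 1" by (rule eD) simp
    then have "norm (exp (D 0)) = 1" by simp
    then have "Re (D 0) = 0" by simp
    moreover have "Im (D 0) = 0" using L(3) by (simp add: D_def schwarz_0)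
    ultimately show ?thesis by (simp add: complex_eq_iff)
  qed
  ultimately show ?thesis by (simp add: D_def L_def)
qed

lemma disk_power_Outer:
  assumes "integrable circle_measure u" "norm z < 1"
  shows "disk_power (Outer u) a z = Outer (\<lambda>\<zeta>. a * u \<zeta>) z"
  by (simp add: disk_power_def disk_log_Outer[OF assms] Outer_def schwarz_cmult)

lemma disk_power_cong:
  assumes "\<And>z. norm z < 1 \<Longrightarrow> F z = G z"
  shows "disk_power F a = disk_power G a"
proof -
  have "disk_log F = disk_log G"
    unfolding disk_log_def using assms by (intro arg_cong[where f = Eps] ext) auto
  then show ?thesis by (simp add: disk_power_def[abs_def])
qed

text \<open>The quotient by the outer function of the same boundary modulus has modulus 1 throughout the disk.\<close>

lemma right_half_plane_outer:
  assumes f: "f holomorphic_on ball 0 1" and B: "\<And>z. norm z < 1 \<Longrightarrow> norm (f z) \<le> B"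
    and pos: "\<And>z. norm z < 1 \<Longrightarrow> Re (f z) > 0"
  obtains \<alpha> where "norm \<alpha> = 1" "integrable circle_measure (\<lambda>\<zeta>. ln (norm (bdry f \<zeta>)))"
    "\<And>z. norm z < 1 \<Longrightarrow> f z = \<alpha> * Outer (\<lambda>\<zeta>. ln (norm (bdry f \<zeta>))) z"
proof -
  let ?u = "\<lambda>\<zeta>. ln (norm (bdry f \<zeta>))"
  have f0: "f 0 \<noteq> 0" using pos[of 0] by auto
  have ui: "integrable circle_measure ?u"
    using bounded_analytic_log_bdry(2)[OF f B _ f0] by simp
  define q where "q = (\<lambda>z. f z / Outer ?u z)"
  have qh: "q holomorphic_on ball 0 1"
    unfolding q_def by (intro holomorphic_intros f Outer_holomorphic ui) auto
  have q1: "norm (q z) = 1" if z: "norm z < 1" for z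
    using right_half_plane_norm_eq[OF f B pos z] by (simp add: q_def norm_divide norm_Outer[OF ui z])
  have "q constant_on ball 0 1"
    by (rule maximum_modulus_principle[OF qh, of "ball 0 1" 0]) (use q1 in auto)
  then obtain \<alpha> where \<alpha>: "\<And>z. norm z < 1 \<Longrightarrow> q z = \<alpha>" by (auto simp: constant_on_def)
  show thesis
  proof (rule that[OF _ ui])
    show "norm \<alpha> = 1" using q1[of 0] \<alpha>[of 0] by simp
    show "f z = \<alpha> * Outer ?u z" if "norm z < 1" for z
      using \<alpha>[OF that] by (simp add: q_def field_simps)
  qed
qed

section \<open>The variational condition\<close>

lemma powr_diff_le:
  fixes x y :: real
  assumes "0 \<le> x" "0 \<le> y" "1 \<le> p"
  shows "\<bar>x powr p - y powr p\<bar> \<le> p * max x y powr (p - 1) * \<bar>x - y\<bar>"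
proof -
  have main: "\<bar>b powr p - a powr p\<bar> \<le> p * b powr (p - 1) * (b - a)" if "0 \<le> a" "a \<le> b" for a b :: real
  proof (cases "a = 0 \<or> a = b")
    case True
    have "b powr p = b powr (p - 1) * b"
      using that assms(3) by (cases "b = 0") (auto simp: powr_diff)
    moreover have "b powr p \<le> p * b powr p"
      using mult_right_mono[of 1 p "b powr p"] assms(3) by simp
    ultimately have "b powr p \<le> p * (b powr (p - 1) * b)" by simp
    with True show ?thesis using assms(3) by (auto simp: mult.assoc)
  next
    case False
    with that have ab: "0 < a" "a < b" by auto
    have der: "((\<lambda>x. x powr p) has_real_derivative p * x powr (p - 1)) (at x)" if "a \<le> x" "x \<le> b" for x
      using that ab by (auto intro!: derivative_eq_intros)
    from MVT2[OF ab(2) der] obtain c where c: "a < c" "c < b" "b powr p - a powr p = (b - a) * (p * c powr (p - 1))"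
      by blast
    have "c powr (p - 1) \<le> b powr (p - 1)" using c ab assms(3) by (intro powr_mono2) auto
    then have "(b - a) * (p * c powr (p - 1)) \<le> (b - a) * (p * b powr (p - 1))"
      using ab assms(3) by (intro mult_left_mono) auto
    moreover have "0 \<le> (b - a) * (p * c powr (p - 1))" using ab assms(3) by auto
    ultimately show ?thesis unfolding c(3) by (simp add: mult_ac)
  qed
  show ?thesis
  proof (cases "x \<le> y")
    case True
    then show ?thesis using main[OF assms(1) True] by (simp add: max_def abs_minus_commute)
  next
    case False
    then show ?thesis using main[OF assms(2), of x] by (simp add: max_def)
  qed
qed

lemma norm_powr_derivative:
  fixes a k :: complex
  assumes "a \<noteq> 0"
  shows "((\<lambda>t. norm (a - of_real t * k) powr p) has_real_derivative - p * Re (of_real (norm a powr p) / a * k)) (at 0)"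
proof -
  define s where "s = (\<lambda>t::real. (norm a)\<^sup>2 - 2 * t * Re (cnj a * k) + t\<^sup>2 * (norm k)\<^sup>2)"
  have sq: "s t = (norm (a - of_real t * k))\<^sup>2" for t
    unfolding s_def cmod_power2 by (simp add: power2_eq_square algebra_simps)
  have ps: "norm (a - of_real t * k) powr p = s t powr (p / 2)" for t
  proof (cases "a - of_real t * k = 0")
    case False
    then have "norm (a - of_real t * k) > 0" by simp
    then show ?thesis
      unfolding sq using powr_powr[of "norm (a - of_real t * k)" 2 "p / 2"] by (simp add: powr_numeral)
  qed (simp add: sq)
  have s0: "s 0 > 0" using assms by (simp add: s_def)
  have "(s has_real_derivative - 2 * Re (cnj a * k)) (at 0)"
    unfolding s_def by (auto intro!: derivative_eq_intros)
  from DERIV_powr[OF this s0 DERIV_const, of "p / 2"]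
  have "((\<lambda>t. s t powr (p / 2)) has_real_derivative
      s 0 powr (p / 2) * (- 2 * Re (cnj a * k) * (p / 2) / s 0)) (at 0)" by simp
  moreover have "s 0 powr (p / 2) * (- 2 * Re (cnj a * k) * (p / 2) / s 0)
      = - p * Re (of_real (norm a powr p) / a * k)"
  proof -
    have "of_real (norm a powr p) / a * k = of_real (norm a powr p / (norm a)\<^sup>2) * (cnj a * k)"
      using assms complex_norm_square[of a] by (simp add: field_simps)
    then have "Re (of_real (norm a powr p) / a * k) = norm a powr p / (norm a)\<^sup>2 * Re (cnj a * k)"
      by (simp del: of_real_divide)
    moreover have "s 0 powr (p / 2) = norm a powr p" using ps[of 0] by simp
    moreover have "s 0 = (norm a)\<^sup>2" by (simp add: s_def)
    ultimately show ?thesis by (simp only:) (simp only: times_divide_eq_left times_divide_eq_right mult_ac, simp)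
  qed
  ultimately show ?thesis unfolding ps by simp
qed

text \<open>The one-sided derivative at \<open>t = 0\<close> of the \<open>p\<close>-th power of the norm of \<open>f - t k\<close> is nonnegative. It can
  be computed under the integral because \<open>f \<noteq> 0\<close> almost everywhere and the difference quotients are
  dominated by a multiple of \<open>1 + \<bar>f\<bar>\<^sup>p\<close>.\<close>

lemma Lp_variation:
  fixes f k :: "complex \<Rightarrow> complex"
  assumes f: "f \<in> borel_measurable circle_measure" "integrable circle_measure (\<lambda>\<zeta>. norm (f \<zeta>) powr p)"
    and nz: "AE \<zeta> in circle_measure. f \<zeta> \<noteq> 0" and p: "1 \<le> p"
    and k: "k \<in> borel_measurable circle_measure" "\<And>\<zeta>. norm \<zeta> = 1 \<Longrightarrow> norm (k \<zeta>) \<le> 1"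
    and min: "\<And>t::real. (\<integral>\<zeta>. norm (f \<zeta>) powr p \<partial>circle_measure)
        \<le> (\<integral>\<zeta>. norm (f \<zeta> - of_real t * k \<zeta>) powr p \<partial>circle_measure)"
  shows "(\<integral>\<zeta>. Re (of_real (norm (f \<zeta>) powr p) / f \<zeta> * k \<zeta>) \<partial>circle_measure) \<le> 0"
proof -
  let ?M = circle_measure
  define t where "t = (\<lambda>n. 1 / (real n + 1))"
  have t: "0 < t n" "t n \<le> 1" for n by (auto simp: t_def)
  have t0: "t \<longlonglongrightarrow> 0"
    using LIMSEQ_inverse_real_of_nat by (simp add: t_def[abs_def] inverse_eq_divide add.commute)
  define q where "q = (\<lambda>n \<zeta>. (norm (f \<zeta> - of_real (t n) * k \<zeta>) powr p - norm (f \<zeta>) powr p) / t n)"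
  define w where "w = (\<lambda>\<zeta>. p * (1 + 2 powr p * (norm (f \<zeta>) powr p + 1)))"
  have nm: "(\<lambda>\<zeta>. norm (f \<zeta> - of_real (t n) * k \<zeta>)) \<in> borel_measurable ?M" for n
    using f(1) k(1) by measurable
  have nm': "(\<lambda>\<zeta>. norm (f \<zeta> - of_real (t n) * k \<zeta>) powr p) \<in> borel_measurable ?M" for n
    by (rule powr_real_measurable[OF nm]) simp
  have fm': "(\<lambda>\<zeta>. norm (f \<zeta>) powr p) \<in> borel_measurable ?M"
    using f(2) by (rule borel_measurable_integrable)
  have qm: "q n \<in> borel_measurable ?M" for n
    unfolding q_def by (intro borel_measurable_divide borel_measurable_diff nm' fm') simp
  have wi: "integrable ?M w" unfolding w_def using f(2) by auto
  have qw: "norm (q n \<zeta>) \<le> w \<zeta>" if \<zeta>: "norm \<zeta> = 1" for n \<zeta>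
  proof -
    define x y where "x = norm (f \<zeta> - of_real (t n) * k \<zeta>)" and "y = norm (f \<zeta>)"
    have xy: "0 \<le> x" "0 \<le> y" by (auto simp: x_def y_def)
    have tk: "norm (of_real (t n) * k \<zeta>) \<le> t n"
      using k(2)[OF \<zeta>] t[of n] by (simp add: norm_mult mult_left_le)
    have d: "\<bar>x - y\<bar> \<le> t n"
      unfolding x_def y_def using norm_triangle_ineq3[of "f \<zeta> - of_real (t n) * k \<zeta>" "f \<zeta>"] tk by simp
    have m: "max x y \<le> y + 1" using d t[of n] by auto
    have "max x y powr (p - 1) \<le> (y + 1) powr (p - 1)"
      using m p xy by (intro powr_mono2) auto
    also have "\<dots> \<le> (y + 1) powr p" using xy by (intro powr_mono) auto
    also have "\<dots> \<le> (2 * max y 1) powr p" using p xy by (intro powr_mono2) auto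
    also have "\<dots> = 2 powr p * max y 1 powr p" using xy by (intro powr_mult)
    also have "\<dots> \<le> 2 powr p * (y powr p + 1)" by (intro mult_left_mono) (auto simp: max_def)
    finally have mp: "max x y powr (p - 1) \<le> 1 + 2 powr p * (y powr p + 1)" by simp
    have "\<bar>x powr p - y powr p\<bar> \<le> p * max x y powr (p - 1) * \<bar>x - y\<bar>"
      by (rule powr_diff_le[OF xy p])
    also have "\<dots> \<le> p * (1 + 2 powr p * (y powr p + 1)) * t n"
      using mp d p by (intro mult_mono mult_left_mono mult_nonneg_nonneg add_nonneg_nonneg) auto
    finally have "\<bar>x powr p - y powr p\<bar> / t n \<le> p * (1 + 2 powr p * (y powr p + 1))"
      using t[of n] by (simp add: divide_le_eq)
    then show ?thesis using t[of n] by (simp add: q_def w_def x_def y_def)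
  qed
  have qi: "integrable ?M (q n)" for n
  proof (rule Bochner_Integration.integrable_bound[OF wi qm], rule AE_I2)
    fix \<zeta> assume "\<zeta> \<in> space ?M"
    then have "norm (q n \<zeta>) \<le> w \<zeta>" by (intro qw) simp
    also have "\<dots> \<le> norm (w \<zeta>)" by simp
    finally show "norm (q n \<zeta>) \<le> norm (w \<zeta>)" .
  qed
  have lim: "AE \<zeta> in ?M. (\<lambda>n. q n \<zeta>) \<longlonglongrightarrow> - p * Re (of_real (norm (f \<zeta>) powr p) / f \<zeta> * k \<zeta>)"
    using nz
  proof eventually_elim
    case (elim \<zeta>)
    have "((\<lambda>h. (norm (f \<zeta> - of_real h * k \<zeta>) powr p - norm (f \<zeta>) powr p) / h)
        \<longlongrightarrow> - p * Re (of_real (norm (f \<zeta>) powr p) / f \<zeta> * k \<zeta>)) (at 0)"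
      using norm_powr_derivative[OF elim, of "k \<zeta>" p] by (simp add: DERIV_def)
    moreover have "filterlim t (at 0) sequentially"
      unfolding filterlim_at using t0 t(1) by (auto simp: less_imp_neq[symmetric] intro!: always_eventually)
    ultimately show ?case unfolding q_def by (rule filterlim_compose)
  qed
  have dm: "(\<lambda>\<zeta>. - p * Re (of_real (norm (f \<zeta>) powr p) / f \<zeta> * k \<zeta>)) \<in> borel_measurable ?M"
    using f(1) k(1) fm' by measurable
  have "(\<lambda>n. \<integral>\<zeta>. q n \<zeta> \<partial>?M) \<longlonglongrightarrow> (\<integral>\<zeta>. - p * Re (of_real (norm (f \<zeta>) powr p) / f \<zeta> * k \<zeta>) \<partial>?M)"
    by (rule integral_dominated_convergence[OF dm qm wi lim]) (use qw in \<open>auto intro!: AE_I2\<close>)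
  moreover have "0 \<le> (\<integral>\<zeta>. q n \<zeta> \<partial>?M)" for n
  proof -
    have "integrable ?M (\<lambda>\<zeta>. t n * q n \<zeta> + norm (f \<zeta>) powr p)" using qi[of n] f(2) by auto
    then have ki: "integrable ?M (\<lambda>\<zeta>. norm (f \<zeta> - of_real (t n) * k \<zeta>) powr p)"
      using t(1)[of n] by (simp add: q_def)
    have "(\<integral>\<zeta>. q n \<zeta> \<partial>?M) = ((\<integral>\<zeta>. norm (f \<zeta> - of_real (t n) * k \<zeta>) powr p \<partial>?M) - (\<integral>\<zeta>. norm (f \<zeta>) powr p \<partial>?M)) / t n"
      unfolding q_def using ki f(2) by simp
    then show ?thesis using min[of "t n"] t(1)[of n] by simp
  qed
  ultimately have "0 \<le> (\<integral>\<zeta>. - p * Re (of_real (norm (f \<zeta>) powr p) / f \<zeta> * k \<zeta>) \<partial>?M)"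
    by (intro tendsto_lowerbound[where F = sequentially]) auto
  also have "\<dots> = - p * (\<integral>\<zeta>. Re (of_real (norm (f \<zeta>) powr p) / f \<zeta> * k \<zeta>) \<partial>?M)"
    by (rule integral_mult_right_zero)
  finally show ?thesis using p by (simp add: zero_le_mult_iff mult_le_0_iff)
qed

lemma Lp_minimal_moments:
  assumes f: "f \<in> borel_measurable circle_measure" "integrable circle_measure (\<lambda>\<zeta>. norm (f \<zeta>) powr p)"
    and nz: "AE \<zeta> in circle_measure. f \<zeta> \<noteq> 0" and p: "1 \<le> p"
    and min: "\<And>w. (\<integral>\<zeta>. norm (f \<zeta>) powr p \<partial>circle_measure)
        \<le> (\<integral>\<zeta>. norm (f \<zeta> - w * \<zeta> ^ n) powr p \<partial>circle_measure)"
  shows "integrable circle_measure (\<lambda>\<zeta>. of_real (norm (f \<zeta>) powr p) / f \<zeta>)"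
    and "(\<integral>\<zeta>. \<zeta> ^ n * (of_real (norm (f \<zeta>) powr p) / f \<zeta>) \<partial>circle_measure) = 0"
proof -
  let ?M = circle_measure and ?\<phi> = "\<lambda>\<zeta>. of_real (norm (f \<zeta>) powr p) / f \<zeta>"
  have fm': "(\<lambda>\<zeta>. norm (f \<zeta>) powr p) \<in> borel_measurable ?M"
    using f(2) by (rule borel_measurable_integrable)
  have \<phi>m: "?\<phi> \<in> borel_measurable ?M" using f(1) fm' by measurable
  show \<phi>i: "integrable ?M ?\<phi>"
  proof (rule Bochner_Integration.integrable_bound[OF _ \<phi>m])
    show "integrable ?M (\<lambda>\<zeta>. 1 + norm (f \<zeta>) powr p)" using f(2) by auto
    have "x powr p / x \<le> 1 + x powr p" if "x \<ge> 0" for x :: real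
    proof (cases "x = 0")
      case False
      with that have x: "x > 0" by simp
      then have e: "x powr p / x = x powr (p - 1)" by (simp add: powr_diff)
      show ?thesis
      proof (cases "x \<le> 1")
        case True
        then have "x powr (p - 1) \<le> 1" using x p by (simp add: powr_le1)
        then show ?thesis unfolding e by (simp add: add_increasing2)
      next
        case False
        then have "x powr (p - 1) \<le> x powr p" by (intro powr_mono) auto
        then show ?thesis unfolding e by simp
      qed
    qed simp
    then show "AE \<zeta> in ?M. norm (?\<phi> \<zeta>) \<le> norm (1 + norm (f \<zeta>) powr p)"
      by (intro AE_I2) (simp add: norm_divide abs_of_nonneg add_nonneg_nonneg)
  qed
  have ni: "integrable ?M (\<lambda>\<zeta>. \<zeta> ^ n * ?\<phi> \<zeta>)"
  proof (rule Bochner_Integration.integrable_bound[OF \<phi>i])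
    show "(\<lambda>\<zeta>. \<zeta> ^ n * ?\<phi> \<zeta>) \<in> borel_measurable ?M" using \<phi>m by measurable
    show "AE \<zeta> in ?M. norm (\<zeta> ^ n * ?\<phi> \<zeta>) \<le> norm (?\<phi> \<zeta>)"
      by (intro AE_I2) (simp add: norm_mult norm_power norm_divide)
  qed
  let ?I = "\<integral>\<zeta>. \<zeta> ^ n * ?\<phi> \<zeta> \<partial>?M"
  have Re: "Re (c * ?I) \<le> 0" if c: "norm c = 1" for c
  proof -
    have "(\<integral>\<zeta>. Re (?\<phi> \<zeta> * (c * \<zeta> ^ n)) \<partial>?M) \<le> 0"
    proof (rule Lp_variation[OF f nz p])
      show "(\<lambda>\<zeta>. c * \<zeta> ^ n) \<in> borel_measurable ?M" by measurable
      show "norm (c * \<zeta> ^ n) \<le> 1" if "norm \<zeta> = 1" for \<zeta> using that c by (simp add: norm_mult norm_power)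
      show "(\<integral>\<zeta>. norm (f \<zeta>) powr p \<partial>?M) \<le> (\<integral>\<zeta>. norm (f \<zeta> - of_real t * (c * \<zeta> ^ n)) powr p \<partial>?M)" for t
        using min[of "of_real t * c"] by (simp add: mult.assoc)
    qed
    also have "(\<lambda>\<zeta>. Re (?\<phi> \<zeta> * (c * \<zeta> ^ n))) = (\<lambda>\<zeta>. Re (c * (\<zeta> ^ n * ?\<phi> \<zeta>)))"
      by (simp add: mult_ac)
    also have "(\<integral>\<zeta>. Re (c * (\<zeta> ^ n * ?\<phi> \<zeta>)) \<partial>?M) = Re (\<integral>\<zeta>. c * (\<zeta> ^ n * ?\<phi> \<zeta>) \<partial>?M)"
      by (rule integral_Re) (use ni in \<open>rule integrable_mult_right\<close>)
    finally show ?thesis unfolding integral_mult_right_zero .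
  qed
  \<comment> \<open>the four directions together leave only the value 0\<close>
  from Re[of 1] Re[of "-1"] Re[of \<i>] Re[of "-\<i>"] show "?I = 0"
    by (auto simp: complex_eq_iff)
qed

section \<open>Boundary calculus\<close>

lemma bdry_mult:
  assumes "has_bdry f" "has_bdry g"
  shows "has_bdry (\<lambda>z. f z * g z)"
    "AE \<zeta> in circle_measure. bdry (\<lambda>z. f z * g z) \<zeta> = bdry f \<zeta> * bdry g \<zeta>"
proof -
  have "AE \<zeta> in circle_measure. has_angular_limit (\<lambda>z. f z * g z) \<zeta> (bdry f \<zeta> * bdry g \<zeta>)"
    using assms[unfolded has_bdry_def] by eventually_elim (rule angular_limit_mult)
  then show "has_bdry (\<lambda>z. f z * g z)"
    "AE \<zeta> in circle_measure. bdry (\<lambda>z. f z * g z) \<zeta> = bdry f \<zeta> * bdry g \<zeta>"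
    by (rule has_bdryI)+
qed

lemma bdry_add:
  assumes "has_bdry f" "has_bdry g"
  shows "has_bdry (\<lambda>z. f z + g z)"
    "AE \<zeta> in circle_measure. bdry (\<lambda>z. f z + g z) \<zeta> = bdry f \<zeta> + bdry g \<zeta>"
proof -
  have "AE \<zeta> in circle_measure. has_angular_limit (\<lambda>z. f z + g z) \<zeta> (bdry f \<zeta> + bdry g \<zeta>)"
    using assms[unfolded has_bdry_def] by eventually_elim (rule angular_limit_add)
  then show "has_bdry (\<lambda>z. f z + g z)"
    "AE \<zeta> in circle_measure. bdry (\<lambda>z. f z + g z) \<zeta> = bdry f \<zeta> + bdry g \<zeta>"
    by (rule has_bdryI)+
qed

lemma bdry_const: "has_bdry (\<lambda>_. c)" "AE \<zeta> in circle_measure. bdry (\<lambda>_. c) \<zeta> = c"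
proof -
  have "AE \<zeta> in circle_measure. has_angular_limit (\<lambda>_. c) \<zeta> c"
    by (intro AE_I2 angular_limit_const)
  then show "has_bdry (\<lambda>_. c)" "AE \<zeta> in circle_measure. bdry (\<lambda>_. c) \<zeta> = c"
    by (rule has_bdryI)+
qed

lemma bdry_power_ident: "has_bdry (\<lambda>z. z ^ n)" "AE \<zeta> in circle_measure. bdry (\<lambda>z. z ^ n) \<zeta> = \<zeta> ^ n"
proof -
  have "AE \<zeta> in circle_measure. has_angular_limit (\<lambda>z. z ^ n) \<zeta> (\<zeta> ^ n)"
    by (intro AE_I2 angular_limit_compose[OF angular_limit_ident]) simp
  then show "has_bdry (\<lambda>z. z ^ n)" "AE \<zeta> in circle_measure. bdry (\<lambda>z. z ^ n) \<zeta> = \<zeta> ^ n"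
    by (rule has_bdryI)+
qed

lemma bdry_ident: "has_bdry (\<lambda>z. z)" "AE \<zeta> in circle_measure. bdry (\<lambda>z. z) \<zeta> = \<zeta>"
  using bdry_power_ident[of 1] by simp_all

lemma bdry_cmult:
  assumes "has_bdry f"
  shows "has_bdry (\<lambda>z. c * f z)" "AE \<zeta> in circle_measure. bdry (\<lambda>z. c * f z) \<zeta> = c * bdry f \<zeta>"
proof -
  show "has_bdry (\<lambda>z. c * f z)" by (rule bdry_mult(1)[OF bdry_const(1) assms])
  show "AE \<zeta> in circle_measure. bdry (\<lambda>z. c * f z) \<zeta> = c * bdry f \<zeta>"
    using bdry_mult(2)[OF bdry_const(1)[of c] assms] bdry_const(2)[of c] by eventually_elim simp
qed

lemma AE_circle_False: "\<not> (AE \<zeta> in circle_measure. False)"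
proof
  assume "AE \<zeta> in circle_measure. False"
  then have "(\<integral>\<zeta>. 1 \<partial>circle_measure) = (\<integral>\<zeta>. (0::real) \<partial>circle_measure)"
    by (intro integral_cong_AE) auto
  then show False by simp
qed

text \<open>The singularity of \<open>f z / z\<close> at 0 is removable; the quotient is bounded by compactness where
  \<open>\<bar>z\<bar> \<le> 1/2\<close> and by \<open>2 B\<close> elsewhere.\<close>

lemma divide_by_ident:
  assumes f: "f holomorphic_on ball 0 1" and B: "\<And>z. norm z < 1 \<Longrightarrow> norm (f z) \<le> B" and f0: "f 0 = 0"
  obtains h C where "h holomorphic_on ball 0 1" "\<And>z. norm z < 1 \<Longrightarrow> norm (h z) \<le> C"
    "\<And>z. norm z < 1 \<Longrightarrow> f z = z * h z" "has_bdry h" "AE \<zeta> in circle_measure. bdry f \<zeta> = \<zeta> * bdry h \<zeta>"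
proof -
  define h where "h = (\<lambda>z. if z = 0 then deriv f 0 else f z / z)"
  have hol: "h holomorphic_on ball 0 1"
    by (rule pole_theorem_0[OF f, of 0]) (auto simp: h_def f0)
  have eq: "f z = z * h z" for z by (simp add: h_def f0)
  have "compact (h ` cball 0 (1 / 2))"
    by (intro compact_continuous_image continuous_on_subset[OF holomorphic_on_imp_continuous_on[OF hol]]) auto
  then obtain D where D: "\<And>x. x \<in> h ` cball 0 (1 / 2) \<Longrightarrow> norm x \<le> D"
    using compact_imp_bounded bounded_iff by metis
  have bound: "norm (h z) \<le> max D (2 * B)" if z: "norm z < 1" for z
  proof (cases "norm z \<le> 1 / 2")
    case True
    then show ?thesis using D[of "h z"] by (simp add: le_max_iff_disj)
  next
    case False
    have "norm (h z) * (1 / 2) \<le> norm (h z) * norm z" using False by (intro mult_left_mono) auto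
    also have "\<dots> = norm (f z)" by (simp add: eq norm_mult mult.commute)
    also have "\<dots> \<le> B" by (rule B[OF z])
    finally show ?thesis by simp
  qed
  have hb: "has_bdry h" by (rule bounded_analytic_bdry(1)[OF hol bound])
  have "bdry f = bdry (\<lambda>z. z * h z)" by (rule bdry_cong) (rule eq)
  moreover have "AE \<zeta> in circle_measure. bdry (\<lambda>z. z * h z) \<zeta> = \<zeta> * bdry h \<zeta>"
    using bdry_mult(2)[OF bdry_ident(1) hb] bdry_ident(2) by eventually_elim simp
  ultimately have "AE \<zeta> in circle_measure. bdry f \<zeta> = \<zeta> * bdry h \<zeta>" by simp
  with hol bound eq hb show thesis by (intro that)
qed

lemma schwarz_const: "norm z < 1 \<Longrightarrow> schwarz (\<lambda>_. a) z = of_real a"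
  using circle_Cauchy_formula[of "\<lambda>_. of_real a" z]
  by (subst schwarz_eq_cauchy) (auto simp: algebra_simps)

lemma Outer_add_const:
  assumes "integrable circle_measure u" "norm z < 1"
  shows "Outer (\<lambda>\<zeta>. u \<zeta> + a) z = of_real (exp a) * Outer u z"
  using schwarz_add[OF assms(1) circle.integrable_const assms(2), of a] schwarz_const[OF assms(2)]
  by (simp add: Outer_def exp_add exp_of_real)

lemma Outer_0: "Outer u 0 = of_real (exp (\<integral>\<zeta>. u \<zeta> \<partial>circle_measure))"
  by (simp add: Outer_def schwarz_0 exp_of_real)

lemma outer_function_Outer:
  assumes "integrable circle_measure u" "norm \<alpha> = 1" "\<And>z. norm z < 1 \<Longrightarrow> F z = \<alpha> * Outer u z"
  shows "outer_function F"
  unfolding outer_function_def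
  by (intro exI[of _ u] exI[of _ \<alpha>]) (use assms in \<open>auto simp: Outer_def schwarz_def\<close>)

lemma outer_function_positive:
  assumes "outer_function F" "Im (F 0) = 0" "Re (F 0) > 0"
  obtains u where "integrable circle_measure u" "\<And>z. norm z < 1 \<Longrightarrow> F z = Outer u z"
proof -
  from assms(1) obtain u \<alpha> where u: "integrable circle_measure u" "norm \<alpha> = 1"
    "\<And>z. norm z < 1 \<Longrightarrow> F z = \<alpha> * Outer u z"
    by (auto simp: outer_function_def Outer_def schwarz_def)
  define e where "e = exp (\<integral>\<zeta>. u \<zeta> \<partial>circle_measure)"
  have e: "e > 0" by (simp add: e_def)
  have "F 0 = \<alpha> * of_real e" using u(3)[of 0] by (simp add: Outer_0 e_def)
  with assms e have a: "Im \<alpha> = 0" "Re \<alpha> > 0" by (auto simp: zero_less_mult_iff)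
  then have "\<alpha> = 1" using u(2) by (simp add: complex_eq_iff cmod_eq_Re)
  then show thesis using that[OF u(1)] u(3) by simp
qed

lemma powr_norm_measurable:
  assumes "f \<in> borel_measurable circle_measure"
  shows "(\<lambda>\<zeta>. norm (f \<zeta>) powr p) \<in> borel_measurable circle_measure"
proof -
  have "(\<lambda>\<zeta>. norm (f \<zeta>)) \<in> borel_measurable circle_measure"
    using assms by measurable
  then show ?thesis by (rule powr_real_measurable) simp
qed

section \<open>The error of best approximation\<close>

text \<open>The boundary function of \<open>lift\<close> is \<open>\<theta>\<close> times the error: multiplication by \<open>\<theta>\<close> moves the error into the
  Hardy space without changing its modulus. \<open>mass\<close> is the \<open>p\<close>-th power of the distance.\<close>

locale best_approximation =
  fixes \<theta> g q h :: "complex \<Rightarrow> complex" and p :: real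
  assumes \<theta>: "inner_function \<theta>" and p: "1 \<le> p" and gm: "g \<in> borel_measurable circle_measure"
    and h: "h \<in> hardy p" and gh: "AE \<zeta> in circle_measure. g \<zeta> = cnj (bdry \<theta> \<zeta>) * bdry h \<zeta>"
    and q: "q \<in> hardy p" and min: "Lp_norm p (\<lambda>\<zeta>. g \<zeta> - bdry q \<zeta>) = dist_hardy p g"
begin

definition err where "err = (\<lambda>\<zeta>. g \<zeta> - bdry q \<zeta>)"
definition lift where "lift = (\<lambda>z. h z + (- 1) * (\<theta> z * q z))"
definition mass where "mass = (\<integral>\<zeta>. norm (err \<zeta>) powr p \<partial>circle_measure)"

lemma p0: "p > 0" using p by simp

lemmas \<theta>_inner = inner_function_bounded[OF \<theta>]

lemma lift_hardy: "lift \<in> hardy p"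
  unfolding lift_def
  by (intro hardy_add[OF h] hardy_mult_bounded[of _ _ "\<lambda>_. - 1" 1] hardy_mult_bounded[OF q \<theta>_inner(1,2)] p0) auto

lemma err_measurable: "err \<in> borel_measurable circle_measure"
  unfolding err_def using gm hardy_bdry_measurable[OF q] by measurable

lemma lift_bdry: "AE \<zeta> in circle_measure. bdry lift \<zeta> = bdry \<theta> \<zeta> * err \<zeta> \<and> norm (bdry lift \<zeta>) = norm (err \<zeta>)"
proof -
  note hb = hardy_has_bdry[OF h p] and qb = hardy_has_bdry[OF q p]
  note m = bdry_mult[OF \<theta>_inner(3) qb]
  note c = bdry_cmult[OF m(1), of "- 1"]
  show ?thesis
    using bdry_add(2)[OF hb c(1)] c(2) m(2) gh \<theta>_inner(4)
    unfolding lift_def[symmetric]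
  proof eventually_elim
    case (elim \<zeta>)
    have "bdry \<theta> \<zeta> * cnj (bdry \<theta> \<zeta>) = 1"
      using elim(5) complex_norm_square[of "bdry \<theta> \<zeta>"] by simp
    then have "bdry lift \<zeta> = bdry \<theta> \<zeta> * err \<zeta>"
      using elim(1-4) by (simp add: err_def right_diff_distrib mult.assoc[symmetric])
    with elim(5) show ?case by (simp add: norm_mult)
  qed
qed

lemma err_integrable: "integrable circle_measure (\<lambda>\<zeta>. norm (err \<zeta>) powr p)"
proof (rule integrable_cong_AE_imp[OF hardy_bdry_powr_integrable[OF lift_hardy p]
        powr_norm_measurable[OF err_measurable]])
  show "AE \<zeta> in circle_measure. norm (bdry lift \<zeta>) powr p = norm (err \<zeta>) powr p"
    using lift_bdry
  proof eventually_elim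
    case (elim \<zeta>)
    then have "norm (bdry lift \<zeta>) = norm (err \<zeta>)" by (rule conjunct2)
    then show ?case by (rule arg_cong)
  qed
qed

lemma mass_nonneg: "mass \<ge> 0"
  unfolding mass_def by (rule integral_nonneg_AE) simp

lemma dist_eq: "dist_hardy p g = mass powr (1 / p)"
  using min by (simp add: Lp_norm_def mass_def err_def)

lemma dist_powr: "dist_hardy p g powr p = mass"
  using mass_nonneg p0 by (simp add: dist_eq powr_powr)

lemma dist_nonneg: "dist_hardy p g \<ge> 0"
  by (simp add: dist_eq)

lemma err_zero:
  assumes "dist_hardy p g = 0"
  shows "AE \<zeta> in circle_measure. err \<zeta> = 0"
proof -
  have "mass = 0" using assms dist_powr by simp
  then have "AE \<zeta> in circle_measure. norm (err \<zeta>) powr p = 0"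
    unfolding mass_def by (subst (asm) integral_nonneg_eq_0_iff_AE[OF err_integrable]) auto
  then show ?thesis by eventually_elim simp
qed

text \<open>Adding \<open>w z\<^sup>n\<close> to \<open>q\<close> gives another competitor in \<open>H\<^sup>p\<close>.\<close>

lemma mass_minimal: "mass \<le> (\<integral>\<zeta>. norm (err \<zeta> - w * \<zeta> ^ n) powr p \<partial>circle_measure)"
proof -
  let ?M = circle_measure
  let ?k = "\<lambda>z. q z + w * z ^ n"
  have zn: "(\<lambda>z. w * z ^ n) \<in> hardy p"
  proof (rule hardy_bounded[OF _ _ p0])
    show "(\<lambda>z. w * z ^ n) holomorphic_on ball 0 1" by (intro holomorphic_intros)
    show "norm (w * z ^ n) \<le> norm w" if "norm z < 1" for z
      using that by (simp add: norm_mult norm_power mult_left_le power_le_one)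
  qed
  have k: "?k \<in> hardy p" by (rule hardy_add[OF q zn p0])
  have "dist_hardy p g \<le> Lp_norm p (\<lambda>\<zeta>. g \<zeta> - bdry ?k \<zeta>)"
    unfolding dist_hardy_def
  proof (rule cINF_lower[OF _ k])
    show "bdd_below ((\<lambda>h. Lp_norm p (\<lambda>\<zeta>. g \<zeta> - bdry h \<zeta>)) ` hardy p)"
      by (rule bdd_belowI[of _ 0]) (auto simp: Lp_norm_def)
  qed
  also have "Lp_norm p (\<lambda>\<zeta>. g \<zeta> - bdry ?k \<zeta>) = (\<integral>\<zeta>. norm (err \<zeta> - w * \<zeta> ^ n) powr p \<partial>?M) powr (1 / p)"
    unfolding Lp_norm_def
  proof (intro arg_cong2[where f = "(powr)"] refl integral_cong_AE)
    have m: "bdry ?k \<in> borel_measurable ?M" by (rule hardy_bdry_measurable[OF k])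
    have "(\<lambda>\<zeta>. g \<zeta> - bdry ?k \<zeta>) \<in> borel_measurable ?M" using gm m by measurable
    then show "(\<lambda>\<zeta>. norm (g \<zeta> - bdry ?k \<zeta>) powr p) \<in> borel_measurable ?M"
      by (rule powr_norm_measurable)
    have "(\<lambda>\<zeta>. err \<zeta> - w * \<zeta> ^ n) \<in> borel_measurable ?M" using err_measurable by measurable
    then show "(\<lambda>\<zeta>. norm (err \<zeta> - w * \<zeta> ^ n) powr p) \<in> borel_measurable ?M"
      by (rule powr_norm_measurable)
    note c = bdry_cmult[OF bdry_power_ident(1)[of n], of w]
    show "AE \<zeta> in ?M. norm (g \<zeta> - bdry ?k \<zeta>) powr p = norm (err \<zeta> - w * \<zeta> ^ n) powr p"
      using bdry_add(2)[OF hardy_has_bdry[OF q p] c(1)] c(2) bdry_power_ident(2)[of n]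
      by eventually_elim (simp add: err_def diff_diff_eq)
  qed
  finally have le: "mass powr (1 / p) \<le> (\<integral>\<zeta>. norm (err \<zeta> - w * \<zeta> ^ n) powr p \<partial>?M) powr (1 / p)"
    by (simp add: dist_eq)
  have nn: "0 \<le> (\<integral>\<zeta>. norm (err \<zeta> - w * \<zeta> ^ n) powr p \<partial>?M)"
    by (rule integral_nonneg_AE) simp
  show ?thesis
  proof (rule ccontr)
    assume "\<not> ?thesis"
    then have "(\<integral>\<zeta>. norm (err \<zeta> - w * \<zeta> ^ n) powr p \<partial>?M) powr (1 / p) < mass powr (1 / p)"
      using nn p0 by (intro powr_less_mono2) auto
    with le show False by simp
  qed
qed

end

section \<open>Existence and uniqueness of the representation\<close>

context best_approximation
begin

lemma representationI:
  assumes u: "integrable circle_measure u" and \<alpha>: "norm \<alpha> = 1"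
    and F: "\<And>z. norm z < 1 \<Longrightarrow> F z = \<alpha> * Outer u z" and F0: "Im (F 0) = 0" "Re (F 0) > 0"
    and norm: "Lp_norm 2 (bdry F) = 1" and I: "inner_function I"
    and Fh: "F \<in> hardy 2" and f1: "f1 \<in> hardy 2" and f2: "f2 \<in> hardy 2"
    and K1: "AE \<zeta> in circle_measure. bdry F \<zeta> = cnj \<zeta> * bdry \<theta> \<zeta> * cnj (bdry f1 \<zeta>)"
    and K2: "AE \<zeta> in circle_measure. bdry I \<zeta> * bdry F \<zeta> = cnj \<zeta> * bdry \<theta> \<zeta> * cnj (bdry f2 \<zeta>)"
    and rep: "AE \<zeta> in circle_measure. err \<zeta> =
       of_real (dist_hardy p g) * cnj (bdry \<theta> \<zeta>) * bdry I \<zeta> * bdry (disk_power F (2 / p)) \<zeta>"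
  shows "is_representation \<theta> p g q I F"
proof -
  note Ii = inner_function_bounded[OF I]
  have Fb: "has_bdry F" by (rule hardy_has_bdry[OF Fh]) simp
  have IF: "(\<lambda>z. I z * F z) \<in> hardy 2"
    by (rule hardy_mult_bounded[OF Fh Ii(1,2)]) auto
  have "AE \<zeta> in circle_measure. bdry (\<lambda>z. I z * F z) \<zeta> = cnj \<zeta> * bdry \<theta> \<zeta> * cnj (bdry f2 \<zeta>)"
    using bdry_mult(2)[OF Ii(3) Fb] K2 by eventually_elim simp
  then have "(\<lambda>z. I z * F z) \<in> model_space \<theta>"
    using IF f2 by (auto simp: model_space_def)
  moreover have "F \<in> model_space \<theta>"
    using Fh f1 K1 by (auto simp: model_space_def)
  moreover have "outer_function F"
    by (rule outer_function_Outer[OF u \<alpha> F])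
  ultimately show ?thesis
    using F0 norm I rep by (simp add: is_representation_def err_def)
qed

text \<open>Both sides of the representation vanish, so only the model space matters. The reproducing kernel
  \<open>1 - cnj (\<theta> 0) \<theta>\<close> at 0 is bounded with values in the right half-plane, hence outer, and it equals
  \<open>cnj \<zeta> \<theta> cnj f\<close> on the circle with \<open>f = (\<theta> - \<theta> 0)/z\<close>.\<close>

lemma representation_dist_zero:
  assumes nonconst: "\<not> \<theta> constant_on ball 0 1" and dist0: "dist_hardy p g = 0"
  shows "\<exists>I F. is_representation \<theta> p g q I F"
proof -
  let ?M = circle_measure
  define a where "a = \<theta> 0"
  have a1: "norm a < 1"
  proof (rule ccontr)
    assume "\<not> norm a < 1"
    then have "norm (\<theta> z) \<le> norm (\<theta> 0)" if "z \<in> ball 0 1" for z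
      using \<theta>_inner(2)[of z] that by (auto simp: a_def)
    then have "\<theta> constant_on ball 0 1"
      by (intro maximum_modulus_principle[OF \<theta>_inner(1), of "ball 0 1" 0]) auto
    with nonconst show False by simp
  qed
  define k where "k = (\<lambda>z. 1 + (- cnj a) * \<theta> z)"
  have kh: "k holomorphic_on ball 0 1" unfolding k_def by (intro holomorphic_intros \<theta>_inner)
  have ak: "norm (cnj a * \<theta> z) \<le> norm a" if "norm z < 1" for z
    using \<theta>_inner(2)[OF that] by (simp add: norm_mult mult_left_le)
  have kB: "norm (k z) \<le> 2" if "norm z < 1" for z
    using norm_triangle_ineq4[of 1 "cnj a * \<theta> z"] ak[OF that] a1 by (simp add: k_def)
  have kpos: "Re (k z) > 0" if "norm z < 1" for z
    using complex_Re_le_cmod[of "cnj a * \<theta> z"] ak[OF that] a1 by (simp add: k_def)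
  obtain \<alpha> where \<alpha>: "norm \<alpha> = 1" "integrable ?M (\<lambda>\<zeta>. ln (norm (bdry k \<zeta>)))"
    "\<And>z. norm z < 1 \<Longrightarrow> k z = \<alpha> * Outer (\<lambda>\<zeta>. ln (norm (bdry k \<zeta>))) z"
    by (rule right_half_plane_outer[OF kh kB kpos]) auto
  note t = bdry_cmult[OF \<theta>_inner(3), of "- cnj a"]
  have kb: "AE \<zeta> in ?M. bdry k \<zeta> = 1 - cnj a * bdry \<theta> \<zeta>"
    using bdry_add(2)[OF bdry_const(1)[of 1] t(1)] t(2) bdry_const(2)[of 1]
    unfolding k_def by eventually_elim simp
  have khb: "has_bdry k" unfolding k_def by (rule bdry_add(1)[OF bdry_const(1) t(1)])
  have kh2: "k \<in> hardy 2" by (rule hardy_bounded[OF kh kB]) auto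
  define N where "N = (\<integral>\<zeta>. norm (bdry k \<zeta>) powr 2 \<partial>?M)"
  have Ni: "integrable ?M (\<lambda>\<zeta>. norm (bdry k \<zeta>) powr 2)"
    by (rule hardy_bdry_powr_integrable[OF kh2]) simp
  have "(1 - norm a)\<^sup>2 = (\<integral>\<zeta>. (1 - norm a)\<^sup>2 \<partial>?M)" by simp
  also have "\<dots> \<le> N" unfolding N_def
  proof (rule integral_mono_AE[OF _ Ni])
    show "AE \<zeta> in ?M. (1 - norm a)\<^sup>2 \<le> norm (bdry k \<zeta>) powr 2"
      using kb \<theta>_inner(4)
    proof eventually_elim
      case (elim \<zeta>)
      have "1 - norm a \<le> norm (bdry k \<zeta>)"
        using norm_triangle_ineq2[of 1 "cnj a * bdry \<theta> \<zeta>"] elim by (simp add: norm_mult)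
      then have "(1 - norm a)\<^sup>2 \<le> (norm (bdry k \<zeta>))\<^sup>2" using a1 by (intro power_mono) auto
      then show ?case by simp
    qed
  qed auto
  finally have Npos: "N > 0" using a1 by (smt (verit) zero_less_power)
  define s where "s = sqrt N"
  have s: "s > 0" "s\<^sup>2 = N" using Npos by (auto simp: s_def)
  define F where "F = (\<lambda>z. of_real (1 / s) * k z)"
  have Fhb: "has_bdry F" and Fb: "AE \<zeta> in ?M. bdry F \<zeta> = of_real (1 / s) * bdry k \<zeta>"
    unfolding F_def by (rule bdry_cmult[OF khb])+
  have Fh2: "F \<in> hardy 2" unfolding F_def
    by (rule hardy_mult_bounded[OF kh2, of _ "1 / s"]) (use s in \<open>auto simp: norm_divide\<close>)
  have "(\<lambda>z. \<theta> z + (- a)) holomorphic_on ball 0 1" by (intro holomorphic_intros \<theta>_inner)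
  moreover have "norm (\<theta> z + (- a)) \<le> 2" if "norm z < 1" for z
    using norm_triangle_ineq4[of "\<theta> z" a] \<theta>_inner(2)[OF that] a1 by simp
  ultimately obtain h0 C where h0: "h0 holomorphic_on ball 0 1" "\<And>z. norm z < 1 \<Longrightarrow> norm (h0 z) \<le> C"
    "has_bdry h0" "AE \<zeta> in ?M. bdry (\<lambda>z. \<theta> z + (- a)) \<zeta> = \<zeta> * bdry h0 \<zeta>"
    by (rule divide_by_ident) (auto simp: a_def)
  define f where "f = (\<lambda>z. of_real (1 / s) * h0 z)"
  have fh2: "f \<in> hardy 2" unfolding f_def
  proof (rule hardy_bounded)
    show "(\<lambda>z. of_real (1 / s) * h0 z) holomorphic_on ball 0 1" by (intro holomorphic_intros h0)
    show "norm (of_real (1 / s) * h0 z) \<le> 1 / s * C" if "norm z < 1" for z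
      unfolding norm_mult norm_of_real using h0(2)[OF that] s by (intro mult_mono) auto
  qed simp
  have fb: "AE \<zeta> in ?M. bdry f \<zeta> = of_real (1 / s) * bdry h0 \<zeta>"
    unfolding f_def by (rule bdry_cmult[OF h0(3)])
  have K: "AE \<zeta> in ?M. bdry F \<zeta> = cnj \<zeta> * bdry \<theta> \<zeta> * cnj (bdry f \<zeta>)"
    using Fb kb fb h0(4) bdry_add(2)[OF \<theta>_inner(3) bdry_const(1)[of "- a"]] bdry_const(2)[of "- a"]
      \<theta>_inner(4) AE_space
  proof eventually_elim
    case (elim \<zeta>)
    have zz: "\<zeta> * cnj \<zeta> = 1" using elim(8) complex_norm_square[of \<zeta>] by simp
    have tt: "bdry \<theta> \<zeta> * cnj (bdry \<theta> \<zeta>) = 1" using elim(7) complex_norm_square[of "bdry \<theta> \<zeta>"] by simp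
    have "\<zeta> * bdry h0 \<zeta> = bdry \<theta> \<zeta> - a" using elim(4-6) by simp
    then have "cnj \<zeta> * (\<zeta> * bdry h0 \<zeta>) = cnj \<zeta> * (bdry \<theta> \<zeta> - a)" by simp
    then have e: "bdry h0 \<zeta> = cnj \<zeta> * (bdry \<theta> \<zeta> - a)" using zz by (simp add: mult.assoc[symmetric] mult.commute)
    have "cnj \<zeta> * bdry \<theta> \<zeta> * cnj (bdry h0 \<zeta>)
        = (\<zeta> * cnj \<zeta>) * (bdry \<theta> \<zeta> * cnj (bdry \<theta> \<zeta>)) - (\<zeta> * cnj \<zeta>) * (cnj a * bdry \<theta> \<zeta>)"
      unfolding e by (simp add: algebra_simps)
    then have "cnj \<zeta> * bdry \<theta> \<zeta> * cnj (bdry h0 \<zeta>) = bdry k \<zeta>" unfolding zz tt elim(2) by simp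
    then show ?case using elim(1,3) by (simp add: mult_ac)
  qed
  have norm1: "Lp_norm 2 (bdry F) = 1"
  proof -
    have "(\<integral>\<zeta>. norm (bdry F \<zeta>) powr 2 \<partial>?M) = (\<integral>\<zeta>. 1 / N * norm (bdry k \<zeta>) powr 2 \<partial>?M)"
    proof (rule integral_cong_AE)
      show "(\<lambda>\<zeta>. norm (bdry F \<zeta>) powr 2) \<in> borel_measurable ?M"
        by (rule powr_norm_measurable[OF hardy_bdry_measurable[OF Fh2]])
      show "(\<lambda>\<zeta>. 1 / N * norm (bdry k \<zeta>) powr 2) \<in> borel_measurable ?M"
        using borel_measurable_integrable[OF Ni] by measurable
      show "AE \<zeta> in ?M. norm (bdry F \<zeta>) powr 2 = 1 / N * norm (bdry k \<zeta>) powr 2"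
        using Fb by eventually_elim (use s in \<open>simp add: norm_mult norm_divide power_divide\<close>)
    qed
    also have "\<dots> = 1 / N * N" unfolding N_def by (rule integral_mult_right_zero)
    finally show ?thesis using Npos by (simp add: Lp_norm_def)
  qed
  have "F 0 = of_real ((1 - (norm a)\<^sup>2) / s)"
    using complex_norm_square[of a] by (simp add: F_def k_def a_def mult.commute)
  moreover have "(norm a)\<^sup>2 < 1" using a1 by (simp add: abs_square_less_1)
  ultimately have F0: "Im (F 0) = 0" "Re (F 0) > 0" using s by (auto simp del: of_real_divide)
  define u where "u = (\<lambda>\<zeta>. ln (norm (bdry k \<zeta>)) + (- ln s))"
  have ui: "integrable ?M u" unfolding u_def using \<alpha>(2) by auto
  have FO: "F z = \<alpha> * Outer u z" if z: "norm z < 1" for z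
    unfolding u_def Outer_add_const[OF \<alpha>(2) z] using \<alpha>(3)[OF z] s by (simp add: F_def exp_minus inverse_eq_divide)
  have I: "inner_function (\<lambda>_. 1)"
    by (rule inner_functionI[where B = 1]) (use bdry_const(2)[of 1] in \<open>auto elim!: eventually_mono\<close>)
  have "AE \<zeta> in ?M. bdry (\<lambda>_. 1) \<zeta> * bdry F \<zeta> = cnj \<zeta> * bdry \<theta> \<zeta> * cnj (bdry f \<zeta>)"
    using K bdry_const(2)[of 1] by eventually_elim simp
  moreover have "AE \<zeta> in ?M. err \<zeta> = of_real (dist_hardy p g) * cnj (bdry \<theta> \<zeta>) * bdry (\<lambda>_. 1) \<zeta> * bdry (disk_power F (2 / p)) \<zeta>"
    using err_zero[OF dist0] dist0 by simp
  ultimately have "is_representation \<theta> p g q (\<lambda>_. 1) F"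
    by (intro representationI[OF ui \<alpha>(1) FO F0 norm1 I Fh2 fh2 fh2 K])
  then show ?thesis by blast
qed

text \<open>The moments of \<open>\<phi> = \<bar>err\<bar>\<^sup>p / err\<close> vanish by minimality, so it is the boundary
  function of some \<open>\<Phi> \<in> H\<^sup>1\<close> with \<open>\<Phi> 0 = 0\<close>. Factoring \<open>lift\<close> and \<open>\<Phi>\<close> and multiplying their boundary
  values gives \<open>\<theta> \<bar>F\<bar>\<^sup>2 = \<zeta> I I\<^sub>2 F\<^sup>2\<close>, which is the membership of \<open>F\<close> and \<open>I F\<close> in the model space.\<close>

lemma representation_dist_pos:
  assumes pos: "dist_hardy p g \<noteq> 0"
  shows "\<exists>I F. is_representation \<theta> p g q I F"
proof -
  let ?M = circle_measure
  define c where "c = dist_hardy p g"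
  have c0: "c > 0" using pos dist_nonneg by (simp add: c_def)
  have cp: "c powr p = mass" using dist_powr by (simp add: c_def)
  have mpos: "mass > 0" unfolding cp[symmetric] using c0 by simp
  have L1: "lift \<in> hardy 1" by (rule hardy_subset_hardy_1[OF lift_hardy p])
  have "\<exists>z0. norm z0 < 1 \<and> lift z0 \<noteq> 0"
  proof (rule ccontr)
    assume "\<not> ?thesis"
    then have "bdry lift = bdry (\<lambda>_. 0)" by (intro bdry_cong) blast
    then have "AE \<zeta> in ?M. norm (err \<zeta>) powr p = 0"
      using bdry_const(2)[of 0] lift_bdry by (simp, elim eventually_rev_mp) simp
    then have "mass = (\<integral>\<zeta>. 0 \<partial>?M)"
      unfolding mass_def
      by (intro integral_cong_AE borel_measurable_integrable[OF err_integrable]) auto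
    with mpos show False by simp
  qed
  then obtain z0 where z0: "norm z0 < 1" "lift z0 \<noteq> 0" by blast
  note H = hardy_1_bdry[OF L1 z0]
  define v where "v = (\<lambda>\<zeta>. ln (norm (bdry lift \<zeta>)))"
  have vi: "integrable ?M v" unfolding v_def by (rule H(3))
  obtain I where I: "inner_function I" "\<And>z. norm z < 1 \<Longrightarrow> lift z = I z * Outer v z"
    unfolding v_def by (rule inner_outer_factorization[OF L1 z0]) blast
  note Ii = inner_function_bounded[OF I(1)]
  have err_nz: "AE \<zeta> in ?M. err \<zeta> \<noteq> 0"
    using H(2) lift_bdry by eventually_elim auto
  define \<phi> where "\<phi> = (\<lambda>\<zeta>. of_real (norm (err \<zeta>) powr p) / err \<zeta>)"
  have \<phi>i: "integrable ?M \<phi>" and orth: "(\<integral>\<zeta>. \<zeta> ^ n * \<phi> \<zeta> \<partial>?M) = 0" for n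
    unfolding \<phi>_def
    by (rule Lp_minimal_moments[OF err_measurable err_integrable err_nz p mass_minimal[unfolded mass_def, of _ n]])+
  define \<Phi> where "\<Phi> = poisson \<phi>"
  have \<Phi>: "\<Phi> \<in> hardy 1" "\<Phi> 0 = 0" "AE \<zeta> in ?M. bdry \<Phi> \<zeta> = \<phi> \<zeta>"
    unfolding \<Phi>_def by (rule analytic_of_vanishing_moments[OF \<phi>i orth])+
  have "\<exists>z1. norm z1 < 1 \<and> \<Phi> z1 \<noteq> 0"
  proof (rule ccontr)
    assume "\<not> ?thesis"
    then have "bdry \<Phi> = bdry (\<lambda>_. 0)" by (intro bdry_cong) blast
    then have "AE \<zeta> in ?M. bdry \<Phi> \<zeta> = 0" using bdry_const(2)[of 0] by simp
    then have "AE \<zeta> in ?M. False"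
      using \<Phi>(3) err_nz by eventually_elim (simp add: \<phi>_def)
    then show False using AE_circle_False by simp
  qed
  then obtain z1 where z1: "norm z1 < 1" "\<Phi> z1 \<noteq> 0" by blast
  define w where "w = (\<lambda>\<zeta>. ln (norm (bdry \<Phi> \<zeta>)))"
  have wi: "integrable ?M w" unfolding w_def by (rule hardy_1_bdry(3)[OF \<Phi>(1) z1])
  obtain I3 where I3: "inner_function I3" "\<And>z. norm z < 1 \<Longrightarrow> \<Phi> z = I3 z * Outer w z"
    unfolding w_def by (rule inner_outer_factorization[OF \<Phi>(1) z1]) blast
  note I3i = inner_function_bounded[OF I3(1)]
  have "I3 0 = 0" using I3(2)[of 0] \<Phi>(2) by simp
  then obtain I2 C where I2: "I2 holomorphic_on ball 0 1" "\<And>z. norm z < 1 \<Longrightarrow> norm (I2 z) \<le> C"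
    "has_bdry I2" "AE \<zeta> in ?M. bdry I3 \<zeta> = \<zeta> * bdry I2 \<zeta>"
    using divide_by_ident[OF I3i(1,2)] by metis
  have I2u: "AE \<zeta> in ?M. norm (bdry I2 \<zeta>) = 1"
    using I2(4) I3i(4) AE_space by eventually_elim (simp add: norm_mult)
  define u where "u = (\<lambda>\<zeta>. p / 2 * (v \<zeta> + - ln c))"
  have vci: "integrable ?M (\<lambda>\<zeta>. v \<zeta> + - ln c)" using vi by auto
  have ui: "integrable ?M u" unfolding u_def using vci by (rule integrable_mult_right)
  define F where "F = Outer u"
  have Fnb: "AE \<zeta> in ?M. norm (bdry F \<zeta>) = exp (u \<zeta>)" and Fhb: "has_bdry F"
    unfolding F_def by (rule Outer_bdry[OF ui])+
  have e2u: "AE \<zeta> in ?M. norm (err \<zeta>) powr p / mass = exp (2 * u \<zeta>)"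
    using lift_bdry err_nz
  proof eventually_elim
    case (elim \<zeta>)
    have "v \<zeta> = ln (norm (err \<zeta>))" unfolding v_def by (rule arg_cong[OF conjunct2[OF elim(1)]])
    moreover have "2 * u \<zeta> = p * (v \<zeta> + - ln c)" by (simp add: u_def)
    ultimately have "2 * u \<zeta> = p * ln (norm (err \<zeta>)) - p * ln c" by (simp add: algebra_simps)
    then have "exp (2 * u \<zeta>) = norm (err \<zeta>) powr p / c powr p"
      using elim c0 by (simp add: exp_diff powr_def)
    then show ?case by (simp add: cp)
  qed
  have e2i: "integrable ?M (\<lambda>\<zeta>. exp (2 * u \<zeta>))"
  proof (rule integrable_cong_AE_imp[OF _ _ e2u])
    show "integrable ?M (\<lambda>\<zeta>. norm (err \<zeta>) powr p / mass)" using err_integrable by auto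
    show "(\<lambda>\<zeta>. exp (2 * u \<zeta>)) \<in> borel_measurable ?M" using ui by measurable
  qed
  have Fh2: "F \<in> hardy 2" unfolding F_def by (rule Outer_in_hardy[OF ui e2i])
  have norm1: "Lp_norm 2 (bdry F) = 1"
  proof -
    have "(\<integral>\<zeta>. norm (bdry F \<zeta>) powr 2 \<partial>?M) = (\<integral>\<zeta>. norm (err \<zeta>) powr p / mass \<partial>?M)"
    proof (rule integral_cong_AE)
      show "(\<lambda>\<zeta>. norm (bdry F \<zeta>) powr 2) \<in> borel_measurable ?M"
        by (rule powr_norm_measurable[OF hardy_bdry_measurable[OF Fh2]])
      show "(\<lambda>\<zeta>. norm (err \<zeta>) powr p / mass) \<in> borel_measurable ?M"
        using borel_measurable_integrable[OF err_integrable] by measurable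
      show "AE \<zeta> in ?M. norm (bdry F \<zeta>) powr 2 = norm (err \<zeta>) powr p / mass"
        using Fnb e2u by eventually_elim (simp add: exp_double[symmetric])
    qed
    also have "\<dots> = 1" using mpos by (simp add: mass_def)
    finally show ?thesis by (simp add: Lp_norm_def)
  qed
  have F0: "Im (F 0) = 0" "Re (F 0) > 0" by (simp_all add: F_def Outer_0)
  \<comment> \<open>the outer parts of \<open>lift\<close> and \<open>\<Phi>\<close> multiply to \<open>c\<^sup>p F\<^sup>2\<close>\<close>
  have wv: "AE \<zeta> in ?M. v \<zeta> + w \<zeta> = 2 * u \<zeta> + p * ln c"
    using lift_bdry err_nz \<Phi>(3)
  proof eventually_elim
    case (elim \<zeta>)
    have "w \<zeta> = p * ln (norm (err \<zeta>)) - ln (norm (err \<zeta>))"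
      using elim(2,3) by (simp add: w_def \<phi>_def norm_divide ln_div ln_powr)
    moreover have "v \<zeta> = ln (norm (err \<zeta>))" unfolding v_def by (rule arg_cong[OF conjunct2[OF elim(1)]])
    moreover have "2 * u \<zeta> = p * (v \<zeta> + - ln c)" by (simp add: u_def)
    ultimately show ?case by (simp add: algebra_simps)
  qed
  have u2i: "integrable ?M (\<lambda>\<zeta>. 2 * u \<zeta>)" using ui by auto
  have prod: "Outer v z * Outer w z = of_real mass * (F z * F z)" if z: "norm z < 1" for z
  proof -
    have "Outer v z * Outer w z = exp (schwarz (\<lambda>\<zeta>. v \<zeta> + w \<zeta>) z)"
      by (simp add: Outer_def exp_add schwarz_add[OF vi wi z])
    also have "schwarz (\<lambda>\<zeta>. v \<zeta> + w \<zeta>) z = schwarz (\<lambda>\<zeta>. 2 * u \<zeta> + p * ln c) z"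
      by (rule schwarz_cong_AE[OF wv]) (use vi wi ui in measurable)
    also have "exp \<dots> = of_real (exp (p * ln c)) * Outer (\<lambda>\<zeta>. 2 * u \<zeta>) z"
      unfolding Outer_def[symmetric] by (rule Outer_add_const[OF u2i z])
    also have "exp (p * ln c) = mass" using c0 by (simp add: cp[symmetric] powr_def)
    also have "Outer (\<lambda>\<zeta>. 2 * u \<zeta>) z = F z * F z"
      by (simp add: Outer_def F_def schwarz_cmult exp_add[symmetric])
    finally show ?thesis .
  qed
  note vb = Outer_bdry(1)[OF vi] and wb = Outer_bdry(1)[OF wi]
  have pe: "bdry (\<lambda>z. Outer v z * Outer w z) = bdry (\<lambda>z. of_real mass * (F z * F z))"
    by (rule bdry_cong) (rule prod)
  have prodb: "AE \<zeta> in ?M. bdry (Outer v) \<zeta> * bdry (Outer w) \<zeta> = of_real mass * (bdry F \<zeta> * bdry F \<zeta>)"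
    using bdry_mult(2)[OF vb wb] bdry_cmult(2)[OF bdry_mult(1)[OF Fhb Fhb], of "of_real mass"]
      bdry_mult(2)[OF Fhb Fhb]
    unfolding pe by eventually_elim simp
  have lb: "AE \<zeta> in ?M. bdry lift \<zeta> = bdry I \<zeta> * bdry (Outer v) \<zeta>"
    using bdry_mult(2)[OF Ii(3) vb] bdry_cong[of lift "\<lambda>z. I z * Outer v z"] I(2) by simp
  have \<Phi>b: "AE \<zeta> in ?M. bdry \<Phi> \<zeta> = bdry I3 \<zeta> * bdry (Outer w) \<zeta>"
    using bdry_mult(2)[OF I3i(3) wb] bdry_cong[of \<Phi> "\<lambda>z. I3 z * Outer w z"] I3(2) by simp
  have key: "AE \<zeta> in ?M. bdry F \<zeta> = cnj \<zeta> * bdry \<theta> \<zeta> * cnj (bdry I \<zeta> * bdry I2 \<zeta> * bdry F \<zeta>)"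
    using lb \<Phi>b prodb I2(4) \<Phi>(3) lift_bdry err_nz e2u Fnb \<theta>_inner(4)
  proof eventually_elim
    case (elim \<zeta>)
    have tt: "bdry \<theta> \<zeta> * cnj (bdry \<theta> \<zeta>) = 1" using elim(10) complex_norm_square[of "bdry \<theta> \<zeta>"] by simp
    have Fne: "bdry F \<zeta> \<noteq> 0" using elim(9) by auto
    have "of_real (norm (err \<zeta>) powr p) = of_real mass * complex_of_real ((norm (bdry F \<zeta>))\<^sup>2)"
    proof -
      have "norm (err \<zeta>) powr p = mass * exp (2 * u \<zeta>)"
        using elim(8) mpos by (simp add: field_simps)
      also have "\<dots> = mass * (norm (bdry F \<zeta>))\<^sup>2"
        unfolding elim(9) exp_double ..
      finally show ?thesis by simp
    qed
    then have e: "of_real (norm (err \<zeta>) powr p) = of_real mass * (bdry F \<zeta> * cnj (bdry F \<zeta>))"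
      unfolding complex_norm_square .
    have "bdry lift \<zeta> * bdry \<Phi> \<zeta> = bdry \<theta> \<zeta> * of_real (norm (err \<zeta>) powr p)"
      using elim(5,6,7) by (simp add: \<phi>_def)
    moreover have "bdry lift \<zeta> * bdry \<Phi> \<zeta>
        = \<zeta> * bdry I \<zeta> * bdry I2 \<zeta> * (bdry (Outer v) \<zeta> * bdry (Outer w) \<zeta>)"
      unfolding elim(1,2,4) by (simp add: mult_ac)
    ultimately have "of_real mass * bdry F \<zeta> * (bdry \<theta> \<zeta> * cnj (bdry F \<zeta>))
        = of_real mass * bdry F \<zeta> * (\<zeta> * bdry I \<zeta> * bdry I2 \<zeta> * bdry F \<zeta>)"
      unfolding elim(3) e by (simp add: mult_ac)
    then have "bdry \<theta> \<zeta> * cnj (bdry F \<zeta>) = \<zeta> * bdry I \<zeta> * bdry I2 \<zeta> * bdry F \<zeta>"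
      using mpos Fne by simp
    then have "cnj (bdry \<theta> \<zeta> * cnj (bdry F \<zeta>)) = cnj (\<zeta> * bdry I \<zeta> * bdry I2 \<zeta> * bdry F \<zeta>)" by simp
    then have "cnj (bdry \<theta> \<zeta>) * bdry F \<zeta> = cnj \<zeta> * cnj (bdry I \<zeta> * bdry I2 \<zeta> * bdry F \<zeta>)"
      by (simp add: mult_ac)
    then have "bdry \<theta> \<zeta> * (cnj (bdry \<theta> \<zeta>) * bdry F \<zeta>) = bdry \<theta> \<zeta> * (cnj \<zeta> * cnj (bdry I \<zeta> * bdry I2 \<zeta> * bdry F \<zeta>))"
      by simp
    then show ?case unfolding mult.assoc[symmetric] tt by (simp add: mult_ac)
  qed
  define f2 where "f2 = (\<lambda>z. I2 z * F z)"
  define f1 where "f1 = (\<lambda>z. I z * f2 z)"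
  have f2h: "f2 \<in> hardy 2" unfolding f2_def by (rule hardy_mult_bounded[OF Fh2 I2(1,2)]) auto
  have f1h: "f1 \<in> hardy 2" unfolding f1_def by (rule hardy_mult_bounded[OF f2h Ii(1,2)]) auto
  have f2b: "AE \<zeta> in ?M. bdry f2 \<zeta> = bdry I2 \<zeta> * bdry F \<zeta>"
    unfolding f2_def by (rule bdry_mult(2)[OF I2(3) Fhb])
  have f1b: "AE \<zeta> in ?M. bdry f1 \<zeta> = bdry I \<zeta> * bdry f2 \<zeta>"
    unfolding f1_def by (rule bdry_mult(2)[OF Ii(3) hardy_has_bdry[OF f2h]]) simp
  have K1: "AE \<zeta> in ?M. bdry F \<zeta> = cnj \<zeta> * bdry \<theta> \<zeta> * cnj (bdry f1 \<zeta>)"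
    using key f1b f2b
  proof eventually_elim
    case (elim \<zeta>)
    show ?case unfolding elim(2,3) mult.assoc[symmetric, of "bdry I \<zeta>"] by (rule elim(1))
  qed
  have K2: "AE \<zeta> in ?M. bdry I \<zeta> * bdry F \<zeta> = cnj \<zeta> * bdry \<theta> \<zeta> * cnj (bdry f2 \<zeta>)"
    using key f2b Ii(4)
  proof eventually_elim
    case (elim \<zeta>)
    have ii: "bdry I \<zeta> * cnj (bdry I \<zeta>) = 1" using elim(3) complex_norm_square[of "bdry I \<zeta>"] by simp
    have "bdry I \<zeta> * bdry F \<zeta> = bdry I \<zeta> * (cnj \<zeta> * bdry \<theta> \<zeta> * cnj (bdry I \<zeta> * bdry I2 \<zeta> * bdry F \<zeta>))"
      by (rule arg_cong[OF elim(1)])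
    also have "\<dots> = (bdry I \<zeta> * cnj (bdry I \<zeta>)) * (cnj \<zeta> * bdry \<theta> \<zeta> * cnj (bdry f2 \<zeta>))"
      unfolding elim(2) by (simp add: mult_ac)
    finally show ?case unfolding ii by simp
  qed
  have pw: "Outer v z = of_real c * disk_power F (2 / p) z" if z: "norm z < 1" for z
  proof -
    have "(\<lambda>\<zeta>. 2 / p * u \<zeta>) = (\<lambda>\<zeta>. v \<zeta> + - ln c)" using p0 by (simp add: u_def fun_eq_iff)
    then have "disk_power F (2 / p) z = Outer (\<lambda>\<zeta>. v \<zeta> + - ln c) z"
      unfolding F_def disk_power_Outer[OF ui z] by simp
    also have "\<dots> = of_real (exp (- ln c)) * Outer v z" by (rule Outer_add_const[OF vi z])
    finally show ?thesis using c0 by (simp add: exp_minus)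
  qed
  have dpb: "has_bdry (disk_power F (2 / p))"
  proof -
    have "AE \<zeta> in ?M. has_angular_limit (disk_power F (2 / p)) \<zeta> (bdry (Outer (\<lambda>\<zeta>. 2 / p * u \<zeta>)) \<zeta>)"
      using Outer_bdry(1)[of "\<lambda>\<zeta>. 2 / p * u \<zeta>", unfolded has_bdry_def] ui
        angular_limit_cong[of "disk_power F (2 / p)" "Outer (\<lambda>\<zeta>. 2 / p * u \<zeta>)"] disk_power_Outer[OF ui]
      unfolding F_def by simp
    then show ?thesis by (rule has_bdryI)
  qed
  have "bdry (Outer v) = bdry (\<lambda>z. of_real c * disk_power F (2 / p) z)"
    by (rule bdry_cong) (rule pw)
  then have pwb: "AE \<zeta> in ?M. bdry (Outer v) \<zeta> = of_real c * bdry (disk_power F (2 / p)) \<zeta>"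
    using bdry_cmult(2)[OF dpb, of "of_real c"] by simp
  have rep: "AE \<zeta> in ?M. err \<zeta> = of_real (dist_hardy p g) * cnj (bdry \<theta> \<zeta>) * bdry I \<zeta> * bdry (disk_power F (2 / p)) \<zeta>"
    using lift_bdry lb pwb \<theta>_inner(4)
  proof eventually_elim
    case (elim \<zeta>)
    have tt: "cnj (bdry \<theta> \<zeta>) * bdry \<theta> \<zeta> = 1"
      using elim(4) complex_norm_square[of "bdry \<theta> \<zeta>"] by (simp add: mult.commute)
    have "err \<zeta> = cnj (bdry \<theta> \<zeta>) * (bdry \<theta> \<zeta> * err \<zeta>)" unfolding mult.assoc[symmetric] tt by simp
    also have "bdry \<theta> \<zeta> * err \<zeta> = bdry I \<zeta> * (of_real c * bdry (disk_power F (2 / p)) \<zeta>)"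
      using elim(1-3) by metis
    finally show ?case by (simp add: c_def mult_ac)
  qed
  have "is_representation \<theta> p g q I F"
    by (rule representationI[OF ui _ _ F0 norm1 I(1) Fh2 f1h f2h K1 K2 rep, of 1]) (simp_all add: F_def)
  then show ?thesis by blast
qed

text \<open>Taking moduli in the representation determines \<open>\<bar>F\<bar>\<close> almost everywhere on the circle, and an outer
  function that is positive at 0 is determined by its boundary modulus. Dividing by the common factors
  then gives \<open>I\<close> on the circle.\<close>

lemma representation_unique:
  assumes pos: "dist_hardy p g \<noteq> 0"
    and R: "is_representation \<theta> p g q I F" and R': "is_representation \<theta> p g q I' F'" and z: "norm z < 1"
  shows "I z = I' z \<and> F z = F' z"
proof -
  let ?M = circle_measure
  have c0: "dist_hardy p g > 0" using pos dist_nonneg by simp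
  have modulus: "\<exists>u. integrable ?M u \<and> (\<forall>z. norm z < 1 \<longrightarrow> F z = Outer u z) \<and>
      (AE \<zeta> in ?M. norm (err \<zeta>) = dist_hardy p g * exp (2 / p * u \<zeta>) \<and> bdry (disk_power F (2 / p)) \<zeta> \<noteq> 0)"
    if R: "is_representation \<theta> p g q I F" for I F
  proof -
    from R have "outer_function F" "Im (F 0) = 0" "Re (F 0) > 0" by (auto simp: is_representation_def)
    then obtain u where u: "integrable ?M u" "\<And>z. norm z < 1 \<Longrightarrow> F z = Outer u z"
      by (rule outer_function_positive) blast
    have ui: "integrable ?M (\<lambda>\<zeta>. 2 / p * u \<zeta>)" using u(1) by (rule integrable_mult_right)
    have "disk_power F (2 / p) = disk_power (Outer u) (2 / p)" by (rule disk_power_cong) (rule u(2))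
    moreover have "bdry (disk_power (Outer u) (2 / p)) = bdry (Outer (\<lambda>\<zeta>. 2 / p * u \<zeta>))"
      by (rule bdry_cong) (rule disk_power_Outer[OF u(1)])
    ultimately have dp: "bdry (disk_power F (2 / p)) = bdry (Outer (\<lambda>\<zeta>. 2 / p * u \<zeta>))" by simp
    have Iu: "AE \<zeta> in ?M. norm (bdry I \<zeta>) = 1" and eq: "AE \<zeta> in ?M. err \<zeta> =
        of_real (dist_hardy p g) * cnj (bdry \<theta> \<zeta>) * bdry I \<zeta> * bdry (disk_power F (2 / p)) \<zeta>"
      using R by (auto simp: is_representation_def inner_function_def err_def)
    have "AE \<zeta> in ?M. norm (err \<zeta>) = dist_hardy p g * exp (2 / p * u \<zeta>) \<and> bdry (disk_power F (2 / p)) \<zeta> \<noteq> 0"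
      using eq Iu \<theta>_inner(4) Outer_bdry(2)[OF ui] unfolding dp
    proof eventually_elim
      case (elim \<zeta>)
      have "norm (err \<zeta>) = dist_hardy p g * exp (2 / p * u \<zeta>)"
        unfolding elim(1) norm_mult using elim(2-4) c0 by simp
      moreover have "bdry (Outer (\<lambda>\<zeta>. 2 / p * u \<zeta>)) \<zeta> \<noteq> 0" using elim(4) by auto
      ultimately show ?case by blast
    qed
    with u show ?thesis by blast
  qed
  obtain u where u: "integrable ?M u" "\<And>z. norm z < 1 \<Longrightarrow> F z = Outer u z"
    "AE \<zeta> in ?M. norm (err \<zeta>) = dist_hardy p g * exp (2 / p * u \<zeta>) \<and> bdry (disk_power F (2 / p)) \<zeta> \<noteq> 0"
    using modulus[OF R] by blast
  obtain u' where u': "integrable ?M u'" "\<And>z. norm z < 1 \<Longrightarrow> F' z = Outer u' z"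
    "AE \<zeta> in ?M. norm (err \<zeta>) = dist_hardy p g * exp (2 / p * u' \<zeta>) \<and> bdry (disk_power F' (2 / p)) \<zeta> \<noteq> 0"
    using modulus[OF R'] by blast
  have uu: "AE \<zeta> in ?M. u \<zeta> = u' \<zeta>"
    using u(3) u'(3)
  proof eventually_elim
    case (elim \<zeta>)
    have "dist_hardy p g * exp (2 / p * u \<zeta>) = dist_hardy p g * exp (2 / p * u' \<zeta>)"
      by (rule trans[OF sym[OF conjunct1[OF elim(1)]] conjunct1[OF elim(2)]])
    then have "2 / p * u \<zeta> = 2 / p * u' \<zeta>" using c0 by simp
    then show ?case using p0 by simp
  qed
  have "schwarz u z = schwarz u' z" for z
    by (rule schwarz_cong_AE[OF uu]) (use u(1) u'(1) in measurable)
  then have FF: "F z = F' z" if "norm z < 1" for z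
    using u(2)[OF that] u'(2)[OF that] by (simp add: Outer_def)
  have dpe: "disk_power F (2 / p) = disk_power F' (2 / p)" by (rule disk_power_cong) (rule FF)
  have eq: "AE \<zeta> in ?M. err \<zeta> =
        of_real (dist_hardy p g) * cnj (bdry \<theta> \<zeta>) * bdry I \<zeta> * bdry (disk_power F (2 / p)) \<zeta>"
    and eq': "AE \<zeta> in ?M. err \<zeta> =
        of_real (dist_hardy p g) * cnj (bdry \<theta> \<zeta>) * bdry I' \<zeta> * bdry (disk_power F (2 / p)) \<zeta>"
    and In: "inner_function I" "inner_function I'"
    using R R' by (simp_all add: is_representation_def err_def dpe)
  have II: "AE \<zeta> in ?M. bdry I \<zeta> = bdry I' \<zeta>"
    using eq eq' u(3) \<theta>_inner(4)
  proof eventually_elim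
    case (elim \<zeta>)
    have "of_real (dist_hardy p g) * cnj (bdry \<theta> \<zeta>) * bdry (disk_power F (2 / p)) \<zeta> \<noteq> 0"
      using c0 elim(3,4) by auto
    moreover have "of_real (dist_hardy p g) * cnj (bdry \<theta> \<zeta>) * bdry (disk_power F (2 / p)) \<zeta> * bdry I \<zeta>
        = of_real (dist_hardy p g) * cnj (bdry \<theta> \<zeta>) * bdry (disk_power F (2 / p)) \<zeta> * bdry I' \<zeta>"
      using elim(1,2) by (metis mult.assoc mult.commute)
    ultimately show ?case by (metis mult_cancel_left)
  qed
  note J = inner_function_bounded[OF In(1)] and J' = inner_function_bounded[OF In(2)]
  have "I z = poisson (bdry I) z" by (rule bounded_analytic_bdry(3)[OF J(1,2) z])
  also have "\<dots> = poisson (bdry I') z"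
    by (rule poisson_cong_AE[OF II])
       (intro bdry_measurable holomorphic_on_imp_continuous_on J(1) J'(1))+
  also have "\<dots> = I' z" by (rule bounded_analytic_bdry(3)[OF J'(1,2) z, symmetric])
  finally show ?thesis using FF[OF z] by simp
qed

end

theorem theorem2:
  fixes \<theta> g p\<^sub>g :: "complex \<Rightarrow> complex" and p :: real
  assumes "inner_function \<theta>" and "\<not> \<theta> constant_on ball 0 1"
    and "1 \<le> p"
    and "g \<in> conj_mult_hardy \<theta> p"
    and "best_hardy_approx p g p\<^sub>g"
  shows "(\<exists>I F. is_representation \<theta> p g p\<^sub>g I F) \<and>
         (g \<notin> hardy_circle p \<longrightarrow>
            (\<forall>I F I' F'. is_representation \<theta> p g p\<^sub>g I F \<and> is_representation \<theta> p g p\<^sub>g I' F' \<longrightarrow>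
               (\<forall>z\<in>ball 0 1. I z = I' z \<and> F z = F' z)))"
proof -
  obtain h where h: "h \<in> hardy p" "AE \<zeta> in circle_measure. g \<zeta> = cnj (bdry \<theta> \<zeta>) * bdry h \<zeta>"
    and gL: "g \<in> Lp p"
    using assms(4) by (auto simp: conj_mult_hardy_def)
  have q: "p\<^sub>g \<in> hardy p" "Lp_norm p (\<lambda>\<zeta>. g \<zeta> - bdry p\<^sub>g \<zeta>) = dist_hardy p g"
    using assms(5) by (auto simp: best_hardy_approx_def)
  interpret best_approximation \<theta> g p\<^sub>g h p
    by unfold_locales (use assms h q gL in \<open>auto simp: Lp_def\<close>)
  have "\<exists>I F. is_representation \<theta> p g p\<^sub>g I F"
    using representation_dist_zero[OF assms(2)] representation_dist_pos by blast
  moreover have "I z = I' z \<and> F z = F' z"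
    if g: "g \<notin> hardy_circle p" and R: "is_representation \<theta> p g p\<^sub>g I F" "is_representation \<theta> p g p\<^sub>g I' F'"
      and z: "z \<in> ball 0 1" for I F I' F' z
  proof -
    have "dist_hardy p g \<noteq> 0"
    proof
      assume "dist_hardy p g = 0"
      then have "AE \<zeta> in circle_measure. g \<zeta> = bdry p\<^sub>g \<zeta>"
        using err_zero by (auto simp: err_def)
      then have "g \<in> hardy_circle p" using gL q(1) by (auto simp: hardy_circle_def)
      with g show False by simp
    qed
    from representation_unique[OF this R] z show ?thesis by simp
  qed
  ultimately show ?thesis by blast
qed

end
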